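(* Any pipeline built by composing, as a linear chain, stateful, stateless and partitioned stateful operators, each implemented by the corresponding operator implementation described in the context, and executed using the dynamic runtime described in the context, only allows ordered executions. That is, for every concurrent execution of such a pipeline on any input sequence $i_1,i_2,i_3,\dots$, the output sequence $o_1,o_2,o_3,\dots$ produced by the execution is the same output sequence as the one produced by a sequential execution of the pipeline on $i_1,i_2,i_3,\dots$.
   Context: Operators. An operator maps each input tuple to a sequence of zero or more output tuples. - Stateless: a pure function of the input tuple, with no associated state. - Stateful: there is an internal state that is accessed and updated during the computation. - Partitioned stateful: every input tuple has a key, and processing a tuple accesses and updates only the part of the state determined by its key, these parts being disjoint for different keys. A fixed function maps keys to finitely many partitions; getPartition(tuple) is the partition of the tuple's key. Linear chain: the outputs of each operator are the inputs of the next (downstream) one; the inputs of the first operator are the pipeline inputs, and the outputs of the last operator are the pipeline outputs. Sequential execution: the inputs are processed serially, one at a time, in the order of their arrival. Ordered execution (definition): a concurrent execution of a streaming computation on any input sequence $i_1,i_2,i_3,\dots$ is ordered if and only if the output sequence $o_1,o_2,o_3,\dots$ it produces is the same output sequence produced by a sequential execution of the pipeline on $i_1,i_2,i_3,\dots$. Concurrency model. Worker threads run concurrently on shared memory. Operations on atomic variables and on queues are atomic (linearizable) and sequentially consistent. fetch_add(1), fetch_sub(1) atomically increment/decrement and return the old value; test_and_set() sets a flag and returns its previous value; clear() resets it. Queues are linearizable concurrent FIFO queues; tryDequeue($x$) removes the head into $x$ and returns true if the queue is non-empty, and otherwise returns false. Dynamic runtime. Each operator has a worklist (or worklists) holding its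 pending inputs. The number of workers equals the number of available cores. Each worker repeatedly queries a central scheduler, which allots it to an operator and specifies a maximum number of tuples to process there (computed from a constant time slice and the operator's per-tuple processing cost). The worker takes inputs from the operator's worklist, processes them according to the operator's implementation, and then returns to the scheduler for more work; if the worklist becomes empty before the specified number of tuples is processed, the worker does not block but returns to the scheduler. The scheduler considers only schedulable operators: those whose worklist is non-empty and whose currently allotted number of workers is less than the maximum allowed degree of parallelism, which is 1 for a stateful operator, the number of partitions for a partitioned stateful operator, and unlimited (essentially the number of cores) for a stateless operator. Among these, it chooses by a scheduling heuristic, a rule that may use estimated operator characteristics (per-tuple cost, selectivity), current worklist sizes, and observed throughput and latency; no particular heuristic is fixed in the statement. Adding inputs to an operator: outputs sent downstream by an operator are added to the worklist of the downstream operator (or leave the pipeline, for the last operator). For stateless and partitioned stateful operators, each input is assigned, when it is added, a unique serial number $1,2,3,\dots$ in order of arrival, using an atomic counter. All the outputs produced from the input with serial number $t$ are treated together as one unit, denoted $o_t$ in the procedures below, different from the special value EMPTY. Reordering buffer (one per stateless or partitioned stateful operator), of size $s$: atomic integer next, initially 1; array buffer$[0..s-1]$ of atomic cells, initially EMPTY; an atomic flag, initially clear. send($o_t$): success := try_add($o_t$); send_pending_outputs(); return success. try_add($o_t$): $n$ := next.load(); if $t\ge n$ and $t<n+s$, then buffer$[t \bmod s]$.set($o_t$) and return true; otherwise return false. send_pending_outputs(): 1. if flag.test_and_set() returns true, return; otherwise continue 2. loop forever: (a) $n$ := next.load(); $i := n \bmod s$; $o$ := buffer$[i]$.load() (b)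 if $o\ne$ EMPTY: send $o$ downstream; then buffer$[i]$.set(EMPTY); then next.fetch_add(1) (c) otherwise: flag.clear() and exit the loop 3. $o$ := buffer$[i]$.load(); if $o\ne$ EMPTY, call send_pending_outputs() Operator implementations. - Stateful: the worklist is a single-producer single-consumer concurrent queue, to which a worker of the upstream operator adds inputs. Only a single worker is allotted to the operator at any time; it consumes the inputs serially and adds the corresponding outputs to the worklist of the downstream operator. - Stateless: the worklist is a shared multi-producer multi-consumer concurrent queue. Each allotted worker dequeues an input (with serial number $t$), processes it to produce $o_t$, and calls send($o_t$) of the operator's reordering buffer; if the call fails (returns false), the worker tries again until it succeeds. - Partitioned stateful: the worklist consists of a FIFO queue masterQueue of partition identifiers and, for each partition $p$, a FIFO queue partitionQueues$[p]$ of tuples, all initially empty, together with an atomic counter count$[p]$, initially 0. An input is added by addInput(tuple): $p$ := getPartition(tuple); partitionQueues$[p]$.enqueue(tuple); masterQueue.enqueue($p$). Allotted workers consume inputs by consumeInputs(): while masterQueue.tryDequeue($p$) returns true: if count$[p]$.fetch_add(1) returns 0: do partitionQueues$[p]$.tryDequeue(tuple); operate(tuple) while count$[p]$.fetch_sub(1) returns a value $>1$ Here operate(tuple) is the processing of the tuple (with serial number $t$) to produce $o_t$, which the worker sends downstream by calling send($o_t$) of the operator's reordering buffer, trying again if the call fails. Variables not declared as shared are local to each invocation.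
   Formalization: Equality of output sequences is claimed for executions in which no thread is suspended forever and, for infinite input, the scheduling heuristic never ignores forever an operator that stays schedulable; for all other executions the output is always a prefix of the sequential output. *)

theory Defs
  imports Main "HOL-Library.Sublist"
begin

section \<open>Operators and pipelines\<close>

text \<open>
  All tuples of a pipeline live in one type \<open>'a\<close> and all pieces of operator state in one
  type \<open>'s\<close>; chains with different tuple or state types are covered by taking sum types.

  \<open>Stateful s0 f\<close> has initial state \<open>s0\<close>. \<open>Partitioned n key part s0 f\<close> has \<open>n\<close> partitions and
  extracts the key of a tuple by \<open>key\<close>; \<open>part\<close> maps keys to partitions (so getPartition is
  \<open>part \<circ> key\<close>), and \<open>s0 c\<close> is the initial content of the part of the state belonging to key \<open>c\<close>,
  the only part that \<open>f\<close> sees and changes on a tuple with key \<open>c\<close>.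
\<close>

datatype ('a, 'k, 's) operator =
    Stateless "'a \<Rightarrow> 'a list"
  | Stateful 's "'s \<Rightarrow> 'a \<Rightarrow> 's \<times> 'a list"
  | Partitioned nat "'a \<Rightarrow> 'k" "'k \<Rightarrow> nat" "'k \<Rightarrow> 's" "'s \<Rightarrow> 'a \<Rightarrow> 's \<times> 'a list"

text \<open>
  The memory of an operator: location \<open>None\<close> holds the state of a stateful operator, location
  \<open>Some c\<close> the part for key \<open>c\<close> of the state of a partitioned stateful operator.
\<close>

type_synonym ('k, 's) memory = "'k option \<Rightarrow> 's"

fun init_mem :: "('a, 'k, 's) operator \<Rightarrow> ('k, 's) memory" where
  "init_mem (Stateless f) = (\<lambda>_. undefined)"
| "init_mem (Stateful s0 f) = (\<lambda>_. s0)"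
| "init_mem (Partitioned n key part s0 f) = (\<lambda>l. case l of None \<Rightarrow> undefined | Some c \<Rightarrow> s0 c)"

text \<open>\<open>bufsize P k\<close> is the size of the reordering buffer of the \<open>k\<close>-th operator (counting from 0).\<close>

record ('a, 'k, 's) pipeline =
  ops :: "('a, 'k, 's) operator list"
  bufsize :: "nat \<Rightarrow> nat"
  cores :: nat

definition valid_pipeline :: "('a, 'k, 's) pipeline \<Rightarrow> bool" where
  "valid_pipeline P \<longleftrightarrow>
     0 < cores P \<and> (\<forall>k < length (ops P). 0 < bufsize P k) \<and>
     (\<forall>n key part s0 f. Partitioned n key part s0 f \<in> set (ops P) \<longrightarrow> (\<forall>c. part c < n))"


section \<open>Sequential execution\<close>

fun apply_op :: "('a, 'k, 's) operator \<Rightarrow> ('k, 's) memory \<Rightarrow> 'a \<Rightarrow> ('k, 's) memory \<times> 'a list" where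
  "apply_op (Stateless f) m x = (m, f x)"
| "apply_op (Stateful s0 f) m x = (let (s, ys) = f (m None) x in (m(None := s), ys))"
| "apply_op (Partitioned n key part s0 f) m x =
     (let (s, ys) = f (m (Some (key x))) x in (m(Some (key x) := s), ys))"

fun apply_op_list ::
  "('a, 'k, 's) operator \<Rightarrow> ('k, 's) memory \<Rightarrow> 'a list \<Rightarrow> ('k, 's) memory \<times> 'a list" where
  "apply_op_list p m [] = (m, [])"
| "apply_op_list p m (x # xs) =
     (let (m1, ys) = apply_op p m x; (m2, zs) = apply_op_list p m1 xs in (m2, ys @ zs))"

fun apply_chain ::
  "(('a, 'k, 's) operator \<times> ('k, 's) memory) list \<Rightarrow> 'a list \<Rightarrow>
   (('a, 'k, 's) operator \<times> ('k, 's) memory) list \<times> 'a list" where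
  "apply_chain [] xs = ([], xs)"
| "apply_chain ((p, m) # c) xs =
     (let (m', ys) = apply_op_list p m xs; (c', zs) = apply_chain c ys in ((p, m') # c', zs))"

text \<open>Each input passes through the whole chain before the next one is looked at.\<close>

fun run_chain :: "(('a, 'k, 's) operator \<times> ('k, 's) memory) list \<Rightarrow> 'a list \<Rightarrow> 'a list" where
  "run_chain c [] = []"
| "run_chain c (x # xs) = (let (c', ys) = apply_chain c [x] in ys @ run_chain c' xs)"

definition sequential_outputs :: "('a, 'k, 's) pipeline \<Rightarrow> 'a list \<Rightarrow> 'a list" where
  "sequential_outputs P xs = run_chain (map (\<lambda>p. (p, init_mem p)) (ops P)) xs"


section \<open>Finite or infinite sequences\<close>

text \<open>
  A finite or infinite sequence is a function \<open>nat \<Rightarrow> 'a option\<close> that is \<open>None\<close> exactly beyond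
  its end.
\<close>

definition valid_seq :: "(nat \<Rightarrow> 'a option) \<Rightarrow> bool" where
  "valid_seq inp \<longleftrightarrow> (\<forall>n. inp n = None \<longrightarrow> inp (Suc n) = None)"

definition first :: "nat \<Rightarrow> (nat \<Rightarrow> 'a option) \<Rightarrow> 'a list" where
  "first n inp = List.map_filter inp [0..<n]"

text \<open>The limit of a chain of lists that is increasing with respect to the prefix order.\<close>

definition limit :: "(nat \<Rightarrow> 'a list) \<Rightarrow> nat \<Rightarrow> 'a option" where
  "limit F j = (if \<exists>i. j < length (F i) then Some (F (LEAST i. j < length (F i)) ! j) else None)"

definition sequential_output_seq ::
  "('a, 'k, 's) pipeline \<Rightarrow> (nat \<Rightarrow> 'a option) \<Rightarrow> nat \<Rightarrow> 'a option" where
  "sequential_output_seq P inp = limit (\<lambda>n. sequential_outputs P (first n inp))"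


section \<open>Shared memory of the concurrent runtime\<close>

text \<open>
  The shared data of one operator; each kind of operator uses only some of the components.
  \<open>squeue\<close> is the worklist of a stateful operator, \<open>queue\<close> that of a stateless one; \<open>master\<close>,
  \<open>parts\<close> and \<open>cnt\<close> are masterQueue, partitionQueues and count of a partitioned stateful operator.
  Heads of queues are heads of lists. \<open>serial\<close> is the counter that supplies serial numbers, which
  travel with the tuples. In the reordering buffer \<open>None\<close> is EMPTY and \<open>Some u\<close> is a unit: the
  list of all outputs of one input (so \<open>Some []\<close> differs from EMPTY).
\<close>

record ('a, 'k, 's) opdata =
  mem :: "('k, 's) memory"
  squeue :: "'a list"
  queue :: "(nat \<times> 'a) list"
  master :: "nat list"
  parts :: "nat \<Rightarrow> (nat \<times> 'a) list"
  cnt :: "nat \<Rightarrow> int"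
  serial :: nat
  nxt :: nat
  buffer :: "nat \<Rightarrow> 'a list option"
  flag :: bool

record ('a, 'k, 's) shared =
  opd :: "nat \<Rightarrow> ('a, 'k, 's) opdata"
  outs :: "'a list"

definition modify ::
  "nat \<Rightarrow> (('a, 'k, 's) opdata \<Rightarrow> ('a, 'k, 's) opdata) \<Rightarrow>
   ('a, 'k, 's) shared \<Rightarrow> ('a, 'k, 's) shared" where
  "modify k g S = S\<lparr>opd := (opd S)(k := g (opd S k))\<rparr>"

definition init_opdata :: "('a, 'k, 's) operator \<Rightarrow> ('a, 'k, 's) opdata" where
  "init_opdata p =
     \<lparr>mem = init_mem p, squeue = [], queue = [], master = [], parts = (\<lambda>_. []), cnt = (\<lambda>_. 0),
      serial = 1, nxt = 1, buffer = (\<lambda>_. None), flag = False\<rparr>"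

definition init_shared :: "('a, 'k, 's) pipeline \<Rightarrow> ('a, 'k, 's) shared" where
  "init_shared P = \<lparr>opd = (\<lambda>k. init_opdata (ops P ! k)), outs = []\<rparr>"


section \<open>Sending tuples downstream\<close>

text \<open>
  A delivery is a list of tuples that remain to be added one after the other to the worklist of an
  operator, and the progress made with the first of them. \<open>deliver P k\<close> performs one atomic action
  of a delivery to operator \<open>k\<close>; tuples sent beyond the last operator leave the pipeline.
\<close>

datatype stage = Start | Numbered nat | Enqueued

type_synonym 'a delivery = "'a list \<times> stage"

fun deliver ::
  "('a, 'k, 's) pipeline \<Rightarrow> nat \<Rightarrow> 'a delivery \<Rightarrow> ('a, 'k, 's) shared \<Rightarrow>
   'a delivery \<times> ('a, 'k, 's) shared" where
  "deliver P k ([], st) S = (([], st), S)"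
| "deliver P k (x # xs, st) S =
    (if length (ops P) \<le> k then ((xs, Start), S\<lparr>outs := outs S @ [x]\<rparr>)
     else case ops P ! k of
       Stateful s0 f \<Rightarrow>
         ((xs, Start), modify k (\<lambda>d. d\<lparr>squeue := squeue d @ [x]\<rparr>) S)
     | Stateless f \<Rightarrow>
         (case st of
            Numbered t \<Rightarrow> ((xs, Start), modify k (\<lambda>d. d\<lparr>queue := queue d @ [(t, x)]\<rparr>) S)
          | _ \<Rightarrow> ((x # xs, Numbered (serial (opd S k))), modify k (\<lambda>d. d\<lparr>serial := serial d + 1\<rparr>) S))
     | Partitioned n key part s0 f \<Rightarrow>
         (let p = part (key x) in
          case st of
            Start \<Rightarrow>
              ((x # xs, Numbered (serial (opd S k))), modify k (\<lambda>d. d\<lparr>serial := serial d + 1\<rparr>) S)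
          | Numbered t \<Rightarrow>
              ((x # xs, Enqueued),
               modify k (\<lambda>d. d\<lparr>parts := (parts d)(p := parts d p @ [(t, x)])\<rparr>) S)
          | Enqueued \<Rightarrow>
              ((xs, Start), modify k (\<lambda>d. d\<lparr>master := master d @ [p]\<rparr>) S)))"


section \<open>Workers\<close>

text \<open>
  Arguments of a call of send: the serial number, the unit, and the partition that the caller is
  serving (\<open>None\<close> for a stateless operator).
\<close>

type_synonym 'a job = "nat option \<times> nat \<times> 'a list"

text \<open>
  Program counters together with the live local variables. In the part belonging to send, the
  boolean is the variable success and the number is the buffer index \<open>i\<close>.
\<close>

datatype ('a, 's) pc =
    Fetch
  | Return
    \<comment> \<open>stateful\<close>
  | SRead 'a
  | SWrite 'a 's
  | SSend "'a delivery"
    \<comment> \<open>stateless\<close>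
  | Compute nat 'a
    \<comment> \<open>partitioned stateful: consumeInputs\<close>
  | PEnter nat
  | PTake nat
  | PRead nat nat 'a
  | PWrite nat nat 'a 's
  | PLeave nat
    \<comment> \<open>try_add\<close>
  | AddLoad "'a job"
  | AddStore "'a job"
    \<comment> \<open>send_pending_outputs\<close>
  | Tas "'a job" bool
  | LoadNext "'a job" bool
  | LoadCell "'a job" bool nat
  | Forward "'a job" bool nat "'a delivery"
  | EmptyCell "'a job" bool nat
  | IncNext "'a job" bool
  | ClearFlag "'a job" bool nat
  | Recheck "'a job" bool nat

text \<open>Where a worker continues after send: it retries on failure.\<close>

fun resume :: "'a job \<Rightarrow> bool \<Rightarrow> ('a, 's) pc" where
  "resume j False = AddLoad j"
| "resume (None, t, u) True = Fetch"
| "resume (Some p, t, u) True = PLeave p"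

text \<open>
  One atomic action of a worker allotted to operator \<open>k\<close>. The first component is the number of
  inputs that the worker may still take from the worklist before it has to return to the scheduler.
  Access to operator state takes two actions (a read and a later write), so that mutual exclusion is
  not built in. The pseudocode ignores the result of the inner tryDequeue; should it fail, the
  worker proceeds with an arbitrary tuple (rule \<open>p_take_fail\<close>).
\<close>

inductive work ::
  "('a, 'k, 's) pipeline \<Rightarrow> nat \<Rightarrow>
   nat \<times> ('a, 's) pc \<times> ('a, 'k, 's) shared \<Rightarrow>
   nat \<times> ('a, 's) pc \<times> ('a, 'k, 's) shared \<Rightarrow> bool"
  for P k where
  exhausted: "work P k (0, Fetch, S) (0, Return, S)"

| s_none: "\<lbrakk>ops P ! k = Stateful s0 f; squeue (opd S k) = []\<rbrakk> \<Longrightarrow>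
    work P k (Suc q, Fetch, S) (Suc q, Return, S)"
| s_take: "\<lbrakk>ops P ! k = Stateful s0 f; squeue (opd S k) = x # xs\<rbrakk> \<Longrightarrow>
    work P k (Suc q, Fetch, S) (q, SRead x, modify k (\<lambda>d. d\<lparr>squeue := xs\<rparr>) S)"
| s_read: "work P k (q, SRead x, S) (q, SWrite x (mem (opd S k) None), S)"
| s_write: "\<lbrakk>ops P ! k = Stateful s0 f; f s x = (s', ys)\<rbrakk> \<Longrightarrow>
    work P k (q, SWrite x s, S)
      (q, SSend (ys, Start), modify k (\<lambda>d. d\<lparr>mem := (mem d)(None := s')\<rparr>) S)"
| s_send: "\<lbrakk>fst d \<noteq> []; deliver P (Suc k) d S = (d', S')\<rbrakk> \<Longrightarrow>
    work P k (q, SSend d, S) (q, SSend d', S')"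
| s_done: "fst d = [] \<Longrightarrow> work P k (q, SSend d, S) (q, Fetch, S)"

| l_none: "\<lbrakk>ops P ! k = Stateless f; queue (opd S k) = []\<rbrakk> \<Longrightarrow>
    work P k (Suc q, Fetch, S) (Suc q, Return, S)"
| l_take: "\<lbrakk>ops P ! k = Stateless f; queue (opd S k) = (t, x) # xs\<rbrakk> \<Longrightarrow>
    work P k (Suc q, Fetch, S) (q, Compute t x, modify k (\<lambda>d. d\<lparr>queue := xs\<rparr>) S)"
| l_compute: "ops P ! k = Stateless f \<Longrightarrow>
    work P k (q, Compute t x, S) (q, AddLoad (None, t, f x), S)"

| p_none: "\<lbrakk>ops P ! k = Partitioned n key part s0 f; master (opd S k) = []\<rbrakk> \<Longrightarrow>
    work P k (Suc q, Fetch, S) (Suc q, Return, S)"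
| p_fetch: "\<lbrakk>ops P ! k = Partitioned n key part s0 f; master (opd S k) = p # ps\<rbrakk> \<Longrightarrow>
    work P k (Suc q, Fetch, S) (q, PEnter p, modify k (\<lambda>d. d\<lparr>master := ps\<rparr>) S)"
| p_enter: "work P k (q, PEnter p, S)
      (q, if cnt (opd S k) p = 0 then PTake p else Fetch,
       modify k (\<lambda>d. d\<lparr>cnt := (cnt d)(p := cnt d p + 1)\<rparr>) S)"
| p_take: "parts (opd S k) p = (t, x) # xs \<Longrightarrow>
    work P k (q, PTake p, S)
      (q, PRead p t x, modify k (\<lambda>d. d\<lparr>parts := (parts d)(p := xs)\<rparr>) S)"
| p_take_fail: "parts (opd S k) p = [] \<Longrightarrow>
    work P k (q, PTake p, S) (q, PRead p t x, S)"
| p_read: "ops P ! k = Partitioned n key part s0 f \<Longrightarrow>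
    work P k (q, PRead p t x, S) (q, PWrite p t x (mem (opd S k) (Some (key x))), S)"
| p_write: "\<lbrakk>ops P ! k = Partitioned n key part s0 f; f s x = (s', ys)\<rbrakk> \<Longrightarrow>
    work P k (q, PWrite p t x s, S)
      (q, AddLoad (Some p, t, ys), modify k (\<lambda>d. d\<lparr>mem := (mem d)(Some (key x) := s')\<rparr>) S)"
| p_leave: "work P k (q, PLeave p, S)
      (q, if cnt (opd S k) p > 1 then PTake p else Fetch,
       modify k (\<lambda>d. d\<lparr>cnt := (cnt d)(p := cnt d p - 1)\<rparr>) S)"

| add_load: "work P k (q, AddLoad (po, t, u), S)
      (q, if nxt (opd S k) \<le> t \<and> t < nxt (opd S k) + bufsize P k
          then AddStore (po, t, u) else Tas (po, t, u) False, S)"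
| add_store: "work P k (q, AddStore (po, t, u), S)
      (q, Tas (po, t, u) True,
       modify k (\<lambda>d. d\<lparr>buffer := (buffer d)(t mod bufsize P k := Some u)\<rparr>) S)"

| tas_set: "flag (opd S k) \<Longrightarrow>
    work P k (q, Tas j b, S) (q, resume j b, S)"
| tas_clear: "\<not> flag (opd S k) \<Longrightarrow>
    work P k (q, Tas j b, S) (q, LoadNext j b, modify k (\<lambda>d. d\<lparr>flag := True\<rparr>) S)"
| load_next: "work P k (q, LoadNext j b, S)
      (q, LoadCell j b (nxt (opd S k) mod bufsize P k), S)"
| cell_full: "buffer (opd S k) i = Some u \<Longrightarrow>
    work P k (q, LoadCell j b i, S) (q, Forward j b i (u, Start), S)"
| cell_empty: "buffer (opd S k) i = None \<Longrightarrow>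
    work P k (q, LoadCell j b i, S) (q, ClearFlag j b i, S)"
| forward: "\<lbrakk>fst d \<noteq> []; deliver P (Suc k) d S = (d', S')\<rbrakk> \<Longrightarrow>
    work P k (q, Forward j b i d, S) (q, Forward j b i d', S')"
| forward_done: "fst d = [] \<Longrightarrow>
    work P k (q, Forward j b i d, S) (q, EmptyCell j b i, S)"
| empty_cell: "work P k (q, EmptyCell j b i, S)
      (q, IncNext j b, modify k (\<lambda>d. d\<lparr>buffer := (buffer d)(i := None)\<rparr>) S)"
| inc_next: "work P k (q, IncNext j b, S)
      (q, LoadNext j b, modify k (\<lambda>d. d\<lparr>nxt := nxt d + 1\<rparr>) S)"
| clear_flag: "work P k (q, ClearFlag j b i, S)
      (q, Recheck j b i, modify k (\<lambda>d. d\<lparr>flag := False\<rparr>) S)"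
| recheck_full: "buffer (opd S k) i \<noteq> None \<Longrightarrow>
    work P k (q, Recheck j b i, S) (q, Tas j b, S)"
| recheck_empty: "buffer (opd S k) i = None \<Longrightarrow>
    work P k (q, Recheck j b i, S) (q, resume j b, S)"


section \<open>Scheduler and executions\<close>

text \<open>\<open>Busy k q c\<close>: allotted to operator \<open>k\<close>, may take \<open>q\<close> more inputs, program counter \<open>c\<close>.\<close>

datatype ('a, 's) worker = Idle | Busy nat nat "('a, 's) pc"

text \<open>
  \<open>arrived\<close> counts the pipeline inputs that have arrived so far; \<open>incoming\<close> is the delivery of the
  latest one to the first operator.
\<close>

record ('a, 'k, 's) state =
  shared :: "('a, 'k, 's) shared"
  workers :: "nat \<Rightarrow> ('a, 's) worker"
  arrived :: nat
  incoming :: "'a delivery"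

definition init_state :: "('a, 'k, 's) pipeline \<Rightarrow> ('a, 'k, 's) state" where
  "init_state P =
     \<lparr>shared = init_shared P, workers = (\<lambda>_. Idle), arrived = 0, incoming = ([], Start)\<rparr>"

definition allotted :: "('a, 'k, 's) pipeline \<Rightarrow> ('a, 'k, 's) state \<Rightarrow> nat \<Rightarrow> nat" where
  "allotted P G k = card {w. w < cores P \<and> (\<exists>q c. workers G w = Busy k q c)}"

definition schedulable :: "('a, 'k, 's) pipeline \<Rightarrow> ('a, 'k, 's) state \<Rightarrow> nat \<Rightarrow> bool" where
  "schedulable P G k \<longleftrightarrow> k < length (ops P) \<and>
     (case ops P ! k of
        Stateful s0 f \<Rightarrow> squeue (opd (shared G) k) \<noteq> [] \<and> allotted P G k < 1
      | Stateless f \<Rightarrow> queue (opd (shared G) k) \<noteq> []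
      | Partitioned n key part s0 f \<Rightarrow> master (opd (shared G) k) \<noteq> [] \<and> allotted P G k < n)"

datatype agent = Source | Worker nat

text \<open>
  One atomic action of an agent. The heuristic of the scheduler and its choice of the maximum number
  of tuples are left completely open (rule \<open>allot\<close>), which covers every heuristic. Every agent can
  act in every reachable state: an idle worker whose query finds no schedulable operator, and a
  source whose inputs have all arrived, perform an action without effect.
\<close>

inductive step ::
  "('a, 'k, 's) pipeline \<Rightarrow> (nat \<Rightarrow> 'a option) \<Rightarrow> agent \<Rightarrow>
   ('a, 'k, 's) state \<Rightarrow> ('a, 'k, 's) state \<Rightarrow> bool"
  for P inp where
  allot: "\<lbrakk>w < cores P; workers G w = Idle; schedulable P G k; 0 < q\<rbrakk> \<Longrightarrow>
    step P inp (Worker w) G (G\<lparr>workers := (workers G)(w := Busy k q Fetch)\<rparr>)"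
| no_work: "\<lbrakk>w < cores P; workers G w = Idle; \<forall>k. \<not> schedulable P G k\<rbrakk> \<Longrightarrow>
    step P inp (Worker w) G G"
| act: "\<lbrakk>w < cores P; workers G w = Busy k q c; work P k (q, c, shared G) (q', c', S')\<rbrakk> \<Longrightarrow>
    step P inp (Worker w) G
      (G\<lparr>shared := S', workers := (workers G)(w := Busy k q' c')\<rparr>)"
| return: "\<lbrakk>w < cores P; workers G w = Busy k q Return\<rbrakk> \<Longrightarrow>
    step P inp (Worker w) G (G\<lparr>workers := (workers G)(w := Idle)\<rparr>)"
| arrive: "\<lbrakk>fst (incoming G) = []; inp (arrived G) = Some x\<rbrakk> \<Longrightarrow>
    step P inp Source G (G\<lparr>arrived := arrived G + 1, incoming := ([x], Start)\<rparr>)"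
| feed: "\<lbrakk>fst (incoming G) \<noteq> []; deliver P 0 (incoming G) (shared G) = (d', S')\<rbrakk> \<Longrightarrow>
    step P inp Source G (G\<lparr>shared := S', incoming := d'\<rparr>)"
| no_input: "\<lbrakk>fst (incoming G) = []; inp (arrived G) = None\<rbrakk> \<Longrightarrow>
    step P inp Source G G"

text \<open>
  An execution: states \<open>\<sigma>\<close> and, for each action, the acting agent \<open>a\<close>. Executions are arbitrary
  interleavings; nothing is said yet about progress.
\<close>

definition execution ::
  "('a, 'k, 's) pipeline \<Rightarrow> (nat \<Rightarrow> 'a option) \<Rightarrow>
   (nat \<Rightarrow> ('a, 'k, 's) state) \<Rightarrow> (nat \<Rightarrow> agent) \<Rightarrow> bool" where
  "execution P inp \<sigma> a \<longleftrightarrow> \<sigma> 0 = init_state P \<and> (\<forall>i. step P inp (a i) (\<sigma> i) (\<sigma> (Suc i)))"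

definition query_at :: "(nat \<Rightarrow> ('a, 'k, 's) state) \<Rightarrow> (nat \<Rightarrow> agent) \<Rightarrow> nat \<Rightarrow> bool" where
  "query_at \<sigma> a i \<longleftrightarrow> (\<exists>w. a i = Worker w \<and> workers (\<sigma> i) w = Idle)"

definition allot_at :: "(nat \<Rightarrow> ('a, 'k, 's) state) \<Rightarrow> (nat \<Rightarrow> agent) \<Rightarrow> nat \<Rightarrow> nat \<Rightarrow> bool" where
  "allot_at \<sigma> a i k \<longleftrightarrow>
     (\<exists>w q. a i = Worker w \<and> workers (\<sigma> i) w = Idle \<and> workers (\<sigma> (Suc i)) w = Busy k q Fetch)"

text \<open>
  The heuristic does not starve an operator: among infinitely many queries, an operator that remains
  schedulable is eventually chosen.
\<close>

definition no_starvation ::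
  "('a, 'k, 's) pipeline \<Rightarrow> (nat \<Rightarrow> ('a, 'k, 's) state) \<Rightarrow> (nat \<Rightarrow> agent) \<Rightarrow> bool" where
  "no_starvation P \<sigma> a \<longleftrightarrow>
     (\<forall>k i. (\<exists>\<^sub>\<infinity>j. query_at \<sigma> a j) \<and> (\<forall>j\<ge>i. schedulable P (\<sigma> j) k) \<longrightarrow> (\<exists>j\<ge>i. allot_at \<sigma> a j k))"

text \<open>
  An execution is complete if no thread is suspended forever and, in case the input is infinite, the
  heuristic does not starve an operator. (With infinitely many inputs a heuristic may keep choosing
  the first operator, so that nothing is ever output. With finitely many inputs no heuristic is
  excluded.)
\<close>

definition complete_execution ::
  "('a, 'k, 's) pipeline \<Rightarrow> (nat \<Rightarrow> 'a option) \<Rightarrow>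
   (nat \<Rightarrow> ('a, 'k, 's) state) \<Rightarrow> (nat \<Rightarrow> agent) \<Rightarrow> bool" where
  "complete_execution P inp \<sigma> a \<longleftrightarrow>
     execution P inp \<sigma> a \<and>
     (\<exists>\<^sub>\<infinity>i. a i = Source) \<and> (\<forall>w < cores P. \<exists>\<^sub>\<infinity>i. a i = Worker w) \<and>
     ((\<forall>n. inp n \<noteq> None) \<longrightarrow> no_starvation P \<sigma> a)"

definition output_seq :: "(nat \<Rightarrow> ('a, 'k, 's) state) \<Rightarrow> nat \<Rightarrow> 'a option" where
  "output_seq \<sigma> = limit (\<lambda>i. outs (shared (\<sigma> i)))"

definition ordered ::
  "('a, 'k, 's) pipeline \<Rightarrow> (nat \<Rightarrow> 'a option) \<Rightarrow> (nat \<Rightarrow> ('a, 'k, 's) state) \<Rightarrow> bool" where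
  "ordered P inp \<sigma> \<longleftrightarrow> output_seq \<sigma> = sequential_output_seq P inp"

end

theory Submission
  imports Defs "HOL-Library.Infinite_Set"
begin

text \<open>
  Safety is an inductive invariant, local to each operator, about the list of tuples it has received
  and the list of tuples it has emitted: the emitted list is always the sequential output of the
  units whose serial number is below \<open>nxt\<close>. Serial numbers arrive in order because only one thread
  at a time delivers to an operator (the source, the worker of a stateful operator, or the holder of
  the flag of a reordering buffer). The unit with number \<open>t\<close> sits in cell \<open>t mod s\<close>, and no two
  numbers between \<open>nxt\<close> and \<open>nxt + s\<close> share a cell.

  For completeness, suppose \<open>nxt\<close> never moves again although the input with that number has left the
  worklist. A full next cell would eventually be seen by a thread in send_pending_outputs, since the
  second look at the cell excludes lost wake-ups; hence the next cell stays empty, hence nobody holds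
  the next unit, and the accounting of count[p] then yields a worker that takes it. So whatever is
  fetched is eventually sent. An operator that fetches nothing more drains, stays schedulable, and is
  therefore allotted a worker, which fetches. If the input is finite, no assumption on the heuristic
  is needed, because every allotment is followed by a fetch and there are only finitely many fetches.
\<close>

section \<open>Sequential semantics\<close>

text \<open>A delivery takes many atomic actions and writes into the memory of the next operator,
  yet the invariants of neighbouring operators must not refer to each other's program counters.
  Therefore a unit counts as emitted at the instant its cell is read (for a stateful operator, when
  the new state is written), the undelivered rest is kept as a separate delivery, and a tuple counts
  as received only with its last enqueue. Received tuples followed by the undelivered rest then form
  exactly the emitted list, and this equation is the only link between two operators. An entry of
  masterQueue names a partition and not a tuple, so the worker that removes it is not tied to a
  serial number. This is why the invariant of that worklist counts entries instead of matching them
  with tuples. For progress, no measure decreases with every action, since a worker whose number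
  lies beyond the window retries for as long as \<open>nxt\<close> stands still. Program counters
  are instead ruled out one after the other, backwards along the code: fairness would force a worker
  there into a situation already excluded.\<close>

definition final_mem :: "('a, 'k, 's) operator \<Rightarrow> 'a list \<Rightarrow> ('k, 's) memory" where
  "final_mem p xs = fst (apply_op_list p (init_mem p) xs)"

definition outputs :: "('a, 'k, 's) operator \<Rightarrow> 'a list \<Rightarrow> 'a list" where
  "outputs p xs = snd (apply_op_list p (init_mem p) xs)"

text \<open>Serial numbers start at 1, so number \<open>t\<close> belongs to list index
  \<open>t - 1\<close> and meets the memory left by the \<open>t - 1\<close> inputs before
  it.\<close>

definition unit_of :: "('a, 'k, 's) operator \<Rightarrow> 'a list \<Rightarrow> nat \<Rightarrow> 'a list" where
  "unit_of p xs t = snd (apply_op p (final_mem p (take (t - 1) xs)) (xs ! (t - 1)))"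

lemma apply_op_list_append:
  "apply_op_list p m (xs @ ys) =
     (let (m1, us) = apply_op_list p m xs; (m2, vs) = apply_op_list p m1 ys in (m2, us @ vs))"
  by (induction xs arbitrary: m) (auto simp: split_beta)

lemma final_mem_Nil [simp]: "final_mem p [] = init_mem p"
  by (simp add: final_mem_def)

lemma outputs_Nil [simp]: "outputs p [] = []"
  by (simp add: outputs_def)

lemma final_mem_snoc: "final_mem p (xs @ [x]) = fst (apply_op p (final_mem p xs) x)"
  by (simp add: final_mem_def apply_op_list_append split_beta)

lemma outputs_snoc: "outputs p (xs @ [x]) = outputs p xs @ snd (apply_op p (final_mem p xs) x)"
  by (simp add: final_mem_def outputs_def apply_op_list_append split_beta)

lemma outputs_append: "\<exists>zs. outputs p (xs @ ys) = outputs p xs @ zs"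
  by (simp add: outputs_def apply_op_list_append split_beta)

lemma outputs_mono: "prefix xs ys \<Longrightarrow> prefix (outputs p xs) (outputs p ys)"
  by (metis outputs_append prefix_def)

text \<open>A unit depends only on the inputs up to its own number. Later arrivals may thus extend
  the input list without disturbing units that are already held, stored or sent.\<close>

lemma unit_of_append: "0 < t \<Longrightarrow> t \<le> length xs \<Longrightarrow> unit_of p (xs @ ys) t = unit_of p xs t"
  by (cases t) (auto simp: unit_of_def nth_append)

text \<open>Brings the sequential output into the form in which a reordering buffer emits it, unit
  by unit.\<close>

lemma outputs_take: "n \<le> length xs \<Longrightarrow> outputs p (take n xs) = concat (map (unit_of p xs) [1..<Suc n])"
proof (induction n)
  case (Suc n)
  then show ?case
    by (simp add: take_Suc_conv_app_nth outputs_snoc unit_of_def)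
qed simp

lemma final_mem_take_Suc:
  "n < length xs \<Longrightarrow> final_mem p (take (Suc n) xs) = fst (apply_op p (final_mem p (take n xs)) (xs ! n))"
  by (simp add: take_Suc_conv_app_nth final_mem_snoc)

lemma apply_chain_append:
  "apply_chain c (xs @ ys) =
     (let (c1, us) = apply_chain c xs; (c2, vs) = apply_chain c1 ys in (c2, us @ vs))"
proof (induction c arbitrary: xs ys)
  case (Cons pm c)
  obtain p m where [simp]: "pm = (p, m)" by fastforce
  show ?case by (auto simp: apply_op_list_append Cons split_beta Let_def)
qed simp

lemma run_chain_append:
  "run_chain c (xs @ ys) = snd (apply_chain c xs) @ run_chain (fst (apply_chain c xs)) ys"
proof (induction xs arbitrary: c)
  case Nil
  have "apply_chain c [] = (c, [])" by (induction c) auto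
  then show ?case by simp
next
  case (Cons x xs)
  have "apply_chain c (x # xs) =
     (let (c1, us) = apply_chain c [x]; (c2, vs) = apply_chain c1 xs in (c2, us @ vs))"
    using apply_chain_append[of c "[x]" xs] by simp
  then show ?case by (auto simp: Cons split_beta)
qed

text \<open>The operators have separate memories, and the tail of the chain sees the same tuples in
  the same order either way. So passing inputs one by one through the chain agrees with running the
  first operator on the whole list before the others, which makes a stagewise treatment
  possible.\<close>

lemma run_chain_Cons:
  "run_chain ((p, m) # c) xs = run_chain c (snd (apply_op_list p m xs))"
proof (induction xs arbitrary: m c)
  case Nil
  then show ?case by simp
next
  case (Cons x xs)
  then show ?case by (auto simp: split_beta run_chain_append)
qed

primrec stage_outputs :: "('a, 'k, 's) pipeline \<Rightarrow> nat \<Rightarrow> 'a list \<Rightarrow> 'a list" where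
  "stage_outputs P 0 xs = xs"
| "stage_outputs P (Suc k) xs = outputs (ops P ! k) (stage_outputs P k xs)"

lemma sequential_outputs_eq: "sequential_outputs P xs = stage_outputs P (length (ops P)) xs"
proof -
  have Nil: "run_chain [] xs = xs" for xs :: "'a list"
    by (induction xs) auto
  \<comment> \<open>Operators are peeled off the front of the chain; at
    \<open>k = length (ops P)\<close> the empty chain remains.\<close>
  have "k \<le> length (ops P) \<Longrightarrow>
      run_chain (map (\<lambda>p. (p, init_mem p)) (ops P)) xs =
      run_chain (map (\<lambda>p. (p, init_mem p)) (drop k (ops P))) (stage_outputs P k xs)" for k
    by (induction k) (auto simp: Cons_nth_drop_Suc[symmetric] run_chain_Cons outputs_def)
  from this[of "length (ops P)"] show ?thesis
    by (simp add: sequential_outputs_def Nil)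
qed

lemma stage_outputs_mono: "prefix xs ys \<Longrightarrow> prefix (stage_outputs P k xs) (stage_outputs P k ys)"
  by (induction k) (auto intro: outputs_mono)

section \<open>Finite approximations of sequences and limits of growing lists\<close>

lemma first_Suc: "first (Suc n) inp = first n inp @ (case inp n of None \<Rightarrow> [] | Some x \<Rightarrow> [x])"
  by (auto simp: first_def List.map_filter_def split: option.split)

lemma first_mono: "m \<le> n \<Longrightarrow> prefix (first m inp) (first n inp)"
  by (induction n rule: dec_induct) (auto simp: first_Suc intro: prefix_order.trans)

text \<open>Any list that is long enough gives the same entry, since one of two members extends the
  other; this frees later arguments from the \<open>LEAST\<close> in \<open>limit\<close>.\<close>

lemma limit_eq_Some_iff:
  assumes mono: "\<And>i j. i \<le> j \<Longrightarrow> prefix (F i) (F j)"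
  shows "limit F n = Some x \<longleftrightarrow> (\<exists>i. n < length (F i) \<and> F i ! n = x)"
proof -
  have "F i ! n = F (LEAST i. n < length (F i)) ! n" if "n < length (F i)" for i
  proof -
    let ?l = "LEAST i. n < length (F i)"
    have l: "n < length (F ?l)" "?l \<le> i"
      using that by (auto intro: LeastI Least_le)
    then show ?thesis
      using mono[of ?l i] by (auto simp: prefix_def nth_append)
  qed
  then show ?thesis
    by (auto simp: limit_def)
qed

lemma limit_cofinal_le:
  assumes F: "\<And>i j. i \<le> j \<Longrightarrow> prefix (F i) (F j)" and G: "\<And>i j. i \<le> j \<Longrightarrow> prefix (G i) (G j)"
    and FG: "\<And>i. \<exists>j. prefix (F i) (G j)" and x: "limit F n = Some x"
  shows "limit G n = Some x"
proof -
  obtain i where i: "n < length (F i)" "F i ! n = x"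
    using x limit_eq_Some_iff[of F, OF F] by blast
  obtain j zs where "G j = F i @ zs"
    using FG[of i] by (auto simp: prefix_def)
  with i show ?thesis
    by (subst limit_eq_Some_iff[of G, OF G]) (auto intro!: exI[of _ j] simp: nth_append)
qed

text \<open>Safety bounds concurrent outputs by sequential ones and progress does the converse; if
  each chain is cofinal in the other, their limits agree.\<close>

lemma limit_cong_cofinal:
  assumes F: "\<And>i j. i \<le> j \<Longrightarrow> prefix (F i) (F j)" and G: "\<And>i j. i \<le> j \<Longrightarrow> prefix (G i) (G j)"
    and FG: "\<And>i. \<exists>j. prefix (F i) (G j)" and GF: "\<And>i. \<exists>j. prefix (G i) (F j)"
  shows "limit F = limit G"
proof (rule ext)
  fix n
  have "limit F n = Some x \<longleftrightarrow> limit G n = Some x" for x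
    using limit_cofinal_le[of F G, OF F G FG] limit_cofinal_le[of G F, OF G F GF] by blast
  then show "limit F n = limit G n"
    by (metis not_Some_eq)
qed

section \<open>The reordering buffer\<close>

fun job_of :: "('a, 's) pc \<Rightarrow> ('a job \<times> bool) option" where
  "job_of (AddLoad j) = Some (j, False)"
| "job_of (AddStore j) = Some (j, False)"
| "job_of (Tas j b) = Some (j, b)"
| "job_of (LoadNext j b) = Some (j, b)"
| "job_of (LoadCell j b i) = Some (j, b)"
| "job_of (Forward j b i d) = Some (j, b)"
| "job_of (EmptyCell j b i) = Some (j, b)"
| "job_of (IncNext j b) = Some (j, b)"
| "job_of (ClearFlag j b i) = Some (j, b)"
| "job_of (Recheck j b i) = Some (j, b)"
| "job_of _ = None"

text \<open>A serial number stays with its worker until the unit is stored. After a failed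
  \<open>try_add\<close> the worker still runs \<open>send_pending_outputs\<close> before it
  retries, so ownership is read off the variable success and not off the position in the
  code.\<close>

fun holds :: "('a, 's) pc \<Rightarrow> nat option" where
  "holds (Compute t x) = Some t"
| "holds (PRead p t x) = Some t"
| "holds (PWrite p t x s) = Some t"
| "holds c = (case job_of c of Some (j, False) \<Rightarrow> Some (fst (snd j)) | _ \<Rightarrow> None)"

text \<open>Ends with the clearing of the flag: at \<open>Recheck\<close> the cell is inspected
  without the lock.\<close>

fun locked :: "('a, 's) pc \<Rightarrow> bool" where
  "locked (LoadNext j b) = True"
| "locked (LoadCell j b i) = True"
| "locked (Forward j b i d) = True"
| "locked (EmptyCell j b i) = True"
| "locked (IncNext j b) = True"
| "locked (ClearFlag j b i) = True"
| "locked _ = False"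

fun cell_of :: "('a, 's) pc \<Rightarrow> nat option" where
  "cell_of (LoadCell j b i) = Some i"
| "cell_of (Forward j b i d) = Some i"
| "cell_of (EmptyCell j b i) = Some i"
| "cell_of (ClearFlag j b i) = Some i"
| "cell_of _ = None"

fun sending :: "('a, 's) pc \<Rightarrow> bool" where
  "sending (Forward j b i d) = True"
| "sending (EmptyCell j b i) = True"
| "sending (IncNext j b) = True"
| "sending _ = False"

fun delivery_of :: "('a, 's) pc \<Rightarrow> 'a delivery" where
  "delivery_of (Forward j b i d) = d"
| "delivery_of (SSend d) = d"
| "delivery_of _ = ([], Start)"

fun is_IncNext :: "('a, 's) pc \<Rightarrow> bool" where
  "is_IncNext (IncNext j b) = True"
| "is_IncNext _ = False"

text \<open>The workers that can still notice a full cell \<open>i\<close>: one is about to try the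
  flag, the other is about to look at that very cell again.\<close>

fun wakes :: "nat \<Rightarrow> ('a, 's) pc \<Rightarrow> bool" where
  "wakes i (Tas j b) = True"
| "wakes i (Recheck j b i') = (i' = i)"
| "wakes i _ = False"

definition held :: "(nat \<Rightarrow> ('a, 's) pc) \<Rightarrow> nat \<Rightarrow> bool" where
  "held f t \<longleftrightarrow> (\<exists>w. holds (f w) = Some t)"

lemma sending_locked: "sending c \<Longrightarrow> locked c"
  by (cases c) auto

lemma is_IncNext_sending: "is_IncNext c \<Longrightarrow> sending c"
  by (cases c) auto

lemma locked_job: "locked c \<Longrightarrow> job_of c \<noteq> None"
  by (cases c) auto

lemma cell_of_locked: "cell_of c = Some i \<Longrightarrow> locked c"
  by (cases c) auto

lemma holds_job: "job_of c = Some (j, b) \<Longrightarrow> holds c = (if b then None else Some (fst (snd j)))"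
  by (cases c) auto

text \<open>
  \<open>Tk\<close> is the set of serial numbers that workers have taken from the worklist; each of them is sent,
  stored in the buffer, or held by exactly one worker. A worker in state \<open>IncNext\<close> has emptied the cell
  of \<open>nxt\<close> but not yet moved \<open>nxt\<close>. \<open>Out\<close> is everything emitted so far, including the part \<open>V\<close> that
  is still being delivered. \<open>wake\<close> excludes lost wake-ups: a full next cell with a clear flag will be
  noticed by somebody.
\<close>

locale reorder =
  fixes s :: nat and U :: "nat \<Rightarrow> 'a list" and Tk :: "nat set"
    and d :: "('a, 'k, 's) opdata" and f :: "nat \<Rightarrow> ('a, 's) pc"
    and Out :: "'a list" and V :: "'a delivery"
  assumes s_pos: "0 < s"
    and nxt_pos: "0 < nxt d"
    and Tk_pos: "t \<in> Tk \<Longrightarrow> 0 < t"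
    and below: "\<lbrakk>0 < t; t < nxt d\<rbrakk> \<Longrightarrow> t \<in> Tk"
    and held_Tk: "holds (f w) = Some t \<Longrightarrow> t \<in> Tk \<and> nxt d \<le> t"
    and held_unique: "\<lbrakk>holds (f w) = Some t; holds (f w') = Some t\<rbrakk> \<Longrightarrow> w = w'"
    and above: "\<lbrakk>t \<in> Tk; nxt d + s \<le> t\<rbrakk> \<Longrightarrow> held f t"
    and cell: "\<lbrakk>nxt d \<le> t; t < nxt d + s\<rbrakk> \<Longrightarrow> buffer d (t mod s) =
       (if t \<in> Tk \<and> \<not> held f t \<and> \<not> (t = nxt d \<and> (\<exists>w. is_IncNext (f w))) then Some (U t) else None)"
    and store_bound: "f w = AddStore j \<Longrightarrow> fst (snd j) < nxt d + s"
    and lock_unique: "\<lbrakk>locked (f w); locked (f w')\<rbrakk> \<Longrightarrow> w = w'"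
    and flag_iff: "flag d \<longleftrightarrow> (\<exists>w. locked (f w))"
    and cell_index: "cell_of (f w) = Some i \<Longrightarrow> i = nxt d mod s"
    and sending_next: "sending (f w) \<Longrightarrow> nxt d \<in> Tk \<and> \<not> held f (nxt d)"
    and Out_eq: "Out = concat (map U [1..<nxt d + (if \<exists>w. sending (f w) then 1 else 0)])"
    and V_eq: "sending (f w) \<Longrightarrow> V = delivery_of (f w)"
    and V_idle: "(\<And>w. \<not> sending (f w)) \<Longrightarrow> V = ([], Start)"
    and unit: "job_of (f w) = Some ((po, t, u), False) \<Longrightarrow> u = U t"
    and V_start: "fst V = [] \<Longrightarrow> snd V = Start"
    and wake: "\<lbrakk>\<not> flag d; buffer d (nxt d mod s) \<noteq> None\<rbrakk> \<Longrightarrow> \<exists>w. wakes (nxt d mod s) (f w)"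
begin

text \<open>Two numbers in a window of length \<open>s\<close> differ by less than \<open>s\<close>
  in absolute value, so a difference divisible by \<open>s\<close> vanishes.\<close>

lemma mod_window_inj:
  assumes "nxt d \<le> t" "t < nxt d + s" "nxt d \<le> t'" "t' < nxt d + s" "t mod s = t' mod s"
  shows "t = t'"
proof -
  have "\<bar>int t - int t'\<bar> < int s" using assms by linarith
  moreover have "int s dvd int t - int t'"
    using assms(5) by (metis mod_eq_dvd_iff of_nat_mod)
  ultimately show ?thesis
    using zdvd_imp_le[of "int s" "\<bar>int t - int t'\<bar>"] by (cases "t = t'") auto
qed

lemma next_cell: "buffer d (nxt d mod s) =
       (if nxt d \<in> Tk \<and> \<not> held f (nxt d) \<and> \<not> (\<exists>w. is_IncNext (f w)) then Some (U (nxt d)) else None)"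
  using cell[of "nxt d"] s_pos by simp

lemma not_sending: "locked (f w) \<Longrightarrow> \<not> sending (f w) \<Longrightarrow> \<not> sending (f w')"
  using lock_unique sending_locked by blast

section \<open>Effect of single actions on the reordering buffer\<close>

lemma held_upd: "holds c = holds (f w) \<Longrightarrow> held (f(w := c)) t = held f t"
  by (auto simp: held_def)

lemma ex_upd:
  assumes "Q c = Q (f w)" shows "(\<exists>w'. Q ((f(w := c)) w')) = (\<exists>w'. Q (f w'))"
  using assms by (metis fun_upd_apply)

text \<open>Outside the lock nothing that describes the sender changes. The delicate hypothesis is
  the disjunction about \<open>wakes\<close>: a worker may stop being a witness for
  \<open>wake\<close> only if the flag is set or the next cell is empty.\<close>

lemma unlocked_step:
  assumes "\<not> locked (f w)" "\<not> locked c" "holds c = holds (f w)"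
    and "\<And>po t u. job_of c = Some ((po, t, u), False) \<Longrightarrow> u = U t"
    and "\<And>j. c = AddStore j \<Longrightarrow> fst (snd j) < nxt d + s"
    and "flag d \<or> buffer d (nxt d mod s) = None \<or> wakes (nxt d mod s) c \<or> \<not> wakes (nxt d mod s) (f w)"
    and d': "nxt d' = nxt d" "buffer d' = buffer d" "flag d' = flag d"
  shows "reorder s U Tk d' (f(w := c)) Out V"
proof -
  have cs: "\<not> sending c" "\<not> sending (f w)" "\<not> is_IncNext c" "\<not> is_IncNext (f w)"
     "cell_of c = None" "cell_of (f w) = None"
    using assms(1,2) sending_locked is_IncNext_sending cell_of_locked
    by (blast, blast, blast, blast, metis not_None_eq, metis not_None_eq)
  have ex: "(\<exists>w'. is_IncNext ((f(w := c)) w')) = (\<exists>w. is_IncNext (f w))"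
    "(\<exists>w'. sending ((f(w := c)) w')) = (\<exists>w. sending (f w))"
    "(\<exists>w'. locked ((f(w := c)) w')) = (\<exists>w. locked (f w))"
    by (rule ex_upd, use cs assms in simp)+
  have same: "holds ((f(w := c)) w') = holds (f w')" "locked ((f(w := c)) w') = locked (f w')"
    "cell_of ((f(w := c)) w') = cell_of (f w')" "sending ((f(w := c)) w') = sending (f w')" for w'
    using assms(1-3) cs by simp_all
  have del: "sending (f w') \<Longrightarrow> (f(w := c)) w' = f w'" for w'
    using cs by auto
  show ?thesis
  proof (unfold_locales, unfold d' held_upd[OF assms(3)] ex same)
    show "V = ([], Start)" if "\<And>w'. \<not> sending (f w')"
      using that by (rule V_idle)
    show "\<exists>w'. wakes (nxt d mod s) ((f(w := c)) w')"
      if "\<not> flag d" "buffer d (nxt d mod s) \<noteq> None"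
      using wake[OF that] assms(6) that by (metis fun_upd_apply)
    show "u = U t" if "job_of ((f(w := c)) w') = Some ((po, t, u), False)" for w' po t u
      using that assms(4) unit by (auto split: if_splits)
    show "fst (snd j) < nxt d + s" if "(f(w := c)) w' = AddStore j" for w' j
      using that assms(5) store_bound by (auto split: if_splits)
    show "V = delivery_of ((f(w := c)) w')" if "sending (f w')" for w'
      using V_eq that del by simp
  qed (fact V_start s_pos nxt_pos Tk_pos below held_Tk held_unique above cell lock_unique flag_iff
      cell_index sending_next Out_eq)+
qed


text \<open>The flag has a unique holder, so existential statements about senders reduce to the new
  program counter \<open>c\<close> of that worker. \<open>wake\<close> is vacuous while the flag is
  set.\<close>

lemma locked_step:
  assumes "locked (f w)" "locked c" and job: "job_of c = job_of (f w)"
    and "\<And>i. cell_of c = Some i \<Longrightarrow> i = nxt d mod s"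
    and d': "nxt d' = nxt d" "flag d' = flag d"
    and cell': "\<And>t. \<lbrakk>nxt d \<le> t; t < nxt d + s\<rbrakk> \<Longrightarrow> buffer d' (t mod s) =
       (if t \<in> Tk \<and> \<not> held f t \<and> \<not> (t = nxt d \<and> is_IncNext c) then Some (U t) else None)"
    and "sending c \<Longrightarrow> nxt d \<in> Tk \<and> \<not> held f (nxt d)"
    and Out': "Out' = concat (map U [1..<nxt d + (if sending c then 1 else 0)])"
    and V': "V' = delivery_of c" and V_start': "fst V' = [] \<Longrightarrow> snd V' = Start"
  shows "reorder s U Tk d' (f(w := c)) Out' V'"
proof -
  have h: "holds c = holds (f w)"
    using job locked_job[OF assms(1)] by (metis holds_job not_None_eq surj_pair)
  have other: "w' \<noteq> w \<Longrightarrow> \<not> locked (f w')" for w'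
    using lock_unique assms(1) by blast
  have other': "w' \<noteq> w \<Longrightarrow> \<not> sending (f w')" "w' \<noteq> w \<Longrightarrow> \<not> is_IncNext (f w')"
    "w' \<noteq> w \<Longrightarrow> cell_of (f w') = None" for w'
    using other sending_locked is_IncNext_sending cell_of_locked
    by (blast, blast, metis not_None_eq)
  have ex: "(\<exists>w'. is_IncNext ((f(w := c)) w')) = is_IncNext c"
    "(\<exists>w'. sending ((f(w := c)) w')) = sending c"
    using other' by (metis fun_upd_apply)+
  have flag: "flag d"
    using flag_iff assms(1) by blast
  have same: "holds ((f(w := c)) w') = holds (f w')" "locked ((f(w := c)) w') = locked (f w')"
     "job_of ((f(w := c)) w') = job_of (f w')" for w'
    using assms(1-3) h by simp_all
  show ?thesis
  proof (unfold_locales, unfold d' held_upd[OF h] ex same)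
    show "V' = ([], Start)" if "\<And>w'. \<not> sending ((f(w := c)) w')"
      using that[of w] \<open>locked c\<close> V' by (cases c) auto
    show "V' = delivery_of ((f(w := c)) w')" if "sending ((f(w := c)) w')" for w'
      using V' that other' by (auto split: if_splits)
    show "fst (snd j) < nxt d + s" if "(f(w := c)) w' = AddStore j" for w' j
      using that \<open>locked c\<close> store_bound by (auto split: if_splits)
    show "nxt d \<in> Tk \<and> \<not> held f (nxt d)" if "sending ((f(w := c)) w')" for w'
      using that assms(8) other' by (auto split: if_splits)
    show "i = nxt d mod s" if "cell_of ((f(w := c)) w') = Some i" for w' i
      using that assms(4) other' by (auto split: if_splits)
    show "\<exists>w'. wakes (nxt d mod s) ((f(w := c)) w')" if "\<not> flag d"
      using that flag by blast
  qed (fact V_start' s_pos nxt_pos Tk_pos below held_Tk held_unique above cell' lock_unique flag_iff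
      sending_next Out' unit)+
qed

text \<open>The window test may be outdated when the store happens, but both bounds survive: a held
  number is unsent, so \<open>nxt\<close> has not passed it, and the upper bound only grows.
  Afterwards the storing worker is itself a witness for \<open>wake\<close>.\<close>

lemma store_step:
  assumes fw: "f w = AddStore (po, t, u)"
    and d': "nxt d' = nxt d" "flag d' = flag d" "buffer d' = (buffer d)(t mod s := Some u)"
  shows "reorder s U Tk d' (f(w := Tas (po, t, u) True)) Out V"
proof -
  let ?c = "Tas (po, t, u) True :: ('a, 's) pc"
  have t: "t \<in> Tk" "nxt d \<le> t" "t < nxt d + s" "u = U t"
    using held_Tk[of w t] store_bound[OF fw] unit[of w po t u] by (auto simp: fw)
  have ex: "(\<exists>w'. is_IncNext ((f(w := ?c)) w')) = (\<exists>w. is_IncNext (f w))"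
    "(\<exists>w'. sending ((f(w := ?c)) w')) = (\<exists>w. sending (f w))"
    "(\<exists>w'. locked ((f(w := ?c)) w')) = (\<exists>w. locked (f w))"
    by (rule ex_upd, use fw in simp)+
  have same: "locked ((f(w := ?c)) w') = locked (f w')"
    "cell_of ((f(w := ?c)) w') = cell_of (f w')" "sending ((f(w := ?c)) w') = sending (f w')" for w'
    using fw by simp_all
  have held: "held (f(w := ?c)) t' \<longleftrightarrow> held f t' \<and> t' \<noteq> t" for t'
  proof -
    have hw: "holds (f w) = Some t" and hc: "holds ?c = None"
      using fw by simp_all
    have "holds (f w') \<noteq> Some t" if "w' \<noteq> w" for w'
      using held_unique[OF hw] that by blast
    then have "holds ((f(w := ?c)) w') = Some t' \<longleftrightarrow> holds (f w') = Some t' \<and> t' \<noteq> t" for w'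
      using hw hc by (cases "w' = w") auto
    then show ?thesis
      unfolding held_def by blast
  qed
  \<comment> \<open>If the stored number is \<open>nxt\<close> itself, it was held until now, which
    \<open>sending_next\<close> excludes while somebody is sending.\<close>
  have inc: "\<not> is_IncNext (f w')" if "t = nxt d" for w'
  proof -
    have "held f t" unfolding held_def by (rule exI[of _ w]) (simp add: fw)
    then show ?thesis using sending_next[of w'] is_IncNext_sending[of "f w'"] that by blast
  qed
  show ?thesis
  proof (unfold_locales, unfold d' held ex same)
    show "held f t' \<and> t' \<noteq> t" if "t' \<in> Tk" "nxt d + s \<le> t'" for t'
      using above[OF that] that t by auto
    show "V = delivery_of ((f(w := ?c)) w')" if "sending (f w')" for w'
      using V_eq[OF that] that fw by auto
    show "V = ([], Start)" if "\<And>w'. \<not> sending (f w')"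
      using that by (rule V_idle)
    show "nxt d \<in> Tk \<and> \<not> (held f (nxt d) \<and> nxt d \<noteq> t)" if "sending (f w')" for w'
      using sending_next[OF that] by blast
    show "\<exists>w'. wakes (nxt d mod s) ((f(w := ?c)) w')"
      by (rule exI[of _ w]) simp
    show "u' = U t'" if "job_of ((f(w := ?c)) w') = Some ((po', t', u'), False)" for w' po' t' u'
      using that unit by (auto split: if_splits)
    show "fst (snd j) < nxt d + s" if "(f(w := ?c)) w' = AddStore j" for w' j
      using that store_bound by (auto split: if_splits)
    show "t' \<in> Tk \<and> nxt d \<le> t'" if "holds ((f(w := ?c)) w') = Some t'" for w' t'
      using that held_Tk by (auto split: if_splits)
    show "w' = w''" if "holds ((f(w := ?c)) w') = Some t'" "holds ((f(w := ?c)) w'') = Some t'" for w' w'' t'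
      using that held_unique[of w' t' w''] by (auto split: if_splits)
    show "((buffer d)(t mod s := Some u)) (t' mod s) =
      (if t' \<in> Tk \<and> \<not> (held f t' \<and> t' \<noteq> t) \<and> \<not> (t' = nxt d \<and> (\<exists>w. is_IncNext (f w)))
       then Some (U t') else None)" if "nxt d \<le> t'" "t' < nxt d + s" for t'
    proof (cases "t' = t")
      case True
      then show ?thesis using t inc by auto
    next
      case False
      then have "t' mod s \<noteq> t mod s"
        using mod_window_inj that t by blast
      then show ?thesis using False cell[OF that] by simp
    qed
  qed (fact V_start s_pos nxt_pos Tk_pos below lock_unique flag_iff cell_index Out_eq)+
qed

lemma lock_step:
  assumes fw: "f w = Tas j b" and flag: "\<not> flag d"
    and d': "nxt d' = nxt d" "flag d'" "buffer d' = buffer d"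
  shows "reorder s U Tk d' (f(w := LoadNext j b)) Out V"
proof -
  let ?c = "LoadNext j b :: ('a, 's) pc"
  have unl: "\<not> locked (f w')" for w'
    using flag flag_iff by blast
  have nos: "\<not> sending (f w')" "\<not> is_IncNext (f w')" "cell_of (f w') = None" for w'
    using unl sending_locked is_IncNext_sending cell_of_locked by (blast, blast, metis not_None_eq)
  have h: "holds ?c = holds (f w)"
    using holds_job[of ?c j b] holds_job[of "f w" j b] fw by simp
  have same: "holds ((f(w := ?c)) w') = holds (f w')" "job_of ((f(w := ?c)) w') = job_of (f w')"
     "sending ((f(w := ?c)) w') = False" "is_IncNext ((f(w := ?c)) w') = False"
     "cell_of ((f(w := ?c)) w') = None" "locked ((f(w := ?c)) w') = (w' = w)" for w'
    using fw h nos unl by simp_all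
  have eqs: "Out = concat (map U [1..<nxt d])" "V = ([], Start)"
    using Out_eq V_idle nos by simp_all
  show ?thesis
  proof (unfold_locales, unfold d' held_upd[OF h] same)
    show "fst (snd j) < nxt d + s" if "(f(w := ?c)) w' = AddStore j" for w' j
      using that store_bound by (auto split: if_splits)
    show "flag d' = (\<exists>w'. w' = w)" using d' by simp
    show "buffer d (t mod s) = (if t \<in> Tk \<and> \<not> held f t \<and> \<not> (t = nxt d \<and> (\<exists>w::nat. False)) then Some (U t) else None)"
      if "nxt d \<le> t" "t < nxt d + s" for t
      using cell[OF that] nos by simp
    show "Out = concat (map U [1..<nxt d + (if \<exists>w::nat. False then 1 else 0)])"
      using eqs by simp
    show "V = ([], Start)" by (fact eqs)
    show "\<exists>w'. wakes (nxt d mod s) ((f(w := ?c)) w')" if "\<not> flag d'"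
      using that d' by blast
    show "w' = w''" if "w' = w" "w'' = w" for w' w''
      using that by simp
  qed (fact V_start s_pos nxt_pos Tk_pos below held_Tk held_unique above unit | simp)+
qed

text \<open>Clearing the flag could leave behind a unit that was stored after the cell had been
  found empty. The index to be inspected again is still that of \<open>nxt\<close>, so the worker at
  \<open>Recheck\<close> is the required witness for \<open>wake\<close>.\<close>

lemma unlock_step:
  assumes fw: "f w = ClearFlag j b i"
    and d': "nxt d' = nxt d" "\<not> flag d'" "buffer d' = buffer d"
  shows "reorder s U Tk d' (f(w := Recheck j b i)) Out V"
proof -
  let ?c = "Recheck j b i :: ('a, 's) pc"
  have unl: "w' \<noteq> w \<Longrightarrow> \<not> locked (f w')" for w'
    using lock_unique[of w w'] fw by auto
  have nos: "\<not> sending (f w')" "\<not> is_IncNext (f w')" for w'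
    using unl sending_locked[of "f w'"] is_IncNext_sending[of "f w'"] fw by (cases "w' = w", auto)+
  have noc: "w' \<noteq> w \<Longrightarrow> cell_of (f w') = None" for w'
    using unl cell_of_locked[of "f w'"] by (metis not_None_eq)
  have i: "i = nxt d mod s"
    using cell_index[of w i] fw by simp
  have h: "holds ?c = holds (f w)"
    using holds_job[of ?c j b] holds_job[of "f w" j b] fw by simp
  have same: "holds ((f(w := ?c)) w') = holds (f w')" "job_of ((f(w := ?c)) w') = job_of (f w')"
     "sending ((f(w := ?c)) w') = False" "is_IncNext ((f(w := ?c)) w') = False"
     "cell_of ((f(w := ?c)) w') = None" "locked ((f(w := ?c)) w') = False" for w'
    using fw h nos noc unl by simp_all
  have eqs: "Out = concat (map U [1..<nxt d])" "V = ([], Start)"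
    using Out_eq V_idle nos by simp_all
  show ?thesis
  proof (unfold_locales, unfold d' held_upd[OF h] same)
    show "fst (snd j) < nxt d + s" if "(f(w := ?c)) w' = AddStore j" for w' j
      using that store_bound by (auto split: if_splits)
    show "\<exists>w'. wakes (nxt d mod s) ((f(w := ?c)) w')"
      by (rule exI[of _ w]) (simp add: i)
    show "flag d' = (\<exists>w::nat. False)" using d' by simp
    show "buffer d (t mod s) = (if t \<in> Tk \<and> \<not> held f t \<and> \<not> (t = nxt d \<and> (\<exists>w::nat. False)) then Some (U t) else None)"
      if "nxt d \<le> t" "t < nxt d + s" for t
      using cell[OF that] nos by simp
    show "Out = concat (map U [1..<nxt d + (if \<exists>w::nat. False then 1 else 0)])"
      using eqs by simp
    show "V = ([], Start)" by (fact eqs)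
  qed (fact V_start s_pos nxt_pos Tk_pos below held_Tk held_unique above unit | simp)+
qed

lemma inc_step:
  assumes fw: "f w = IncNext j b"
    and d': "nxt d' = Suc (nxt d)" "flag d' = flag d" "buffer d' = buffer d"
  shows "reorder s U Tk d' (f(w := LoadNext j b)) Out V"
proof -
  let ?c = "LoadNext j b :: ('a, 's) pc" and ?n = "nxt d"
  have unl: "w' \<noteq> w \<Longrightarrow> \<not> locked (f w')" for w'
    using lock_unique[of w w'] fw by auto
  have noc: "w' \<noteq> w \<Longrightarrow> cell_of (f w') = None" "w' \<noteq> w \<Longrightarrow> \<not> sending (f w')"
    "w' \<noteq> w \<Longrightarrow> \<not> is_IncNext (f w')" for w'
    using unl[of w'] cell_of_locked[of "f w'"] sending_locked[of "f w'"] is_IncNext_sending[of "f w'"]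
    by (metis not_None_eq, blast, blast)
  have h: "holds ?c = holds (f w)"
    using holds_job[of ?c j b] holds_job[of "f w" j b] fw by simp
  have same: "holds ((f(w := ?c)) w') = holds (f w')" "job_of ((f(w := ?c)) w') = job_of (f w')"
     "sending ((f(w := ?c)) w') = False" "is_IncNext ((f(w := ?c)) w') = False"
     "cell_of ((f(w := ?c)) w') = None" "locked ((f(w := ?c)) w') = locked (f w')" for w'
    using fw h noc unl by simp_all
  have n: "?n \<in> Tk" "\<not> held f ?n"
    using sending_next[of w] fw by auto
  have flag: "flag d"
    using flag_iff fw locked.simps by metis
  have s: "\<exists>w. sending (f w)"
    using fw by (intro exI[of _ w]) simp
  have inc: "\<exists>w. is_IncNext (f w)"
    using fw by (intro exI[of _ w]) simp
  have o: "Out = concat (map U [1..<?n + 1])"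
    using Out_eq s by simp
  have v: "V = ([], Start)"
    using V_eq[of w] fw by simp
  show ?thesis
  proof (unfold_locales, unfold d' held_upd[OF h] same)
    show "fst (snd j) < Suc ?n + s" if "(f(w := ?c)) w' = AddStore j" for w' j
      using that store_bound by (fastforce split: if_splits)
    show "t \<in> Tk" if "0 < t" "t < Suc ?n" for t
      using that below n by (cases "t = ?n") auto
    show "t \<in> Tk \<and> Suc ?n \<le> t" if "holds (f w') = Some t" for w' t
      using held_Tk[OF that] n that by (cases "t = ?n") (auto simp: held_def)
    show "held f t" if "t \<in> Tk" "Suc ?n + s \<le> t" for t
      using that above by simp
    show "buffer d (t mod s) = (if t \<in> Tk \<and> \<not> held f t \<and> \<not> (t = Suc ?n \<and> (\<exists>w::nat. False)) then Some (U t) else None)"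
      if "Suc ?n \<le> t" "t < Suc ?n + s" for t
    \<comment> \<open>The number entering the window shares its cell with the one leaving it. By
      \<open>above\<close> it is either not taken or still held, so the cell just emptied has the
      right content.\<close>
    proof (cases "t = ?n + s")
      case True
      then show ?thesis
        using above[of t] cell[of ?n] s_pos inc by auto
    next
      case False
      then show ?thesis using cell[of t] that by auto
    qed
    show "Out = concat (map U [1..<Suc ?n + (if \<exists>w::nat. False then 1 else 0)])"
      using o by simp
  qed (fact V_start s_pos Tk_pos held_unique unit lock_unique flag_iff v | simp add: flag)+
qed

text \<open>All numbers below \<open>nxt\<close> are taken already, so a fresh number lies at or
  above \<open>nxt\<close> and cannot concern what has been emitted.\<close>

lemma take_step:
  assumes t: "t \<notin> Tk" "0 < t"
    and c: "holds c = Some t" "job_of c = None"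
    and fw: "holds (f w) = None" "job_of (f w) = None"
    and d': "nxt d' = nxt d" "flag d' = flag d" "buffer d' = buffer d"
  shows "reorder s U (insert t Tk) d' (f(w := c)) Out V"
proof -
  have "\<not> locked c" "\<not> locked (f w)"
    using c fw locked_job by blast+
  then have cs: "\<not> locked c" "\<not> locked (f w)" "\<not> sending c" "\<not> sending (f w)" "\<not> is_IncNext c"
     "\<not> is_IncNext (f w)" "cell_of c = None" "cell_of (f w) = None"
    using sending_locked is_IncNext_sending cell_of_locked
    by (blast, blast, blast, blast, blast, blast, metis not_None_eq, metis not_None_eq)
  have ex: "(\<exists>w'. is_IncNext ((f(w := c)) w')) = (\<exists>w. is_IncNext (f w))"
    "(\<exists>w'. sending ((f(w := c)) w')) = (\<exists>w. sending (f w))"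
    "(\<exists>w'. locked ((f(w := c)) w')) = (\<exists>w. locked (f w))"
    by (rule ex_upd, use cs in simp)+
  have same: "locked ((f(w := c)) w') = locked (f w')"
    "cell_of ((f(w := c)) w') = cell_of (f w')" "sending ((f(w := c)) w') = sending (f w')" 
    "job_of ((f(w := c)) w') = job_of (f w')" for w'
    using c fw cs by simp_all
  have held: "held (f(w := c)) t' \<longleftrightarrow> held f t' \<or> t' = t" for t'
  proof -
    have "holds ((f(w := c)) w') = Some t' \<longleftrightarrow> holds (f w') = Some t' \<or> w' = w \<and> t' = t" for w'
      using c fw by (cases "w' = w") auto
    then show ?thesis
      by (simp add: held_def ex_disj_distrib)
  qed
  have tn: "nxt d \<le> t"
    using below t by (meson not_le)
  have nt: "\<not> held f t" using held_Tk t by (auto simp: held_def)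
  show ?thesis
  proof (unfold_locales, unfold d' held ex same)
    show "fst (snd j) < nxt d + s" if "(f(w := c)) w' = AddStore j" for w' j
      using that store_bound c by (auto split: if_splits)
    show "V = delivery_of ((f(w := c)) w')" if "sending (f w')" for w'
      using V_eq[OF that] that cs by auto
    show "V = ([], Start)" if "\<And>w'. \<not> sending (f w')"
      using that by (rule V_idle)
    show "t' \<in> insert t Tk \<and> nxt d \<le> t'" if "holds ((f(w := c)) w') = Some t'" for w' t'
      using that held_Tk tn c by (auto split: if_splits)
    show "w' = w''" if "holds ((f(w := c)) w') = Some t'" "holds ((f(w := c)) w'') = Some t'" for w' w'' t'
      using that held_unique[of w' t' w''] c nt by (auto split: if_splits simp: held_def)
    show "held f t' \<or> t' = t" if "t' \<in> insert t Tk" "nxt d + s \<le> t'" for t'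
      using that above by blast
    show "buffer d (t' mod s) = (if t' \<in> insert t Tk \<and> \<not> (held f t' \<or> t' = t) \<and>
        \<not> (t' = nxt d \<and> (\<exists>w. is_IncNext (f w))) then Some (U t') else None)"
      if "nxt d \<le> t'" "t' < nxt d + s" for t'
      using cell[OF that] t by auto
    show "nxt d \<in> insert t Tk \<and> \<not> (held f (nxt d) \<or> nxt d = t)" if "sending (f w')" for w'
      using sending_next[OF that] t by auto
    show "\<exists>w'. wakes (nxt d mod s) ((f(w := c)) w')"
      if *: "\<not> flag d" "buffer d (nxt d mod s) \<noteq> None"
    proof -
      obtain w' where w': "wakes (nxt d mod s) (f w')" using wake[OF *] by blast
      then have "w' \<noteq> w" using fw by (cases "f w") auto
      then show ?thesis using w' by (intro exI[of _ w']) simp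
    qed
    show "0 < t'" if "t' \<in> insert t Tk" for t'
      using that Tk_pos t by blast
    show "t' \<in> insert t Tk" if "0 < t'" "t' < nxt d" for t'
      using that below by blast
  qed (fact V_start s_pos nxt_pos lock_unique flag_iff cell_index Out_eq unit)+
qed

text \<open>Arrivals change the function \<open>unit_of p xs\<close>, but the invariant speaks only
  of units of taken numbers: those below \<open>nxt\<close>, the one being sent, and those held or
  stored.\<close>

lemma cong_step:
  assumes U: "\<And>t. t \<in> Tk \<Longrightarrow> U' t = U t"
    and d': "nxt d' = nxt d" "flag d' = flag d" "buffer d' = buffer d"
  shows "reorder s U' Tk d' f Out V"
proof -
  have eU: "map U' [1..<nxt d + (if \<exists>w. sending (f w) then 1 else 0)] =
            map U [1..<nxt d + (if \<exists>w. sending (f w) then 1 else 0)]"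
  proof (rule map_cong)
    show "U' x = U x" if "x \<in> set [1..<nxt d + (if \<exists>w. sending (f w) then 1 else 0)]" for x
    proof (cases "x = nxt d")
      case True
      then have "\<exists>w. sending (f w)" using that by (auto split: if_splits)
      then show ?thesis using U sending_next True by blast
    next
      case False
      then have "x < nxt d" using that by (auto split: if_splits)
      then show ?thesis using U below that by (auto split: if_splits)
    qed
  qed simp
  show ?thesis
  proof (unfold_locales, unfold d' eU)
    show "buffer d (t' mod s) = (if t' \<in> Tk \<and> \<not> held f t' \<and>
        \<not> (t' = nxt d \<and> (\<exists>w. is_IncNext (f w))) then Some (U' t') else None)"
      if "nxt d \<le> t'" "t' < nxt d + s" for t'
      using cell[OF that] U by auto
    show "u = U' t'" if "job_of (f w') = Some ((po, t', u), False)" for w' po t' u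
      using unit[OF that] U held_Tk[of w' t'] holds_job[OF that] by simp
  qed (fact V_start s_pos nxt_pos Tk_pos below held_Tk held_unique above store_bound lock_unique flag_iff
      cell_index sending_next Out_eq V_eq V_idle wake)+
qed

end

section \<open>The partitioned worklist\<close>

text \<open>A server is in charge of its partition from the fetch_add that returned 0 to the
  fetch_sub that ends its loop, including the calls of send in between.\<close>

fun serving :: "('a, 's) pc \<Rightarrow> nat option" where
  "serving (PTake p) = Some p"
| "serving (PRead p t x) = Some p"
| "serving (PWrite p t x m) = Some p"
| "serving (PLeave p) = Some p"
| "serving c = (case job_of c of Some (j, b) \<Rightarrow> fst j | None \<Rightarrow> None)"

fun accessing :: "('a, 's) pc \<Rightarrow> nat option" where
  "accessing (PRead p t x) = Some p"
| "accessing (PWrite p t x m) = Some p"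
| "accessing _ = None"

definition weight :: "nat \<Rightarrow> ('a, 's) pc \<Rightarrow> int" where
  "weight p c = (if c = PEnter p then 1 else if serving c = Some p \<and> c \<noteq> PTake p then - 1 else 0)"

definition enum :: "'a list \<Rightarrow> (nat \<times> 'a) list" where
  "enum xs = zip [1..<Suc (length xs)] xs"

lemma enum_snoc [simp]: "enum (xs @ [x]) = enum xs @ [(Suc (length xs), x)]"
proof -
  have "[1..<Suc (length (xs @ [x]))] = [1..<Suc (length xs)] @ [Suc (length xs)]"
    by simp
  then show ?thesis by (simp add: enum_def del: upt_Suc)
qed

lemma length_enum [simp]: "length (enum xs) = length xs"
  by (simp add: enum_def del: upt_Suc)

lemma nth_enum [simp]: "i < length xs \<Longrightarrow> enum xs ! i = (Suc i, xs ! i)"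
  by (simp add: enum_def del: upt_Suc)

lemma in_set_enum: "(t, x) \<in> set (enum xs) \<longleftrightarrow> 0 < t \<and> t \<le> length xs \<and> x = xs ! (t - 1)"
proof -
  have "(t, x) \<in> set (enum xs) \<longleftrightarrow> (\<exists>i < length xs. (Suc i, xs ! i) = (t, x))"
    by (auto simp: in_set_conv_nth cong: conj_cong)
  then show ?thesis by (cases t) auto
qed

lemma sorted_enum: "sorted_wrt (<) (map fst (enum xs))"
proof -
  have "map fst (enum xs) = [1..<Suc (length xs)]"
    by (simp add: enum_def del: upt_Suc)
  then show ?thesis by (metis sorted_wrt_upt)
qed

text \<open>Each partition is consumed in order, so one mark per partition determines the set. It
  need not be an interval, because partitions advance at different speeds.\<close>

definition taken :: "('a \<Rightarrow> nat) \<Rightarrow> (nat \<Rightarrow> nat) \<Rightarrow> 'a list \<Rightarrow> nat set" where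
  "taken pk mark xs = {t. 0 < t \<and> t \<le> length xs \<and> t \<le> mark (pk (xs ! (t - 1)))}"

lemma sum_fun_upd:
  fixes g :: "'b \<Rightarrow> int"
  assumes "w < (N :: nat)"
  shows "(\<Sum>v<N. g ((f(w := c)) v)) = (\<Sum>v<N. g (f v)) - g (f w) + g c"
proof -
  have "(\<Sum>v<N. g ((f(w := c)) v)) = g c + (\<Sum>v\<in>{..<N} - {w}. g (f v))"
    using assms by (subst sum.remove[of _ w]) auto
  moreover have "(\<Sum>v<N. g (f v)) = g (f w) + (\<Sum>v\<in>{..<N} - {w}. g (f v))"
    using assms by (subst sum.remove[of _ w]) auto
  ultimately show ?thesis by simp
qed

text \<open>A tuple changes only the location of its own key. The memory of a key can therefore be
  compared with a sequential run cut at the mark of its own partition, wherever the other partitions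
  stand.\<close>

lemma final_mem_other_key:
  assumes "i \<le> j" "j \<le> length xs" "\<And>t. \<lbrakk>i < t; t \<le> j\<rbrakk> \<Longrightarrow> key (xs ! (t - 1)) \<noteq> c"
  shows "final_mem (Partitioned n key part s0 h) (take j xs) (Some c) =
         final_mem (Partitioned n key part s0 h) (take i xs) (Some c)"
  using assms
proof (induction j rule: dec_induct)
  case (step m)
  then have "key (xs ! m) \<noteq> c" by (metis Suc_eq_plus1 diff_Suc_1 le_imp_less_Suc order_refl)
  then show ?case
    using step by (simp add: final_mem_take_Suc split_beta)
qed simp

text \<open>
  \<open>F\<close> entries of masterQueue have been removed, and \<open>mark p\<close> is the serial number last taken from
  partition_inv \<open>p\<close>. In \<open>count\<close> the left-hand side is the number of removed entries of \<open>p\<close> whose tuple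
  is not yet taken: each belongs to a worker about to execute fetch_add (weight 1) or is counted by
  count[p], which also still counts the tuple being processed (weight -1). \<open>ex\<close> is the tuple, if any,
  that is in its partition_inv queue while its entry in masterQueue is still missing.
\<close>

locale partition_inv =
  fixes N n :: nat and key :: "'a \<Rightarrow> 'k" and part :: "'k \<Rightarrow> nat" and s0 :: "'k \<Rightarrow> 's"
    and h :: "'s \<Rightarrow> 'a \<Rightarrow> 's \<times> 'a list" and xs ex :: "'a list" and mark :: "nat \<Rightarrow> nat" and F :: nat
    and d :: "('a, 'k, 's) opdata" and f :: "nat \<Rightarrow> ('a, 's) pc"
  assumes F_le: "F \<le> length xs"
    and master: "master d = map (\<lambda>x. part (key x)) (drop F xs)"
    and parts: "parts d p = filter (\<lambda>(t, x). part (key x) = p \<and> mark p < t) (enum (xs @ ex))"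
    and mark_le: "mark p \<le> F"
    and count: "int (card {t. mark p < t \<and> t \<le> F \<and> part (key (xs ! (t - 1))) = p}) =
       cnt d p + (\<Sum>w<N. weight p (f w))"
    and serving_cnt: "serving (f w) = Some p \<Longrightarrow> 0 < cnt d p"
    and serving_unique: "\<lbrakk>serving (f w) = Some p; serving (f w') = Some p\<rbrakk> \<Longrightarrow> w = w'"
    and cnt_nonneg: "0 \<le> cnt d p"
    and cnt_serving: "0 < cnt d p \<Longrightarrow> \<exists>w. serving (f w) = Some p"
    and reading: "f w = PRead p t x \<Longrightarrow>
       t = mark p \<and> 0 < t \<and> x = xs ! (t - 1) \<and> part (key x) = p"
    and writing: "f w = PWrite p t x m \<Longrightarrow>
       t = mark p \<and> 0 < t \<and> x = xs ! (t - 1) \<and> part (key x) = p \<and> m = mem d (Some (key x))"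
    and holds_part: "\<lbrakk>holds (f w) = Some t; serving (f w) = Some p\<rbrakk> \<Longrightarrow> 0 < t \<and> t \<le> F \<and> part (key (xs ! (t - 1))) = p"
    and memory: "mem d (Some c) = final_mem (Partitioned n key part s0 h)
       (take (mark (part c) - (if \<exists>w. accessing (f w) = Some (part c) then 1 else 0)) xs) (Some c)"
    and outside: "N \<le> w \<Longrightarrow> f w = Return"
begin

abbreviation "pk x \<equiv> part (key x)"
abbreviation "waiting mk l q \<equiv> {t. mk q < t \<and> t \<le> l \<and> pk (xs ! (t - 1)) = q}"
abbreviation "current mk q t x \<equiv> t = mk q \<and> 0 < t \<and> x = xs ! (t - 1) \<and> pk x = q"
abbreviation "current_read mk q t x v \<equiv> t = mk q \<and> 0 < t \<and> x = xs ! (t - 1) \<and> pk x = q \<and> v"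
abbreviation "self \<equiv> partition_inv N n key part s0 h"

section \<open>Effect of single actions on the partitioned worklist\<close>

lemma ex_upd_eq:
  assumes "Q c = Q (f w)" shows "(\<exists>w'. Q ((f(w := c)) w')) = (\<exists>w'. Q (f w'))"
  using assms by (metis fun_upd_apply)

lemma accessing_upd: "accessing c = accessing (f w) \<Longrightarrow>
    (\<exists>w'. accessing ((f(w := c)) w') = Some p) = (\<exists>w'. accessing (f w') = Some p)"
  by (rule ex_upd_eq) simp

lemma weight_upd: "w < N \<Longrightarrow> (\<Sum>v<N. weight p ((f(w := c)) v)) = (\<Sum>v<N. weight p (f v)) - weight p (f w) + weight p c"
  by (rule sum_fun_upd)

lemma data_cong:
  assumes d': "mem d' = mem d" "cnt d' = cnt d" "parts d' = parts d" "master d' = master d"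
  shows "self xs ex mark F d' f"
  by (unfold_locales, unfold d')
    (fact F_le master parts mark_le count serving_cnt serving_unique cnt_nonneg cnt_serving
      reading writing holds_part memory outside)+

text \<open>Covers the actions that neither touch operator state nor take a tuple from a partition
  queue. Only the balance of counters and weights and the choice of servers can change, and these
  are left as hypotheses.\<close>

lemma blank_step:
  assumes w: "w < N" and ac: "accessing c = None" "accessing (f w) = None"
    and F': "F \<le> F'" "F' \<le> length xs" "master d' = map pk (drop F' xs)"
    and d': "mem d' = mem d" "parts d' = parts d"
    and count': "\<And>p. int (card (waiting mark F' p)) = cnt d' p + (\<Sum>v<N. weight p (f v)) - weight p (f w) + weight p c"
    and cnt': "\<And>p. 0 \<le> cnt d' p"
    and serving': "\<And>w' p. serving ((f(w := c)) w') = Some p \<Longrightarrow> 0 < cnt d' p"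
      "\<And>w' w'' p. \<lbrakk>serving ((f(w := c)) w') = Some p; serving ((f(w := c)) w'') = Some p\<rbrakk> \<Longrightarrow> w' = w''"
      "\<And>p. 0 < cnt d' p \<Longrightarrow> \<exists>w'. serving ((f(w := c)) w') = Some p"
    and hold: "holds c = None \<or> holds c = holds (f w) \<and> serving c = serving (f w)"
  shows "self xs ex mark F' d' (f(w := c))"
proof -
  have acc: "accessing c = accessing (f w)" using ac by simp
  show ?thesis
  proof (unfold_locales, unfold d' accessing_upd[OF acc])
    show "mark p \<le> F'" for p using mark_le[of p] F'(1) by simp
    show "int (card (waiting mark F' p)) = cnt d' p + (\<Sum>v<N. weight p ((f(w := c)) v))" for p
      using count'[of p] weight_upd[OF w] by simp
    show "current mark p t x" if "(f(w := c)) w' = PRead p t x" for w' p t x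
      using that reading ac by (auto split: if_splits)
    show "current_read mark p t x (m = mem d (Some (key x)))" if "(f(w := c)) w' = PWrite p t x m" for w' p t x m
      using that writing ac by (auto split: if_splits)
    show "0 < t \<and> t \<le> F' \<and> pk (xs ! (t - 1)) = p"
      if "holds ((f(w := c)) w') = Some t" "serving ((f(w := c)) w') = Some p" for w' t p
      using that holds_part[of w' t p] hold F'(1) by (auto split: if_splits)
    show "(f(w := c)) w' = Return" if "N \<le> w'" for w'
      using that outside w by auto
  qed (fact F' parts serving' cnt' memory)+
qed

lemma quiet_step:
  assumes w: "w < N" and "serving c = serving (f w)" "\<And>p. weight p c = weight p (f w)"
    and "accessing c = None" "accessing (f w) = None" "holds c = None \<or> holds c = holds (f w)"
    and d': "mem d' = mem d" "cnt d' = cnt d" "parts d' = parts d" "master d' = master d"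
  shows "self xs ex mark F d' (f(w := c))"
proof -
  have same: "serving ((f(w := c)) w') = serving (f w')" for w'
    using assms(2) by simp
  show ?thesis
    by (rule blank_step; (unfold d' same)?)
      (use assms F_le master count serving_cnt serving_unique cnt_nonneg cnt_serving in auto)
qed

lemma fetch_step:
  assumes w: "w < N" "f w = Fetch" and m: "master d = p # ps"
    and d': "mem d' = mem d" "cnt d' = cnt d" "parts d' = parts d" "master d' = ps"
  shows "self xs ex mark (Suc F) d' (f(w := PEnter p)) \<and> F < length xs"
proof -
  have "drop F xs \<noteq> []" using m master by auto
  then have Fl: "F < length xs" by simp
  then have "drop F xs = xs ! F # drop (Suc F) xs" by (rule Cons_nth_drop_Suc[symmetric])
  then have F: "pk (xs ! F) = p" "ps = map pk (drop (Suc F) xs)"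
    using m master by simp_all
  have same: "serving ((f(w := PEnter p)) w') = serving (f w')" for w'
    using w by simp
  \<comment> \<open>Number \<open>Suc F\<close> belongs to index \<open>F\<close>, the entry being
    removed; it exceeds every mark and so joins the waiting numbers of its partition.\<close>
  have set: "waiting mark (Suc F) q = (if q = p then insert (Suc F) else id) (waiting mark F q)" for q
    using mark_le[of q] F by (auto simp: le_Suc_eq)
  have fin: "finite (waiting mark F q)" for q
    by (rule finite_subset[of _ "{..F}"]) auto
  have card: "int (card (waiting mark (Suc F) q)) = int (card (waiting mark F q)) + (if q = p then 1 else 0)" for q
    unfolding set using fin by (simp add: card_insert_if)
  have "self xs ex mark (Suc F) d' (f(w := PEnter p))"
  proof (rule blank_step; (unfold d' same card)?)
    show "int (card (waiting mark F q)) + (if q = p then 1 else 0) =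
      cnt d q + (\<Sum>v<N. weight q (f v)) - weight q (f w) + weight q (PEnter p :: ('a, 's) pc)" for q
      using count[of q] w by (simp add: weight_def)
  qed (use w Fl F serving_cnt serving_unique cnt_nonneg cnt_serving in auto)
  then show ?thesis using Fl by simp
qed

text \<open>The increment of the counter is paid for by the worker's weight falling from 1 to 0. An
  old value 0 means that nobody serves the partition, since a server keeps the counter positive, so
  the worker may become its only server.\<close>

lemma enter_step:
  assumes w: "w < N" "f w = PEnter p"
    and d': "mem d' = mem d" "cnt d' = (cnt d)(p := cnt d p + 1)" "parts d' = parts d" "master d' = master d"
    and c: "c = (if cnt d p = 0 then PTake p else Fetch)"
  shows "self xs ex mark F d' (f(w := c))"
proof -
  have sv: "serving ((f(w := c)) w') = Some q \<longleftrightarrow>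
      serving (f w') = Some q \<or> cnt d p = 0 \<and> w' = w \<and> q = p" for w' q
    using w c by auto
  show ?thesis
  proof (rule blank_step; (unfold sv)?)
    show "int (card (waiting mark F q)) = cnt d' q + (\<Sum>v<N. weight q (f v)) - weight q (f w) + weight q c" for q
      using count[of q] w c d' by (simp add: weight_def)
    show "0 \<le> cnt d' q" for q using cnt_nonneg[of q] d' by auto
    show "0 < cnt d' q" if "serving (f w') = Some q \<or> cnt d p = 0 \<and> w' = w \<and> q = p" for w' q
      using that serving_cnt[of w' q] d' cnt_nonneg[of p] by auto
    show "w' = w''" if "serving (f w') = Some q \<or> cnt d p = 0 \<and> w' = w \<and> q = p"
      "serving (f w'') = Some q \<or> cnt d p = 0 \<and> w'' = w \<and> q = p" for w' w'' q
      using that serving_unique[of w' q w''] serving_cnt[of w' p] serving_cnt[of w'' p] by auto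
    show "\<exists>w'. serving (f w') = Some q \<or> cnt d p = 0 \<and> w' = w \<and> q = p" if "0 < cnt d' q" for q
      using cnt_serving[of q] cnt_nonneg[of p] that d' by (cases "cnt d p = 0"; cases "q = p") auto
  qed (use w c d' F_le master in auto)
qed

text \<open>The decrement is matched by the worker's weight rising from -1 to 0. If the counter
  stays positive, the same worker remains in charge.\<close>

lemma leave_step:
  assumes w: "w < N" "f w = PLeave p"
    and d': "mem d' = mem d" "cnt d' = (cnt d)(p := cnt d p - 1)" "parts d' = parts d" "master d' = master d"
    and c: "c = (if cnt d p > 1 then PTake p else Fetch)"
  shows "self xs ex mark F d' (f(w := c))"
proof -
  have sw: "serving (f w) = Some p" using w by simp
  have pos: "0 < cnt d p" using serving_cnt[OF sw] .
  have sv: "serving ((f(w := c)) w') = Some q \<longleftrightarrow>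
      serving (f w') = Some q \<and> (w' = w \<longrightarrow> cnt d p > 1)" for w' q
    using w c by auto
  show ?thesis
  proof (rule blank_step; (unfold sv)?)
    show "int (card (waiting mark F q)) = cnt d' q + (\<Sum>v<N. weight q (f v)) - weight q (f w) + weight q c" for q
      using count[of q] w c d' by (simp add: weight_def)
    show "0 \<le> cnt d' q" for q using cnt_nonneg[of q] pos d' by auto
    show "0 < cnt d' q" if "serving (f w') = Some q \<and> (w' = w \<longrightarrow> cnt d p > 1)" for w' q
      using that serving_cnt[of w' q] serving_unique[OF sw, of w'] d' pos by auto
    show "w' = w''" if "serving (f w') = Some q \<and> (w' = w \<longrightarrow> cnt d p > 1)"
      "serving (f w'') = Some q \<and> (w'' = w \<longrightarrow> cnt d p > 1)" for w' w'' q
      using that serving_unique[of w' q w''] by auto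
    show "\<exists>w'. serving (f w') = Some q \<and> (w' = w \<longrightarrow> cnt d p > 1)" if q: "0 < cnt d' q" for q
    proof (cases "q = p")
      case True
      then show ?thesis using sw q d' by (intro exI[of _ w]) auto
    next
      case False
      then obtain w' where "serving (f w') = Some q" using cnt_serving[of q] q d' by auto
      then show ?thesis using sw False by (intro exI[of _ w']) auto
    qed
  qed (use w c d' F_le master in auto)
qed

text \<open>With nothing waiting, counter and weights add up to 0. Only the server can have negative
  weight, and at least -1, so the counter is at most 1. At \<open>PTake\<close> the weight would be
  0 and the counter not positive, against \<open>serving_cnt\<close>.\<close>

lemma cnt_le_1:
  assumes w: "serving (f w) = Some p" and 0: "(waiting mark F p) = {}"
  shows "cnt d p \<le> 1 \<and> f w \<noteq> PTake p"
proof -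
  have wN: "w < N" using outside[of w] w by (metis job_of.simps(12) not_le option.distinct(1) option.simps(4) serving.simps(6))
  have "(\<Sum>v<N. weight p (f v)) = weight p (f w) + (\<Sum>v\<in>{..<N} - {w}. weight p (f v))"
    using wN by (subst sum.remove[of _ w]) auto
  moreover have "0 \<le> weight p (f v)" if "v \<in> {..<N} - {w}" for v
    using that serving_unique[OF w, of v] by (auto simp: weight_def)
  then have "0 \<le> (\<Sum>v\<in>{..<N} - {w}. weight p (f v))"
    by (rule sum_nonneg)
  moreover have "cnt d p + (\<Sum>v<N. weight p (f v)) = 0"
    using count[of p] unfolding 0 by simp
  moreover have "weight p (f w) \<ge> - 1" "f w = PTake p \<Longrightarrow> weight p (f w) = 0"
    by (auto simp: weight_def)
  ultimately show ?thesis using serving_cnt[OF w] by linarith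
qed

text \<open>The partition queue lists the numbers above the mark in increasing order, so its head is
  the least of them. A waiting number bounds the head by \<open>F\<close>, so a tuple whose
  masterQueue entry is still missing is not taken prematurely.\<close>

lemma next_in_partition:
  assumes "(waiting mark F p) \<noteq> {}"
  shows "\<exists>t rest. parts d p = (t, xs ! (t - 1)) # rest \<and> mark p < t \<and> t \<le> F \<and> pk (xs ! (t - 1)) = p \<and>
    (\<forall>t'. mark p < t' \<and> t' < t \<longrightarrow> pk (xs ! (t' - 1)) \<noteq> p) \<and>
    rest = filter (\<lambda>(t', x). pk x = p \<and> t < t') (enum (xs @ ex))"
proof -
  let ?l = "enum (xs @ ex)" and ?P = "\<lambda>(t, x). pk x = p \<and> mark p < t"
  obtain t0 where t0: "mark p < t0" "t0 \<le> F" "pk (xs ! (t0 - 1)) = p"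
    using assms by blast
  have mem: "(t0, xs ! (t0 - 1)) \<in> set ?l"
    using t0 F_le by (auto simp: in_set_enum nth_append)
  then have "filter ?P ?l \<noteq> []"
    using t0 by (auto simp: filter_empty_conv)
  then obtain t x rest where r: "filter ?P ?l = (t, x) # rest"
    by (metis neq_Nil_conv surj_pair)
  then have "(t, x) \<in> set (filter ?P ?l)" by simp
  then have tx: "(t, x) \<in> set ?l" "pk x = p" "mark p < t" by auto
  have srt: "sorted_wrt (\<lambda>a b. fst a < fst b) (filter ?P ?l)"
    using sorted_enum[of "xs @ ex"] by (auto intro: sorted_wrt_filter simp: sorted_wrt_map)
  have min: "t \<le> t'" if "(t', x') \<in> set ?l" "pk x' = p" "mark p < t'" for t' x'
  proof -
    have "(t', x') \<in> set ((t, x) # rest)" using that r[symmetric] by simp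
    then show ?thesis using srt r by auto
  qed
  have "t \<le> t0" using min[OF mem] t0 by simp
  then have tF: "t \<le> F" "x = xs ! (t - 1)" "0 < t"
    using t0 tx F_le by (auto simp: in_set_enum nth_append)
  have rest: "rest = filter (\<lambda>(t', x). pk x = p \<and> t < t') ?l"
  proof -
    have "filter (\<lambda>(t', x). pk x = p \<and> t < t') ?l = filter (\<lambda>a. t < fst a) (filter ?P ?l)"
      using tx by (auto intro!: filter_cong)
    also have "\<dots> = filter (\<lambda>a. t < fst a) rest" by (simp add: r)
    also have "\<dots> = rest"
      using srt r by (auto simp: filter_id_conv)
    finally show ?thesis by simp
  qed
  show ?thesis
  proof (intro exI conjI allI impI)
    show "parts d p = (t, xs ! (t - 1)) # rest" using parts[of p] r tF by simp
    fix t' assume t': "mark p < t' \<and> t' < t"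
    show "pk (xs ! (t' - 1)) \<noteq> p"
    proof
      assume "pk (xs ! (t' - 1)) = p"
      moreover have "(t', xs ! (t' - 1)) \<in> set ?l"
        using t' tF F_le by (auto simp: in_set_enum nth_append)
      ultimately show False using min[of t' "xs ! (t' - 1)"] t' by simp
    qed
  qed (use tx tF rest in auto)
qed

text \<open>This is why the inner tryDequeue of consumeInputs may ignore its result: a worker about
  to call it always has a tuple waiting.\<close>

lemma take_nonempty:
  assumes "f w = PTake p"
  shows "(waiting mark F p) \<noteq> {}"
  using cnt_le_1[of w p] assms by auto

lemma take_step:
  assumes w: "w < N" "f w = PTake p" and m: "parts d p = (t, x) # rest"
    and d': "mem d' = mem d" "cnt d' = cnt d" "parts d' = (parts d)(p := rest)" "master d' = master d"
  shows "self xs ex (mark(p := t)) F d' (f(w := PRead p t x)) \<and> 0 < t \<and> t \<le> length xs \<and> x = xs ! (t - 1) \<and>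
    t \<notin> taken pk mark xs \<and> taken pk (mark(p := t)) xs = insert t (taken pk mark xs)"
proof -
  let ?c = "PRead p t x :: ('a, 's) pc"
  obtain t' rest' where "parts d p = (t', xs ! (t' - 1)) # rest'" "mark p < t'" "t' \<le> F" "pk (xs ! (t' - 1)) = p"
    "\<forall>t''. mark p < t'' \<and> t'' < t' \<longrightarrow> pk (xs ! (t'' - 1)) \<noteq> p"
    "rest' = filter (\<lambda>(t'', x). pk x = p \<and> t' < t'') (enum (xs @ ex))"
    using next_in_partition[OF take_nonempty[OF w(2)]] by auto
  then have t: "mark p < t" "t \<le> F" "pk x = p" "x = xs ! (t - 1)"
    "\<And>t''. \<lbrakk>mark p < t''; t'' < t\<rbrakk> \<Longrightarrow> pk (xs ! (t'' - 1)) \<noteq> p"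
    "rest = filter (\<lambda>(t'', x). pk x = p \<and> t < t'') (enum (xs @ ex))"
    using m by auto
  have t0: "0 < t" "t \<le> length xs" using t F_le by auto
  have sw: "serving (f w) = Some p" using w by simp
  have sv: "serving ((f(w := ?c)) w') = serving (f w')" for w'
    using w by simp
  have ws: "(\<Sum>v<N. weight q ((f(w := ?c)) v)) = (\<Sum>v<N. weight q (f v)) - (if q = p then 1 else 0)" for q
    using weight_upd[OF w(1)] w by (simp add: weight_def)
  have acc: "serving c = Some q" if "accessing c = Some q" for c :: "('a, 's) pc" and q
    using that by (cases c) auto
  have noacc: "accessing (f w') \<noteq> Some p" for w'
  proof
    assume a: "accessing (f w') = Some p"
    then have "w = w'" using serving_unique[OF sw] acc by blast
    then show False using a w by simp
  qed
  have ac: "(\<exists>w'. accessing ((f(w := ?c)) w') = Some q) \<longleftrightarrow> (\<exists>w'. accessing (f w') = Some q) \<or> q = p" for q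
  proof (cases "q = p")
    case True
    then show ?thesis by (auto intro!: exI[of _ w])
  next
    case False
    then show ?thesis using ex_upd_eq[of "\<lambda>c. accessing c = Some q" ?c w] w by simp
  qed
  have set: "{t'. (mark(p := t)) q < t' \<and> t' \<le> F \<and> pk (xs ! (t' - 1)) = q} =
     (if q = p then {t'. mark q < t' \<and> t' \<le> F \<and> pk (xs ! (t' - 1)) = q} - {t}
      else {t'. mark q < t' \<and> t' \<le> F \<and> pk (xs ! (t' - 1)) = q})" for q
  proof (cases "q = p")
    case True
    \<comment> \<open>No number of partition \<open>p\<close> lies strictly between the old mark and
      \<open>t\<close>, so raising the mark removes exactly \<open>t\<close> from the waiting
      numbers.\<close>
    have "t < t' \<longleftrightarrow> mark p < t' \<and> t' \<noteq> t" if "pk (xs ! (t' - 1)) = p" for t'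
      using t(1) t(5)[of t'] that by (meson linorder_neqE_nat order.strict_trans order_less_irrefl)
    then show ?thesis using True by auto
  qed simp
  have fin: "finite (waiting mark F q)" for q
    by (rule finite_subset[of _ "{..F}"]) auto
  have card: "int (card {t'. (mark(p := t)) q < t' \<and> t' \<le> F \<and> pk (xs ! (t' - 1)) = q}) =
     int (card (waiting mark F q)) - (if q = p then 1 else 0)" for q
  proof (cases "q = p")
    case True
    have "t \<in> (waiting mark F q)" using t True by simp
    then show ?thesis unfolding set using fin[of q] True
      using card_Suc_Diff1[OF fin[of q], of t] by simp
  qed (simp add: set)
  have "self xs ex (mark(p := t)) F d' (f(w := ?c))"
  proof (unfold_locales, unfold d'(1,2,4) sv ws ac card)
    show "parts d' q = filter (\<lambda>(t', x). pk x = q \<and> (mark(p := t)) q < t') (enum (xs @ ex))" for q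
      using parts[of q] t d' by simp
    show "(mark(p := t)) q \<le> F" for q using mark_le[of q] t by simp
    show "int (card (waiting mark F q)) - (if q = p then 1 else 0)
        = cnt d q + ((\<Sum>v<N. weight q (f v)) - (if q = p then 1 else 0))" for q
      using count[of q] by simp
    show "t' = (mark(p := t)) p' \<and> 0 < t' \<and> x' = xs ! (t' - 1) \<and> pk x' = p'"
      if "(f(w := ?c)) w' = PRead p' t' x'" for w' p' t' x'
      using that reading[of w' p' t' x'] noacc[of w'] t t0 by (auto split: if_splits)
    show "t' = (mark(p := t)) p' \<and> 0 < t' \<and> x' = xs ! (t' - 1) \<and> pk x' = p' \<and> m = mem d (Some (key x'))"
      if "(f(w := ?c)) w' = PWrite p' t' x' m" for w' p' t' x' m
      using that writing[of w' p' t' x'] noacc[of w'] by (auto split: if_splits)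
    show "(f(w := ?c)) w' = Return" if "N \<le> w'" for w'
      using that outside w by auto
    show "0 < t' \<and> t' \<le> F \<and> pk (xs ! (t' - 1)) = q" if "holds ((f(w := ?c)) w') = Some t'" "serving (f w') = Some q" for w' t' q
      using that holds_part[of w' t' q] w t t0 by (auto split: if_splits)
    show "mem d (Some c) = final_mem (Partitioned n key part s0 h)
       (take ((mark(p := t)) (part c) - (if (\<exists>w'. accessing (f w') = Some (part c)) \<or> part c = p then 1 else 0)) xs) (Some c)" for c
    proof (cases "part c = p")
      case True
      then have "mem d (Some c) = final_mem (Partitioned n key part s0 h) (take (mark p) xs) (Some c)"
        using memory[of c] noacc by simp
      \<comment> \<open>Tuples between the old mark and \<open>t\<close> belong to other partitions
        and hence have other keys. The run stops at \<open>t - 1\<close> because the write for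
        \<open>t\<close> is still to come.\<close>
      also have "\<dots> = final_mem (Partitioned n key part s0 h) (take (t - 1) xs) (Some c)"
      proof (rule final_mem_other_key[symmetric])
        show "key (xs ! (t' - 1)) \<noteq> c" if "mark p < t'" "t' \<le> t - 1" for t'
        proof -
          have "t' < t" using that t0 by linarith
          then show ?thesis using t(5)[of t'] that True by auto
        qed
      qed (use t t0 in auto)
      finally show ?thesis using True by simp
    next
      case False
      then show ?thesis using memory[of c] by simp
    qed
  qed (fact F_le master serving_cnt serving_unique cnt_nonneg cnt_serving)+
  moreover have "t \<notin> taken pk mark xs"
    using t by (auto simp: taken_def)
  moreover have "taken pk (mark(p := t)) xs = insert t (taken pk mark xs)"
  proof -
    have "t' \<le> t \<longleftrightarrow> t' \<le> mark p \<or> t' = t" if "pk (xs ! (t' - 1)) = p" for t'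
      using t(1) t(5)[of t'] that by (meson le_less_trans less_imp_le linorder_neqE_nat not_le order_refl)
    then show ?thesis using t t0 by (auto simp: taken_def)
  qed
  ultimately show ?thesis using t t0 by simp
qed

lemma read_step:
  assumes w: "w < N" "f w = PRead p t x"
    and d': "mem d' = mem d" "cnt d' = cnt d" "parts d' = parts d" "master d' = master d"
  shows "self xs ex mark F d' (f(w := PWrite p t x (mem d (Some (key x)))))"
proof -
  let ?c = "PWrite p t x (mem d (Some (key x))) :: ('a, 's) pc"
  have same: "serving ((f(w := ?c)) w') = serving (f w')" "holds ((f(w := ?c)) w') = holds (f w')" for w'
    using w by simp_all
  have ac: "accessing ?c = accessing (f w)" using w by simp
  have ws: "(\<Sum>v<N. weight p ((f(w := ?c)) v)) = (\<Sum>v<N. weight p (f v))" for p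
    using weight_upd[OF w(1)] w by (simp add: weight_def)
  show ?thesis
  proof (unfold_locales, unfold d' same accessing_upd[OF ac] ws)
    show "current mark p t x" if "(f(w := ?c)) w' = PRead p t x" for w' p t x
      using that reading by (auto split: if_splits)
    show "current_read mark p' t' x' (m = mem d (Some (key x')))"
      if "(f(w := ?c)) w' = PWrite p' t' x' m" for w' p' t' x' m
      using that writing[of w' p' t' x'] reading[OF w(2)] by (auto split: if_splits)
    show "(f(w := ?c)) w' = Return" if "N \<le> w'" for w'
      using that outside w by auto
  qed (fact F_le master parts mark_le count serving_cnt serving_unique cnt_nonneg cnt_serving memory holds_part)+
qed

text \<open>Between read and write the worker is the only server of its partition, so the value it
  has read is still the sequential one before number \<open>t\<close>. Applying the operator then
  reproduces the sequential step in memory and output.\<close>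

lemma write_step:
  assumes w: "w < N" "f w = PWrite p t x m" and h: "h m x = (m', ys)"
    and d': "mem d' = (mem d)(Some (key x) := m')" "cnt d' = cnt d" "parts d' = parts d" "master d' = master d"
  shows "self xs ex mark F d' (f(w := AddLoad (Some p, t, ys))) \<and>
    ys = unit_of (Partitioned n key part s0 h) xs t"
proof -
  let ?c = "AddLoad (Some p, t, ys) :: ('a, 's) pc" and ?p = "Partitioned n key part s0 h"
  have same: "serving ((f(w := ?c)) w') = serving (f w')" "holds ((f(w := ?c)) w') = holds (f w')" for w'
    using w by simp_all
  have wr: "t = mark p" "0 < t" "x = xs ! (t - 1)" "pk x = p" "m = mem d (Some (key x))"
    using writing[OF w(2)] by auto
  have tl: "t - 1 < length xs" using mark_le[of p] F_le wr by linarith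
  have ws: "(\<Sum>v<N. weight p ((f(w := ?c)) v)) = (\<Sum>v<N. weight p (f v))" for p
    using weight_upd[OF w(1)] w by (simp add: weight_def)
  have sw: "serving (f w) = Some p" using w by simp
  have acc: "serving c = Some q" if "accessing c = Some q" for c :: "('a, 's) pc" and q
    using that by (cases c) auto
  have other: "accessing (f w') \<noteq> Some p" if "w' \<noteq> w" for w'
    using serving_unique[OF sw, of w'] acc that by metis
  have ac: "(\<exists>w'. accessing ((f(w := ?c)) w') = Some q) \<longleftrightarrow> (\<exists>w'. accessing (f w') = Some q) \<and> q \<noteq> p" for q
  proof (cases "q = p")
    case True
    then show ?thesis using other by (auto split: if_splits)
  next
    case False
    then have "accessing ?c = Some q \<longleftrightarrow> accessing (f w) = Some q" using w by simp
    then show ?thesis using False ex_upd_eq[of "\<lambda>c. accessing c = Some q" ?c w] by simp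
  qed
  have acp: "\<exists>w'. accessing (f w') = Some p" using w by (intro exI[of _ w]) simp
  have mem1: "mem d (Some c) = final_mem ?p (take (t - 1) xs) (Some c)" if "part c = p" for c
    using memory[of c] acp that wr by simp
  have ap: "apply_op ?p (final_mem ?p (take (t - 1) xs)) x = ((final_mem ?p (take (t - 1) xs))(Some (key x) := m'), ys)"
    using mem1[of "key x"] wr h by simp
  have fm: "final_mem ?p (take t xs) = (final_mem ?p (take (t - 1) xs))(Some (key x) := m')"
    using final_mem_take_Suc[OF tl, of ?p] ap wr by simp
  have "self xs ex mark F d' (f(w := ?c))"
  proof (unfold_locales, unfold d'(2-4) same ac ws)
    show "current mark p t x" if "(f(w := ?c)) w' = PRead p t x" for w' p t x
      using that reading by (auto split: if_splits)
    \<comment> \<open>Another worker about to write serves another partition, so its key differs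
      from \<open>key x\<close> and the value it has read remains current.\<close>
    show "current_read mark p' t' x' (m = mem d' (Some (key x')))"
      if "(f(w := ?c)) w' = PWrite p' t' x' m" for w' p' t' x' m
      using that writing[of w' p' t' x'] other[of w'] wr d' by (auto split: if_splits)
    show "(f(w := ?c)) w' = Return" if "N \<le> w'" for w'
      using that outside w by auto
    show "mem d' (Some c) = final_mem ?p
       (take (mark (part c) - (if (\<exists>w'. accessing (f w') = Some (part c)) \<and> part c \<noteq> p then 1 else 0)) xs) (Some c)" for c
      using memory[of c] mem1[of c] fm wr d' by (cases "part c = p") auto
  qed (fact F_le master parts mark_le count serving_cnt serving_unique cnt_nonneg cnt_serving holds_part)+
  moreover have "ys = unit_of ?p xs t"
    unfolding unit_of_def using ap wr by simp
  ultimately show ?thesis by simp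
qed

lemma enqueue_step:
  assumes ex: "ex = []" and d': "mem d' = mem d" "cnt d' = cnt d" "master d' = master d"
    "parts d' = (parts d)(pk x := parts d (pk x) @ [(Suc (length xs), x)])"
  shows "self xs [x] mark F d' f"
proof (unfold_locales, unfold d'(1-3))
  have "mark (pk x) < Suc (length xs)"
    using mark_le[of "pk x"] F_le by simp
  then show "parts d' q = filter (\<lambda>(t, x). pk x = q \<and> mark q < t) (enum (xs @ [x]))" for q
    using parts[of q] d' ex by auto
qed (fact F_le master mark_le count serving_cnt serving_unique cnt_nonneg cnt_serving reading writing holds_part memory outside)+

text \<open>The tuple counts as received only now that its masterQueue entry exists. All marks are
  at most \<open>F\<close>, so neither taken nor waiting numbers refer to the new last
  position.\<close>

lemma added_step:
  assumes ex: "ex = [x]" and d': "mem d' = mem d" "cnt d' = cnt d" "parts d' = parts d"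
    "master d' = master d @ [pk x]"
  shows "self (xs @ [x]) [] mark F d' f" "taken pk mark (xs @ [x]) = taken pk mark xs"
proof -
  have nth: "(xs @ [x]) ! (t - 1) = xs ! (t - 1)" if "t \<le> F" "0 < t" for t
  proof -
    have "t - 1 < length xs" using that F_le by linarith
    then show ?thesis by (simp add: nth_append)
  qed
  have set: "{t. mark p < t \<and> t \<le> F \<and> pk ((xs @ [x]) ! (t - 1)) = p} =
     (waiting mark F p)" for p
    using nth by auto
  show "self (xs @ [x]) [] mark F d' f"
  proof (unfold_locales, unfold d'(1-3) set)
    show "F \<le> length (xs @ [x])" using F_le by simp
    show "master d' = map pk (drop F (xs @ [x]))" using F_le master d' by simp
    show "parts d q = filter (\<lambda>(t, x). pk x = q \<and> mark q < t) (enum ((xs @ [x]) @ []))" for q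
      using parts[of q] ex by simp
    show "t = mark p \<and> 0 < t \<and> x' = (xs @ [x]) ! (t - 1) \<and> pk x' = p" if "f w' = PRead p t x'" for w' p t x'
      using reading[OF that] nth[of t] mark_le[of p] by auto
    show "t = mark p \<and> 0 < t \<and> x' = (xs @ [x]) ! (t - 1) \<and> pk x' = p \<and> m = mem d (Some (key x'))"
      if "f w' = PWrite p t x' m" for w' p t x' m
      using writing[OF that] nth[of t] mark_le[of p] by auto
    show "0 < t \<and> t \<le> F \<and> pk ((xs @ [x]) ! (t - 1)) = q" if "holds (f w') = Some t" "serving (f w') = Some q" for w' t q
      using holds_part[OF that] nth[of t] by simp
    show "mem d (Some c) = final_mem (Partitioned n key part s0 h)
       (take (mark (part c) - (if \<exists>w'. accessing (f w') = Some (part c) then 1 else 0)) (xs @ [x])) (Some c)" for c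
      using memory[of c] mark_le[of "part c"] F_le by simp
  qed (fact mark_le count serving_cnt serving_unique cnt_nonneg cnt_serving outside)+
  show "taken pk mark (xs @ [x]) = taken pk mark xs"
  proof (rule set_eqI)
    fix t
    show "t \<in> taken pk mark (xs @ [x]) \<longleftrightarrow> t \<in> taken pk mark xs"
    proof (cases "t \<le> F \<and> 0 < t")
      case True
      then show ?thesis using nth[of t] F_le by (auto simp: taken_def)
    next
      case False
      then have "\<not> t \<le> mark p \<or> t = 0" for p
        using mark_le[of p] by linarith
      then show ?thesis by (auto simp: taken_def)
    qed
  qed
qed

end

section \<open>Actions of a worker\<close>

lemma modify_simps [simp]:
  "opd (modify k g S) k = g (opd S k)"
  "j \<noteq> k \<Longrightarrow> opd (modify k g S) j = opd S j"
  "outs (modify k g S) = outs S"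
  by (simp_all add: modify_def)

definition worklist_eq :: "('a, 'k, 's) opdata \<Rightarrow> ('a, 'k, 's) opdata \<Rightarrow> bool" where
  "worklist_eq d d' \<longleftrightarrow> mem d' = mem d \<and> squeue d' = squeue d \<and> queue d' = queue d \<and>
     master d' = master d \<and> parts d' = parts d \<and> cnt d' = cnt d \<and> serial d' = serial d"

text \<open>The contract between neighbours. An action may advance the delivery in progress;
  \<open>Out\<close> is then unchanged, because it already includes the undelivered rest. Otherwise
  it touches only its own operator, and may open a new delivery by appending a unit if none is in
  progress.\<close>

definition output_step ::
  "('a, 'k, 's) pipeline \<Rightarrow> nat \<Rightarrow> ('a, 'k, 's) shared \<Rightarrow> ('a, 'k, 's) shared \<Rightarrow>
   ('a, 's) pc \<Rightarrow> ('a, 's) pc \<Rightarrow> 'a list \<times> 'a delivery \<Rightarrow> 'a list \<times> 'a delivery \<Rightarrow> bool" where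
  "output_step P k S S' c c' = (\<lambda>(Out, V) (Out', V').
     fst V \<noteq> [] \<and> V = delivery_of c \<and> V' = delivery_of c' \<and> deliver P (Suc k) V S = (V', S') \<and> Out' = Out \<or>
     (\<forall>i. i \<noteq> k \<longrightarrow> opd S' i = opd S i) \<and> outs S' = outs S \<and>
       (Out' = Out \<and> V' = V \<or> V = ([], Start) \<and> (\<exists>u. V' = (u, Start) \<and> Out' = Out @ u)))"

lemma output_refl:
  "\<lbrakk>\<And>i. i \<noteq> k \<Longrightarrow> opd S' i = opd S i; outs S' = outs S\<rbrakk> \<Longrightarrow>
   output_step P k S S' c c' (Out, V) (Out, V)"
  by (simp add: output_step_def)

lemma output_emit:
  "\<lbrakk>\<And>i. i \<noteq> k \<Longrightarrow> opd S' i = opd S i; outs S' = outs S; V = ([], Start)\<rbrakk> \<Longrightarrow>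
   output_step P k S S' c c' (Out, V) (Out @ u, (u, Start))"
  by (simp add: output_step_def)

lemma output_deliver:
  "\<lbrakk>fst V \<noteq> []; V = delivery_of c; V' = delivery_of c'; deliver P (Suc k) V S = (V', S')\<rbrakk> \<Longrightarrow>
   output_step P k S S' c c' (Out, V) (Out, V')"
  by (simp add: output_step_def)

lemma deliver_start:
  assumes "deliver P k V S = (V', S')" "fst V \<noteq> []" "fst V' = []"
  shows "snd V' = Start"
  using assms by (cases "(P, k, V, S)" rule: deliver.cases) (auto split: if_splits operator.splits stage.splits simp: Let_def)

lemma deliver_other:
  assumes "deliver P k V S = (V', S')" "i \<noteq> k"
  shows "opd S' i = opd S i"
  using assms by (cases "(P, k, V, S)" rule: deliver.cases) (auto split: if_splits operator.splits stage.splits simp: Let_def)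

lemma resume_job: "job_of (resume j b) = (if b then None else Some (j, False))"
  by (cases "(j, b)" rule: resume.cases) auto

lemma resume_simps [simp]:
  "\<not> locked (resume j b)" "resume j b \<noteq> AddStore i" "wakes n (resume j b) = False"
  by (cases "(j, b)" rule: resume.cases; simp)+

lemma resume_holds: "holds (resume j b) = (if b then None else Some (fst (snd j)))"
  by (cases "(j, b)" rule: resume.cases) auto

text \<open>One case per action of send. The last conclusion follows the call, which keeps its job,
  turns success to true, or leaves through \<open>resume\<close>; the worklist invariants need this
  information about the worker.\<close>

lemma reorder_work:
  assumes R: "reorder (bufsize P k) U Tk (opd S k) f Out V"
    and job: "job_of (f w) = Some (j, b)" and work: "work P k (q, f w, S) (q', c', S')"
  shows "\<exists>Out' V'. reorder (bufsize P k) U Tk (opd S' k) (f(w := c')) Out' V' \<and>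
    output_step P k S S' (f w) c' (Out, V) (Out', V')"
    and "q' = q" and "worklist_eq (opd S k) (opd S' k)" and "nxt (opd S k) \<le> nxt (opd S' k)"
    and "job_of c' = Some (j, b) \<or> job_of c' = Some (j, True) \<and> \<not> b \<or> c' = resume j b"
proof -
  interpret reorder "bufsize P k" U Tk "opd S k" f Out V by (fact R)
  let ?s = "bufsize P k" and ?d = "opd S k"
  have u: "u = U t" if "j = (po, t, u)" "\<not> b" for po t u
    using unit[of w po t u] job that by simp
  let ?main = "(\<exists>Out' V'. reorder ?s U Tk (opd S' k) (f(w := c')) Out' V' \<and>
      output_step P k S S' (f w) c' (Out, V) (Out', V')) \<and> q' = q \<and> worklist_eq ?d (opd S' k) \<and>
      nxt ?d \<le> nxt (opd S' k) \<and>
      (job_of c' = Some (j, b) \<or> job_of c' = Some (j, True) \<and> \<not> b \<or> c' = resume j b)"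
  have finI: ?main if "reorder ?s U Tk d' (f(w := c')) Out' V'"
      "output_step P k S S' (f w) c' (Out, V) (Out', V')" "d' = opd S' k" "q' = q" "worklist_eq ?d (opd S' k)"
      "nxt ?d \<le> nxt (opd S' k)"
      "job_of c' = Some (j, b) \<or> job_of c' = Some (j, True) \<and> \<not> b \<or> c' = resume j b" for Out' V' d'
    using that by blast
  have main: ?main
    using work
  proof (cases rule: work.cases)
    case (add_load po t u)
    then have j: "j = (po, t, u)" "\<not> b" using job by auto
    have "reorder ?s U Tk ?d (f(w := c')) Out V"
      by (rule unlocked_step) (use add_load j u in \<open>auto simp: not_le split: if_splits\<close>)
    from finI[OF this output_refl] show ?thesis using add_load j by (auto simp: worklist_eq_def)
  next
    case (add_store po t u)
    then have j: "j = (po, t, u)" "\<not> b" using job by auto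
    have "reorder ?s U Tk (opd S' k) (f(w := c')) Out V"
      unfolding add_store(3) by (rule store_step) (use add_store in auto)
    from finI[OF this output_refl] show ?thesis using add_store j by (auto simp: worklist_eq_def)
  next
    case (tas_set j' b')
    then have j: "j' = j" "b' = b" using job by auto
    have "reorder ?s U Tk ?d (f(w := c')) Out V"
    proof (rule unlocked_step)
      show "holds c' = holds (f w)" using tas_set j by (cases b) (auto simp: resume_holds)
      show "u = U t" if "job_of c' = Some ((po, t, u), False)" for po t u
        using that tas_set j u by (auto simp: resume_job split: if_splits)
    qed (use tas_set in auto)
    from finI[OF this output_refl] show ?thesis using tas_set j by (auto simp: worklist_eq_def)
  next
    case (tas_clear j' b')
    then have j: "j' = j" "b' = b" using job by auto
    have "reorder ?s U Tk (opd S' k) (f(w := c')) Out V"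
      unfolding tas_clear(3) by (rule lock_step) (use tas_clear in auto)
    from finI[OF this output_refl] show ?thesis using tas_clear j by (auto simp: worklist_eq_def)
  next
    case (load_next j' b')
    then have j: "j' = j" "b' = b" using job by auto
    have ns: "\<not> sending (f w')" for w' by (rule not_sending[of w]) (use load_next in auto)
    have ni: "\<not> is_IncNext (f w')" for w' using ns is_IncNext_sending by blast
    have "reorder ?s U Tk ?d (f(w := c')) Out V"
      by (rule locked_step) (use load_next j ns ni cell Out_eq V_idle in auto)
    from finI[OF this output_refl] show ?thesis using load_next j by (auto simp: worklist_eq_def)
  next
    case (cell_full i u' j' b')
    then have j: "j' = j" "b' = b" using job by auto
    have ns: "\<not> sending (f w')" for w' by (rule not_sending[of w]) (use cell_full in auto)
    have ni: "\<not> is_IncNext (f w')" for w' using ns is_IncNext_sending by blast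
    have i: "i = nxt ?d mod ?s" using cell_index[of w i] cell_full by simp
    have n: "nxt ?d \<in> Tk" "\<not> held f (nxt ?d)" "u' = U (nxt ?d)"
      using next_cell cell_full i by (auto split: if_splits)
    \<comment> \<open>Reading a full cell is the instant of emission: the whole unit joins
      \<open>Out\<close> although none of its tuples has been delivered.\<close>
    have "reorder ?s U Tk ?d (f(w := c')) (Out @ u') (u', Start)"
      by (rule locked_step) (use cell_full j i n ni cell Out_eq ns nxt_pos in auto)
    from finI[OF this output_emit] show ?thesis using cell_full j V_idle ns by (auto simp: worklist_eq_def)
  next
    case (cell_empty i j' b')
    then have j: "j' = j" "b' = b" using job by auto
    have ns: "\<not> sending (f w')" for w' by (rule not_sending[of w]) (use cell_empty in auto)
    have ni: "\<not> is_IncNext (f w')" for w' using ns is_IncNext_sending by blast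
    have "reorder ?s U Tk ?d (f(w := c')) Out V"
      by (rule locked_step) (use cell_empty j ns ni cell Out_eq V_idle cell_index[of w i] in auto)
    from finI[OF this output_refl] show ?thesis using cell_empty j by (auto simp: worklist_eq_def)
  next
    case (forward dl d' j' b' i)
    then have j: "j' = j" "b' = b" using job by auto
    have ni: "\<not> is_IncNext (f w')" for w'
      using lock_unique[of w w'] sending_locked is_IncNext_sending forward by (cases "w' = w") auto
    have ex: "\<exists>w. sending (f w)" using forward by (intro exI[of _ w]) simp
    have o: "opd S' k = ?d" using deliver_other[OF forward(5)] by simp
    have "reorder ?s U Tk (opd S' k) (f(w := c')) Out d'"
      by (rule locked_step) (use deliver_start[OF forward(5,4)] forward j ex ni cell Out_eq sending_next[of w] cell_index[of w i] o in auto)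
    from finI[OF this output_deliver] show ?thesis using forward j o V_eq[of w] by (auto simp: worklist_eq_def)
  next
    case (forward_done dl j' b' i)
    then have j: "j' = j" "b' = b" using job by auto
    have ni: "\<not> is_IncNext (f w')" for w'
      using lock_unique[of w w'] sending_locked is_IncNext_sending forward_done by (cases "w' = w") auto
    have ex: "\<exists>w. sending (f w)" using forward_done by (intro exI[of _ w]) simp
    have "reorder ?s U Tk ?d (f(w := c')) Out V"
      by (rule locked_step) (use forward_done j ex ni cell Out_eq V_eq[of w] V_start sending_next[of w] cell_index[of w i] in \<open>auto simp: prod_eq_iff\<close>)
    from finI[OF this output_refl] show ?thesis using forward_done j by (auto simp: worklist_eq_def)
  next
    case (empty_cell j' b' i)
    then have j: "j' = j" "b' = b" using job by auto
    have ni: "\<not> is_IncNext (f w')" for w'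
      using lock_unique[of w w'] sending_locked is_IncNext_sending empty_cell by (cases "w' = w") auto
    have ex: "\<exists>w. sending (f w)" using empty_cell by (intro exI[of _ w]) simp
    have i: "i = nxt ?d mod ?s" using cell_index[of w i] empty_cell by simp
    have "reorder ?s U Tk (opd S' k) (f(w := c')) Out V"
    proof (rule locked_step)
      \<comment> \<open>Inside the window only \<open>nxt\<close> maps to the emptied cell, and
        \<open>IncNext\<close> is the state in which that cell may be empty although its number is
        taken and not held.\<close>
      show "buffer (opd S' k) (t mod ?s) =
        (if t \<in> Tk \<and> \<not> held f t \<and> \<not> (t = nxt ?d \<and> is_IncNext c') then Some (U t) else None)"
        if "nxt ?d \<le> t" "t < nxt ?d + ?s" for t
        using cell[OF that] mod_window_inj[OF that, of "nxt ?d"] s_pos i ni empty_cell by auto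
    qed (use empty_cell j ex Out_eq V_eq[of w] V_start sending_next[of w] in auto)
    from finI[OF this output_refl] show ?thesis using empty_cell j by (auto simp: worklist_eq_def)
  next
    case (inc_next j' b')
    then have j: "j' = j" "b' = b" using job by auto
    have "reorder ?s U Tk (opd S' k) (f(w := c')) Out V"
      unfolding inc_next(3) by (rule inc_step) (use inc_next in auto)
    from finI[OF this output_refl] show ?thesis using inc_next j by (auto simp: worklist_eq_def)
  next
    case (clear_flag j' b' i)
    then have j: "j' = j" "b' = b" using job by auto
    have "reorder ?s U Tk (opd S' k) (f(w := c')) Out V"
      unfolding clear_flag(3) by (rule unlock_step) (use clear_flag in auto)
    from finI[OF this output_refl] show ?thesis using clear_flag j by (auto simp: worklist_eq_def)
  next
    case (recheck_full i j' b')
    then have j: "j' = j" "b' = b" using job by auto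
    have "reorder ?s U Tk ?d (f(w := c')) Out V"
      by (rule unlocked_step) (use recheck_full j u in \<open>auto simp: holds_job\<close>)
    from finI[OF this output_refl] show ?thesis using recheck_full j by (auto simp: worklist_eq_def)
  next
    case (recheck_empty i j' b')
    then have j: "j' = j" "b' = b" using job by auto
    have "reorder ?s U Tk ?d (f(w := c')) Out V"
    proof (rule unlocked_step)
      show "holds c' = holds (f w)" using recheck_empty j by (cases b) (auto simp: resume_holds)
      show "u = U t" if "job_of c' = Some ((po, t, u), False)" for po t u
        using that recheck_empty j u by (auto simp: resume_job split: if_splits)
    qed (use recheck_empty in auto)
    from finI[OF this output_refl] show ?thesis using recheck_empty j by (auto simp: worklist_eq_def)
  qed (use job in simp_all)
  from main show "\<exists>Out' V'. reorder ?s U Tk (opd S' k) (f(w := c')) Out' V' \<and>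
    output_step P k S S' (f w) c' (Out, V) (Out', V')"
    and "q' = q" and "worklist_eq (opd S k) (opd S' k)" and "nxt (opd S k) \<le> nxt (opd S' k)"
    and "job_of c' = Some (j, b) \<or> job_of c' = Some (j, True) \<and> \<not> b \<or> c' = resume j b"
    by blast+
qed


section \<open>Invariants for the three kinds of operators\<close>

fun stateful_pc :: "('a, 's) pc \<Rightarrow> bool" where
  "stateful_pc Fetch = True"
| "stateful_pc Return = True"
| "stateful_pc (SRead x) = True"
| "stateful_pc (SWrite x m) = True"
| "stateful_pc (SSend d) = True"
| "stateful_pc _ = False"

fun stateless_pc :: "('a, 's) pc \<Rightarrow> bool" where
  "stateless_pc Fetch = True"
| "stateless_pc Return = True"
| "stateless_pc (Compute t x) = True"
| "stateless_pc c = (case job_of c of Some (j, b) \<Rightarrow> fst j = None | None \<Rightarrow> False)"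

fun partitioned_pc :: "('a, 's) pc \<Rightarrow> bool" where
  "partitioned_pc Fetch = True"
| "partitioned_pc Return = True"
| "partitioned_pc (PEnter p) = True"
| "partitioned_pc (PTake p) = True"
| "partitioned_pc (PRead p t x) = True"
| "partitioned_pc (PWrite p t x m) = True"
| "partitioned_pc (PLeave p) = True"
| "partitioned_pc c = (case job_of c of Some (j, b) \<Rightarrow> fst j \<noteq> None | None \<Rightarrow> False)"

text \<open>\<open>C\<close> is the number of inputs removed from the worklist.\<close>

locale stateful =
  fixes p :: "('a, 'k, 's) operator" and xs :: "'a list" and C :: nat
    and d :: "('a, 'k, 's) opdata" and f :: "nat \<Rightarrow> ('a, 's) pc" and Out :: "'a list" and V :: "'a delivery"
  assumes C_le: "C \<le> length xs"
    and squeue: "squeue d = drop C xs"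
    and pcs: "stateful_pc (f w)"
    and alone: "\<lbrakk>f w \<noteq> Return; f w' \<noteq> Return\<rbrakk> \<Longrightarrow> w = w'"
    and idle: "(\<And>w. f w = Return \<or> f w = Fetch) \<Longrightarrow>
       mem d = final_mem p (take C xs) \<and> Out = outputs p (take C xs) \<and> V = ([], Start)"
    and sread: "f w = SRead x \<Longrightarrow> 0 < C \<and> x = xs ! (C - 1) \<and>
       mem d = final_mem p (take (C - 1) xs) \<and> Out = outputs p (take (C - 1) xs) \<and> V = ([], Start)"
    and swrite: "f w = SWrite x m \<Longrightarrow> 0 < C \<and> x = xs ! (C - 1) \<and> m = mem d None \<and>
       mem d = final_mem p (take (C - 1) xs) \<and> Out = outputs p (take (C - 1) xs) \<and> V = ([], Start)"
    and ssend: "f w = SSend dl \<Longrightarrow>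
       mem d = final_mem p (take C xs) \<and> Out = outputs p (take C xs) \<and> V = dl"
    and V_start: "fst V = [] \<Longrightarrow> snd V = Start"

text \<open>Only one worker can be away from \<open>Return\<close>, so its action determines all
  program counters. State and emitted list agree with the first \<open>C\<close> inputs, or with
  \<open>C - 1\<close> while a tuple has been dequeued and its result is not yet written.\<close>

lemma stateful_work:
  assumes R: "stateful p xs C (opd S k) f Out V" and p: "ops P ! k = p" "p = Stateful s0 h"
    and work: "work P k (q, f w, S) (q', c', S')"
  shows "\<exists>C' Out' V'. stateful p xs C' (opd S' k) (f(w := c')) Out' V' \<and> (C' = C \<or> C' = Suc C \<and> f w = Fetch \<and> q = Suc q') \<and>
    output_step P k S S' (f w) c' (Out, V) (Out', V')"
    and "serial (opd S' k) = serial (opd S k)" and "nxt (opd S' k) = nxt (opd S k)"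
proof -
  interpret stateful p xs C "opd S k" f Out V by (fact R)
  let ?d = "opd S k"
  have others: "f w' = Return" if "f w \<noteq> Return" "w' \<noteq> w" for w'
    using alone[of w w'] that by blast
  have f': "(f(w := c')) w' = (if w' = w then c' else Return)" if "f w \<noteq> Return" for w'
    using others that by simp
  have stI: "stateful p xs C' (opd S' k) (f(w := c')) Out' V'"
    if h: "f w \<noteq> Return" "C' \<le> length xs" "squeue (opd S' k) = drop C' xs" "stateful_pc c'"
      "case c' of SRead x \<Rightarrow> 0 < C' \<and> x = xs ! (C' - 1) \<and>
         mem (opd S' k) = final_mem p (take (C' - 1) xs) \<and> Out' = outputs p (take (C' - 1) xs) \<and> V' = ([], Start)
       | SWrite x m \<Rightarrow> 0 < C' \<and> x = xs ! (C' - 1) \<and> m = mem (opd S' k) None \<and>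
         mem (opd S' k) = final_mem p (take (C' - 1) xs) \<and> Out' = outputs p (take (C' - 1) xs) \<and> V' = ([], Start)
       | _ \<Rightarrow> mem (opd S' k) = final_mem p (take C' xs) \<and> Out' = outputs p (take C' xs) \<and> V' = delivery_of c'"
      "fst V' = [] \<Longrightarrow> snd V' = Start" for C' Out' V'
  proof (unfold_locales, unfold f'[OF h(1)])
    show "mem (opd S' k) = final_mem p (take C' xs) \<and> Out' = outputs p (take C' xs) \<and> V' = ([], Start)"
      if "\<And>w'. (if w' = w then c' else Return) = Return \<or> (if w' = w then c' else Return) = Fetch"
      using that[of w] h by (auto split: pc.splits)
  qed (use h in \<open>auto split: if_splits\<close>)
  have nR: "f w \<noteq> Return" if "f w = c" "c \<noteq> Return" for c
    using that by simp
  have fetch: "mem ?d = final_mem p (take C xs) \<and> Out = outputs p (take C xs) \<and> V = ([], Start)" if "f w = Fetch"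
  proof (rule idle)
    show "f w' = Return \<or> f w' = Fetch" for w'
      using others[of w'] that by (cases "w' = w") auto
  qed
  let ?main = "(\<exists>C' Out' V'. stateful p xs C' (opd S' k) (f(w := c')) Out' V' \<and> (C' = C \<or> C' = Suc C \<and> f w = Fetch \<and> q = Suc q') \<and>
    output_step P k S S' (f w) c' (Out, V) (Out', V')) \<and> serial (opd S' k) = serial ?d \<and> nxt (opd S' k) = nxt ?d"
  have finI: ?main if "stateful p xs C' (opd S' k) (f(w := c')) Out' V'" "C' = C \<or> C' = Suc C \<and> f w = Fetch \<and> q = Suc q'"
     "output_step P k S S' (f w) c' (Out, V) (Out', V')" "serial (opd S' k) = serial ?d" "nxt (opd S' k) = nxt ?d"
     for C' Out' V'
    using that by blast
  have main: ?main
    using work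
  proof (cases rule: work.cases)
    case exhausted
    show ?thesis
      by (rule finI[OF stI[of C] _ output_refl]) (use exhausted fetch C_le squeue V_start in auto)
  next
    case s_none
    show ?thesis
      by (rule finI[OF stI[of C] _ output_refl]) (use s_none fetch C_le squeue V_start in auto)
  next
    case (s_take s0' h' x rest)
    have "C < length xs" "x = xs ! C" "rest = drop (Suc C) xs"
    proof -
      have "drop C xs \<noteq> []" using s_take squeue by auto
      then show C: "C < length xs" by simp
      then have "drop C xs = xs ! C # drop (Suc C) xs" by (rule Cons_nth_drop_Suc[symmetric])
      then show "x = xs ! C" "rest = drop (Suc C) xs" using s_take squeue by auto
    qed
    then show ?thesis
      by (intro finI[OF stI[of "Suc C"] _ output_refl]) (use s_take fetch V_start in auto)
  next
    case (s_read x)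
    show ?thesis
      by (rule finI[OF stI[of C] _ output_refl]) (use s_read sread[of w x] C_le squeue V_start in auto)
  next
    case (s_write s0' h' m x m' ys)
    have w: "0 < C" "x = xs ! (C - 1)" "m = mem ?d None" "mem ?d = final_mem p (take (C - 1) xs)"
      "Out = outputs p (take (C - 1) xs)" "V = ([], Start)"
      using swrite[of w x m] s_write by auto
    have tk: "take C xs = take (C - 1) xs @ [x]"
      using w C_le take_Suc_conv_app_nth[of "C - 1" xs] by simp
    have ap: "apply_op p (mem ?d) x = ((mem ?d)(None := m'), ys)"
      using s_write p w(3) by simp
    have "final_mem p (take C xs) = (mem ?d)(None := m')" "outputs p (take C xs) = Out @ ys"
      by (simp_all only: tk final_mem_snoc outputs_snoc w(4,5)[symmetric] ap fst_conv snd_conv)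
    then show ?thesis
      by (intro finI[OF stI[of C] _ output_emit]) (use s_write w squeue C_le in auto)
  next
    case (s_send dl d')
    have o: "opd S' k = ?d" using deliver_other[OF s_send(5)] by simp
    show ?thesis
      by (rule finI[OF stI[of C] _ output_deliver])
        (use s_send o ssend[of w dl] C_le squeue deliver_start[OF s_send(5,4)] in auto)
  next
    case (s_done dl)
    show ?thesis
      by (rule finI[OF stI[of C] _ output_refl])
        (use s_done ssend[of w dl] C_le squeue V_start in \<open>auto simp: prod_eq_iff\<close>)
  qed (use p pcs[of w] in auto)
  then show "\<exists>C' Out' V'. stateful p xs C' (opd S' k) (f(w := c')) Out' V' \<and> (C' = C \<or> C' = Suc C \<and> f w = Fetch \<and> q = Suc q') \<and>
    output_step P k S S' (f w) c' (Out, V) (Out', V')"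
    and "serial (opd S' k) = serial (opd S k)" and "nxt (opd S' k) = nxt (opd S k)"
    by blast+
qed

text \<open>The only queue is emptied from the front, hence the taken numbers form the interval
  \<open>{1..F}\<close>.\<close>

definition stateless ::
  "nat \<Rightarrow> ('a, 'k, 's) operator \<Rightarrow> 'a list \<Rightarrow> nat \<Rightarrow> ('a, 'k, 's) opdata \<Rightarrow> (nat \<Rightarrow> ('a, 's) pc) \<Rightarrow>
   'a list \<Rightarrow> 'a delivery \<Rightarrow> bool" where
  "stateless s p xs F d f Out V \<longleftrightarrow> F \<le> length xs \<and> queue d = drop F (enum xs) \<and>
     reorder s (unit_of p xs) {1..F} d f Out V \<and> (\<forall>w. stateless_pc (f w)) \<and>
     (\<forall>w t x. f w = Compute t x \<longrightarrow> x = xs ! (t - 1))"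

definition op_inv ::
  "('a, 'k, 's) operator \<Rightarrow> nat \<Rightarrow> nat \<Rightarrow> 'a list \<Rightarrow> 'a list \<Rightarrow> nat \<Rightarrow> ('a, 'k, 's) opdata \<Rightarrow>
   (nat \<Rightarrow> ('a, 's) pc) \<Rightarrow> 'a list \<Rightarrow> 'a delivery \<Rightarrow> bool" where
  "op_inv p N s xs ex F d f Out V = (case p of
     Stateful s0 h \<Rightarrow> stateful p xs F d f Out V
   | Stateless h \<Rightarrow> stateless s p xs F d f Out V
   | Partitioned n key part s0 h \<Rightarrow> (\<exists>mark. partition_inv N n key part s0 h xs ex mark F d f \<and>
       reorder s (unit_of p xs) (taken (\<lambda>x. part (key x)) mark xs) d f Out V) \<and> (\<forall>w. partitioned_pc (f w)))"

abbreviation "op_inv_at P k \<equiv> op_inv (ops P ! k) (cores P) (bufsize P k)"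

definition backlog :: "('a, 'k, 's) operator \<Rightarrow> ('a, 'k, 's) opdata \<Rightarrow> nat" where
  "backlog p d = (case p of Stateful s0 h \<Rightarrow> length (squeue d) | Stateless h \<Rightarrow> length (queue d)
     | Partitioned n key part s0 h \<Rightarrow> length (master d))"

lemma op_inv_backlog:
  assumes "op_inv p N s xs ex F d f Out V"
  shows "F \<le> length xs \<and> backlog p d = length xs - F"
proof (cases p)
  case (Stateful s0 h)
  then interpret stateful p xs F d f Out V using assms by (simp add: op_inv_def)
  show ?thesis using C_le squeue Stateful by (simp add: backlog_def)
next
  case (Stateless h)
  then show ?thesis using assms by (simp add: op_inv_def stateless_def backlog_def)
next
  case (Partitioned n key part s0 h)
  then obtain mark where "partition_inv N n key part s0 h xs ex mark F d f"
    using assms by (auto simp: op_inv_def)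
  then interpret partition_inv N n key part s0 h xs ex mark F d f .
  show ?thesis using F_le master Partitioned by (simp add: backlog_def)
qed

lemma stateless_work:
  assumes I: "stateless (bufsize P k) p xs F (opd S k) f Out V" and p: "ops P ! k = p" "p = Stateless h"
    and work: "work P k (q, f w, S) (q', c', S')"
  shows "(\<exists>F' Out' V'. stateless (bufsize P k) p xs F' (opd S' k) (f(w := c')) Out' V' \<and> (F' = F \<or> F' = Suc F \<and> f w = Fetch \<and> q = Suc q') \<and>
    output_step P k S S' (f w) c' (Out, V) (Out', V')) \<and>
    serial (opd S' k) = serial (opd S k) \<and> nxt (opd S k) \<le> nxt (opd S' k)"
proof -
  let ?d = "opd S k"
  have I': "F \<le> length xs" "queue ?d = drop F (enum xs)"
    "\<And>w. stateless_pc (f w)" "\<And>w t x. f w = Compute t x \<Longrightarrow> x = xs ! (t - 1)"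
    and R: "reorder (bufsize P k) (unit_of p xs) {1..F} ?d f Out V"
    using I by (auto simp: stateless_def)
  interpret reorder "bufsize P k" "unit_of p xs" "{1..F}" ?d f Out V by (fact R)
  show ?thesis
  proof (cases "job_of (f w)")
    case (Some jb)
    then obtain j b where job: "job_of (f w) = Some (j, b)" by (cases jb) auto
    note rw = reorder_work[OF R job work]
    from rw(1) obtain Out' V' where "reorder (bufsize P k) (unit_of p xs) {1..F} (opd S' k) (f(w := c')) Out' V'"
      "output_step P k S S' (f w) c' (Out, V) (Out', V')" by blast
    moreover have "fst j = None" using I'(3)[of w] job by (cases "f w") auto
    then have "stateless_pc c' \<and> (\<forall>t x. c' \<noteq> Compute t x)"
      using rw(5) by (cases j; cases b; cases c') auto
    ultimately have "stateless (bufsize P k) p xs F (opd S' k) (f(w := c')) Out' V'"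
      using I' rw(3) by (auto simp: stateless_def worklist_eq_def)
    then show ?thesis
      using rw(3,4) \<open>output_step P k S S' (f w) c' (Out, V) (Out', V')\<close>
      unfolding worklist_eq_def by blast
  next
    case None
    have plain: ?thesis if "stateless_pc c'" "S' = S" "\<not> locked (f w)" "\<not> locked c'" "holds c' = holds (f w)"
      "\<And>po t u. job_of c' = Some ((po, t, u), False) \<Longrightarrow> u = unit_of p xs t" "\<And>j. c' \<noteq> AddStore j"
      "\<And>t x. c' \<noteq> Compute t x" "\<not> wakes (nxt ?d mod bufsize P k) (f w)"
    proof -
      have "reorder (bufsize P k) (unit_of p xs) {1..F} ?d (f(w := c')) Out V"
        by (rule unlocked_step) (use that in auto)
      then have "stateless (bufsize P k) p xs F (opd S' k) (f(w := c')) Out V"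
        using I' that by (auto simp: stateless_def)
      then show ?thesis using that output_refl[of k S S P] by blast
    qed
    from work show ?thesis
    proof (cases rule: work.cases)
      case (l_take h' t x rest)
      have "drop F (enum xs) \<noteq> []" using l_take I' by auto
      then have F: "F < length xs" by simp
      then have "drop F (enum xs) = (Suc F, xs ! F) # drop (Suc F) (enum xs)"
        using Cons_nth_drop_Suc[of F "enum xs"] by simp
      then have tx: "t = Suc F" "x = xs ! F" "rest = drop (Suc F) (enum xs)"
        using l_take I' by auto
      have "reorder (bufsize P k) (unit_of p xs) (insert t {1..F}) (opd S' k) (f(w := c')) Out V"
        by (rule take_step) (use l_take tx in auto)
      moreover have "insert t {1..F} = {1..Suc F}" using tx by auto
      ultimately have "stateless (bufsize P k) p xs (Suc F) (opd S' k) (f(w := c')) Out V"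
        using F I' l_take tx by (auto simp: stateless_def)
      moreover have "output_step P k S S' (f w) c' (Out, V) (Out, V)"
        by (rule output_refl) (use l_take in auto)
      ultimately show ?thesis using l_take
        by (intro conjI exI[of _ "Suc F"] exI[of _ Out] exI[of _ V]) auto
    next
      case (l_compute h' t x)
      show ?thesis
        by (rule plain) (use l_compute p I'(4)[of w t x] in \<open>auto simp: unit_of_def\<close>)
    next
      case exhausted
      show ?thesis by (rule plain) (use exhausted in auto)
    next
      case l_none
      show ?thesis by (rule plain) (use l_none in auto)
    qed (use p I'(3)[of w] None in auto)
  qed
qed

lemma partitioned_work:
  assumes I: "op_inv p (cores P) (bufsize P k) xs ex F (opd S k) f Out V"
    and p: "ops P ! k = p" "p = Partitioned n key part s0 h" and w: "w < cores P"
    and work: "work P k (q, f w, S) (q', c', S')"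
  shows "(\<exists>F' Out' V'. op_inv p (cores P) (bufsize P k) xs ex F' (opd S' k) (f(w := c')) Out' V' \<and> (F' = F \<or> F' = Suc F \<and> f w = Fetch \<and> q = Suc q') \<and>
    output_step P k S S' (f w) c' (Out, V) (Out', V')) \<and>
    serial (opd S' k) = serial (opd S k) \<and> nxt (opd S k) \<le> nxt (opd S' k)"
proof -
  let ?d = "opd S k" and ?pk = "\<lambda>x. part (key x)"
  obtain mark where Q: "partition_inv (cores P) n key part s0 h xs ex mark F ?d f"
    and R: "reorder (bufsize P k) (unit_of p xs) (taken ?pk mark xs) ?d f Out V"
    and pc: "\<And>w. partitioned_pc (f w)"
    using I p by (auto simp: op_inv_def)
  interpret partition_inv "cores P" n key part s0 h xs ex mark F ?d f by (fact Q)
  interpret reorder "bufsize P k" "unit_of p xs" "taken ?pk mark xs" ?d f Out V by (fact R)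
  have fin: ?thesis if "self xs ex mark' F' (opd S' k) (f(w := c'))"
    "reorder (bufsize P k) (unit_of p xs) (taken ?pk mark' xs) (opd S' k) (f(w := c')) Out' V'"
    "partitioned_pc c'" "F' = F \<or> F' = Suc F \<and> f w = Fetch \<and> q = Suc q'" "output_step P k S S' (f w) c' (Out, V) (Out', V')"
    "serial (opd S' k) = serial ?d" "nxt ?d \<le> nxt (opd S' k)" for mark' F' Out' V'
  proof -
    have "op_inv p (cores P) (bufsize P k) xs ex F' (opd S' k) (f(w := c')) Out' V'"
      unfolding op_inv_def p using that pc by (auto simp: p)
    then show ?thesis using that by blast
  qed
  show ?thesis
  proof (cases "job_of (f w)")
    case (Some jb)
    then obtain j b where job: "job_of (f w) = Some (j, b)" by (cases jb) auto
    note rw = reorder_work[OF R job work]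
    from rw(1) obtain Out' V' where R': "reorder (bufsize P k) (unit_of p xs) (taken ?pk mark xs) (opd S' k) (f(w := c')) Out' V'"
      and o: "output_step P k S S' (f w) c' (Out, V) (Out', V')" by blast
    obtain q t u where j: "j = (Some q, t, u)"
      using pc[of w] job by (cases j; cases "f w") auto
    have sw: "serving (f w) = Some q" "accessing (f w) = None" "\<And>q. f w \<noteq> PTake q" "\<And>q. f w \<noteq> PEnter q"
      using job j by (cases "f w"; simp)+
    have c': "serving c' = Some q \<and> accessing c' = None \<and> (\<forall>q. c' \<noteq> PTake q) \<and> (\<forall>q. c' \<noteq> PEnter q) \<and> partitioned_pc c'"
      using rw(5) j by (cases c'; cases b) auto
    have "self xs ex mark F (opd S' k) (f(w := c'))"
    proof (rule quiet_step)
      show "holds c' = None \<or> holds c' = holds (f w)"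
        using rw(5) job by (auto simp: holds_job resume_holds)
    qed (use w sw c' rw(3) in \<open>auto simp: worklist_eq_def weight_def\<close>)
    then show ?thesis
      by (rule fin[OF _ R' _ _ o]) (use c' rw in \<open>auto simp: worklist_eq_def\<close>)
  next
    case None
    have keep: "reorder (bufsize P k) (unit_of p xs) (taken ?pk mark xs) (opd S' k) (f(w := c')) Out V"
      if "\<not> locked c'" "holds c' = holds (f w)" "nxt (opd S' k) = nxt ?d" "buffer (opd S' k) = buffer ?d"
        "flag (opd S' k) = flag ?d" "\<And>po t u. job_of c' = Some ((po, t, u), False) \<Longrightarrow> u = unit_of p xs t"
        "\<And>j. c' \<noteq> AddStore j"
    proof (rule unlocked_step)
      show "\<not> locked (f w)" "flag ?d \<or> buffer ?d (nxt ?d mod bufsize P k) = None \<or>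
        wakes (nxt ?d mod bufsize P k) c' \<or> \<not> wakes (nxt ?d mod bufsize P k) (f w)"
        using None by (cases "f w"; simp)+
    qed (use that in auto)
    from work show ?thesis
    proof (cases rule: work.cases)
      case exhausted
      show ?thesis
        by (rule fin[OF quiet_step keep _ _ output_refl]) (use exhausted w in \<open>auto simp: weight_def\<close>)
    next
      case p_none
      show ?thesis
        by (rule fin[OF quiet_step keep _ _ output_refl]) (use p_none w in \<open>auto simp: weight_def\<close>)
    next
      case (p_fetch n' key' part' s0' h' q1 ps)
      have "self xs ex mark (Suc F) (opd S' k) (f(w := c'))"
        using fetch_step[OF w, of q1 ps "opd S' k"] p_fetch by simp
      then show ?thesis
        by (rule fin[OF _ keep _ _ output_refl]) (use p_fetch in auto)
    next
      case (p_enter q1)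
      have "self xs ex mark F (opd S' k) (f(w := c'))"
        by (rule enter_step) (use p_enter w in auto)
      then show ?thesis
        by (rule fin[OF _ keep _ _ output_refl]) (use p_enter in \<open>auto split: if_splits\<close>)
    next
      case (p_take q1 t x rest)
      have ts: "self xs ex (mark(q1 := t)) F (opd S' k) (f(w := c'))"
        "0 < t" "t \<notin> taken ?pk mark xs" "taken ?pk (mark(q1 := t)) xs = insert t (taken ?pk mark xs)"
        using partition_inv.take_step[OF Q w, of q1 t x rest "opd S' k"] p_take by auto
      have "reorder (bufsize P k) (unit_of p xs) (taken ?pk (mark(q1 := t)) xs) (opd S' k) (f(w := c')) Out V"
        unfolding ts(4) by (rule reorder.take_step[OF R]) (use p_take ts in auto)
      then show ?thesis
        by (rule fin[OF ts(1) _ _ _ output_refl]) (use p_take in auto)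
    next
      case (p_take_fail q1 t x)
      \<comment> \<open>This case is contradictory: at \<open>PTake\<close> the partition queue is
        nonempty.\<close>
      then show ?thesis
        using next_in_partition[OF take_nonempty[of w q1]] by auto
    next
      case (p_read n' key' part' s0' h' q1 t x)
      have "self xs ex mark F (opd S' k) (f(w := c'))"
        using read_step[OF w, of q1 t x "opd S' k"] p_read p by simp
      then show ?thesis
        by (rule fin[OF _ keep _ _ output_refl]) (use p_read in auto)
    next
      case (p_write n' key' part' s0' h' m x m' ys q1 t)
      have wr: "self xs ex mark F (opd S' k) (f(w := c'))" "ys = unit_of p xs t"
      proof -
        have eqs: "c' = AddLoad (Some q1, t, ys)" "key' = key" "h' = h" "f w = PWrite q1 t x m"
          using p_write p by auto
        have "self xs ex mark F (opd S' k) (f(w := AddLoad (Some q1, t, ys))) \<and>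
            ys = unit_of (Partitioned n key part s0 h) xs t"
          by (rule write_step[OF w eqs(4), of m' ys]) (use p_write eqs in auto)
        then show "self xs ex mark F (opd S' k) (f(w := c'))" "ys = unit_of p xs t"
          unfolding eqs(1) p(2) by blast+
      qed
      show ?thesis
        by (rule fin[OF wr(1) keep _ _ output_refl]) (use p_write wr(2) in auto)
    next
      case (p_leave q1)
      have "self xs ex mark F (opd S' k) (f(w := c'))"
        by (rule leave_step) (use p_leave w in auto)
      then show ?thesis
        by (rule fin[OF _ keep _ _ output_refl]) (use p_leave in \<open>auto split: if_splits\<close>)
    qed (use p pc[of w] None in auto)
  qed
qed

lemma op_work:
  assumes I: "op_inv_at P k xs ex F (opd S k) f Out V"
    and w: "w < cores P" and work: "work P k (q, f w, S) (q', c', S')"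
  shows "(\<exists>F' Out' V'. op_inv_at P k xs ex F' (opd S' k) (f(w := c')) Out' V' \<and> (F' = F \<or> F' = Suc F \<and> f w = Fetch \<and> q = Suc q') \<and>
    output_step P k S S' (f w) c' (Out, V) (Out', V')) \<and>
    serial (opd S' k) = serial (opd S k) \<and> nxt (opd S k) \<le> nxt (opd S' k)"
proof (cases "ops P ! k")
  case (Stateful s0 h)
  then show ?thesis using stateful_work[of "ops P ! k" xs F S k f Out V P s0 h q w q' c' S'] work I by (simp add: op_inv_def)
next
  case (Stateless h)
  then show ?thesis using stateless_work[of P k "ops P ! k" xs F S f Out V h q w q' c' S'] work I by (simp add: op_inv_def)
next
  case (Partitioned n key part s0 h)
  show ?thesis using partitioned_work[OF I refl Partitioned w work] .
qed

section \<open>Receiving tuples from upstream\<close>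

definition extra :: "'a delivery \<Rightarrow> 'a list" where
  "extra V = (if snd V = Enqueued then [hd (fst V)] else [])"

text \<open>For numbered worklists the counter runs one ahead while a numbered tuple is not yet
  counted as received. With a single delivery in progress no other tuple slips in between, so
  numbers agree with positions in \<open>xs\<close>.\<close>

definition input_inv :: "('a, 'k, 's) operator \<Rightarrow> 'a list \<Rightarrow> 'a delivery \<Rightarrow> ('a, 'k, 's) opdata \<Rightarrow> bool" where
  "input_inv p xs V d \<longleftrightarrow> (fst V = [] \<longrightarrow> snd V = Start) \<and>
     (\<forall>t. snd V = Numbered t \<longrightarrow> t = Suc (length xs)) \<and>
     (case p of Stateful s0 h \<Rightarrow> snd V = Start
      | Stateless h \<Rightarrow> snd V \<noteq> Enqueued \<and> serial d = Suc (length xs) + (if snd V = Start then 0 else 1)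
      | Partitioned n key part s0 h \<Rightarrow> serial d = Suc (length xs) + (if snd V = Start then 0 else 1))"

text \<open>A tuple needs at most three actions: drawing a number, entering a partition queue and
  entering masterQueue. Hence the factor 3.\<close>

fun delivery_size :: "'a delivery \<Rightarrow> nat" where
  "delivery_size (xs, st) = 3 * length xs - (case st of Start \<Rightarrow> 0 | Numbered t \<Rightarrow> 1 | Enqueued \<Rightarrow> 2)"

text \<open>Only the last enqueue of a tuple moves it from the delivery to the received list;
  numbering it and entering it into a partition queue do not. So the received list followed by the
  rest of the delivery never changes.\<close>

lemma deliver_step:
  assumes I: "op_inv (ops P ! k) N s xs (extra V) F (opd S k) f Out Vo"
    and J: "input_inv (ops P ! k) xs V (opd S k)" and k: "k < length (ops P)"
    and ne: "fst V \<noteq> []" and dl: "deliver P k V S = (V', S')"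
  shows "\<exists>xs'. op_inv (ops P ! k) N s xs' (extra V') F (opd S' k) f Out Vo \<and>
    input_inv (ops P ! k) xs' V' (opd S' k) \<and> prefix xs xs' \<and> xs' @ fst V' = xs @ fst V \<and>
    outs S' = outs S \<and> nxt (opd S' k) = nxt (opd S k) \<and> delivery_size V' < delivery_size V"
proof -
  obtain x ys st where V: "V = (x # ys, st)" using ne by (cases V) (auto simp: neq_Nil_conv)
  have k': "\<not> length (ops P) \<le> k" using k by simp
  show ?thesis
  proof (cases "ops P ! k")
    case (Stateful s0 h)
    then interpret stateful "ops P ! k" xs F "opd S k" f Out Vo using I by (simp add: op_inv_def)
    have st: "st = Start" using J V Stateful by (simp add: input_inv_def)
    have V': "V' = (ys, Start)" "S' = modify k (\<lambda>d. d\<lparr>squeue := squeue d @ [x]\<rparr>) S"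
      using dl V Stateful k' by auto
    have "stateful (ops P ! k) (xs @ [x]) F (opd S' k) f Out Vo"
    proof (unfold_locales)
      show "mem (opd S' k) = final_mem (ops P ! k) (take F (xs @ [x])) \<and>
         Out = outputs (ops P ! k) (take F (xs @ [x])) \<and> Vo = ([], Start)"
        if "\<And>w. f w = Return \<or> f w = Fetch"
        using idle[OF that] C_le V' by simp
      show "0 < F \<and> y = (xs @ [x]) ! (F - 1) \<and>
         mem (opd S' k) = final_mem (ops P ! k) (take (F - 1) (xs @ [x])) \<and>
         Out = outputs (ops P ! k) (take (F - 1) (xs @ [x])) \<and> Vo = ([], Start)"
        if "f w = SRead y" for w y
        using sread[OF that] C_le V' by (auto simp: nth_append)
      show "0 < F \<and> y = (xs @ [x]) ! (F - 1) \<and> m = mem (opd S' k) None \<and>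
         mem (opd S' k) = final_mem (ops P ! k) (take (F - 1) (xs @ [x])) \<and>
         Out = outputs (ops P ! k) (take (F - 1) (xs @ [x])) \<and> Vo = ([], Start)"
        if "f w = SWrite y m" for w y m
        using swrite[OF that] C_le V' by (auto simp: nth_append)
      show "mem (opd S' k) = final_mem (ops P ! k) (take F (xs @ [x])) \<and>
         Out = outputs (ops P ! k) (take F (xs @ [x])) \<and> Vo = dl" if "f w = SSend dl" for w dl
        using ssend[OF that] C_le V' by simp
    qed (use C_le squeue pcs alone V_start V' in auto)
    then show ?thesis
      using V V' st Stateful
      by (intro exI[of _ "xs @ [x]"]) (auto simp: op_inv_def input_inv_def)
  next
    case (Stateless h)
    have "stateless s (ops P ! k) xs F (opd S k) f Out Vo"
      using I Stateless by (simp add: op_inv_def)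
    note I' = this[unfolded stateless_def]
    have J': "st \<noteq> Enqueued" "serial (opd S k) = Suc (length xs) + (if st = Start then 0 else 1)"
      "\<And>t. st = Numbered t \<Longrightarrow> t = Suc (length xs)"
      using J V Stateless by (auto simp: input_inv_def)
    have R: "reorder s (unit_of (ops P ! k) xs) {1..F} (opd S k) f Out Vo" using I' by simp
    show ?thesis
    proof (cases st)
      case Start
      then have V': "V' = (x # ys, Numbered (serial (opd S k)))" "S' = modify k (\<lambda>d. d\<lparr>serial := serial d + 1\<rparr>) S"
        using dl V Stateless k' by auto
      have "reorder s (unit_of (ops P ! k) xs) {1..F} (opd S' k) f Out Vo"
        by (rule reorder.cong_step[OF R]) (use V' in auto)
      then show ?thesis
        using V V' J'(1,2) Start Stateless I'
        by (intro exI[of _ xs]) (auto simp: op_inv_def input_inv_def stateless_def)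
    next
      case (Numbered t)
      then have V': "V' = (ys, Start)" "S' = modify k (\<lambda>d. d\<lparr>queue := queue d @ [(t, x)]\<rparr>) S"
        using dl V Stateless k' by auto
      have "reorder s (unit_of (ops P ! k) (xs @ [x])) {1..F} (opd S' k) f Out Vo"
        by (rule reorder.cong_step[OF R]) (use V' I' in \<open>auto intro!: unit_of_append\<close>)
      moreover have "y = (xs @ [x]) ! (t - 1)" if "f w = Compute t y" for w t y
      proof -
        have "y = xs ! (t - 1)" "t \<in> {1..F}"
          using I' that reorder.held_Tk[OF R, of w t] by auto
        then show ?thesis using I' by (auto simp: nth_append)
      qed
      ultimately show ?thesis
        using V V' J'(1,2) J'(3)[of t] Numbered Stateless I'
        by (intro exI[of _ "xs @ [x]"]) (auto simp: op_inv_def input_inv_def stateless_def)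
    next
      case Enqueued
      then show ?thesis using J' by simp
    qed
  next
    case (Partitioned n key part s0 h)
    let ?pk = "\<lambda>x. part (key x)"
    obtain mark where Q: "partition_inv N n key part s0 h xs (extra V) mark F (opd S k) f"
      and R: "reorder s (unit_of (ops P ! k) xs) (taken ?pk mark xs) (opd S k) f Out Vo"
      and pc: "\<forall>w. partitioned_pc (f w)"
      using I Partitioned by (auto simp: op_inv_def)
    interpret partition_inv N n key part s0 h xs "extra V" mark F "opd S k" f by (fact Q)
    have J': "serial (opd S k) = Suc (length xs) + (if st = Start then 0 else 1)"
      "\<And>t. st = Numbered t \<Longrightarrow> t = Suc (length xs)"
      using J V Partitioned by (auto simp: input_inv_def)
    have op: "op_inv (ops P ! k) N s xs' ex' F (opd S' k) f Out Vo"
      if "partition_inv N n key part s0 h xs' ex' mark F (opd S' k) f"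
        "reorder s (unit_of (ops P ! k) xs') (taken ?pk mark xs') (opd S' k) f Out Vo" for xs' ex'
      unfolding op_inv_def Partitioned operator.case using that[unfolded Partitioned] pc by blast
    show ?thesis
    proof (cases st)
      case Start
      then have V': "V' = (x # ys, Numbered (serial (opd S k)))" "S' = modify k (\<lambda>d. d\<lparr>serial := serial d + 1\<rparr>) S"
        using dl V Partitioned k' by (auto simp: Let_def)
      have "reorder s (unit_of (ops P ! k) xs) (taken ?pk mark xs) (opd S' k) f Out Vo"
        by (rule reorder.cong_step[OF R]) (use V' in auto)
      moreover have "self xs (extra V') mark F (opd S' k) f"
      proof -
        have "extra V' = extra V" using V V' Start by (simp add: extra_def)
        then show ?thesis
          using data_cong[of "opd S' k"] V' by simp
      qed
      ultimately have "op_inv (ops P ! k) N s xs (extra V') F (opd S' k) f Out Vo"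
        using op by blast
      then show ?thesis
        using V V' J'(1) Start Partitioned
        by (intro exI[of _ xs]) (auto simp: input_inv_def)
    next
      case (Numbered t)
      then have V': "V' = (x # ys, Enqueued)" "t = Suc (length xs)"
         "S' = modify k (\<lambda>d. d\<lparr>parts := (parts d)(?pk x := parts d (?pk x) @ [(t, x)])\<rparr>) S"
        using dl V Partitioned k' J'(2)[of t] Numbered by (auto simp: Let_def)
      have "reorder s (unit_of (ops P ! k) xs) (taken ?pk mark xs) (opd S' k) f Out Vo"
        by (rule reorder.cong_step[OF R]) (use V' in auto)
      moreover have "self xs (extra V') mark F (opd S' k) f"
        using enqueue_step[of "opd S' k" x] V V' Numbered by (simp add: extra_def)
      ultimately have "op_inv (ops P ! k) N s xs (extra V') F (opd S' k) f Out Vo"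
        using op by blast
      then show ?thesis
        using V V' J'(1) Numbered Partitioned
        by (intro exI[of _ xs]) (auto simp: input_inv_def)
    next
      case Enqueued
      then have V': "V' = (ys, Start)" "S' = modify k (\<lambda>d. d\<lparr>master := master d @ [?pk x]\<rparr>) S"
        using dl V Partitioned k' by (auto simp: Let_def)
      have ad: "self (xs @ [x]) [] mark F (opd S' k) f" "taken ?pk mark (xs @ [x]) = taken ?pk mark xs"
        using added_step[of x "opd S' k"] V V' Enqueued by (simp_all add: extra_def)
      have R': "reorder s (unit_of (ops P ! k) (xs @ [x])) (taken ?pk mark (xs @ [x])) (opd S' k) f Out Vo"
        unfolding ad(2) by (rule reorder.cong_step[OF R]) (use V' in \<open>auto intro!: unit_of_append simp: taken_def\<close>)
      have "extra V' = []" using V' by (simp add: extra_def)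
      then have "op_inv (ops P ! k) N s (xs @ [x]) (extra V') F (opd S' k) f Out Vo"
        using op[OF ad(1) R'] by simp
      then show ?thesis
        using V V' J'(1) Enqueued Partitioned
        by (intro exI[of _ "xs @ [x]"]) (auto simp: input_inv_def)
    qed
  qed
qed

section \<open>The invariant of the pipeline\<close>

text \<open>
  \<open>Return\<close> also stands for a worker that is idle or allotted elsewhere, so that returning to the
  scheduler does not change \<open>pcs\<close>.
\<close>

definition pcs :: "('a, 'k, 's) state \<Rightarrow> nat \<Rightarrow> nat \<Rightarrow> ('a, 's) pc" where
  "pcs G k w = (case workers G w of Busy k' q c \<Rightarrow> if k' = k then c else Return | Idle \<Rightarrow> Return)"

lemma input_inv_cong: "serial d' = serial d \<Longrightarrow> input_inv p xs V d' = input_inv p xs V d"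
  by (cases p) (auto simp: input_inv_def)

lemma unit_prefix:
  assumes "reorder s (unit_of p xs) Tk d f Out V" and Tk: "\<And>t. t \<in> Tk \<Longrightarrow> t \<le> length xs"
  shows "prefix Out (outputs p xs)"
    and "m < nxt d \<Longrightarrow> prefix (outputs p (take m xs)) Out"
proof -
  interpret reorder s "unit_of p xs" Tk d f Out V by (fact assms(1))
  \<comment> \<open>The units emitted are those of the first \<open>e - 1\<close> inputs: the
    numbers below \<open>nxt\<close>, and \<open>nxt\<close> itself while it is being sent. All of
    them are taken, which bounds \<open>e - 1\<close> by the length of \<open>xs\<close>.\<close>
  define e where "e = nxt d + (if \<exists>w. sending (f w) then 1 else 0)"
  have "e - 1 \<in> Tk \<or> e = 1"
    using sending_next below[of "nxt d - 1"] nxt_pos by (auto simp: e_def)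
  then have "e - 1 \<le> length xs"
    using Tk by auto
  then have e: "0 < e" "e - 1 \<le> length xs" "nxt d \<le> e"
    using nxt_pos by (auto simp: e_def)
  have Out: "Out = outputs p (take (e - 1) xs)"
  proof -
    have "Suc (e - 1) = e" using e by simp
    then show ?thesis using Out_eq outputs_take[OF e(2), of p] by (simp only: e_def[symmetric])
  qed
  show "prefix Out (outputs p xs)"
    unfolding Out by (rule outputs_mono[OF take_is_prefix])
  show "prefix (outputs p (take m xs)) Out" if "m < nxt d"
  proof -
    have "take m xs = take m (take (e - 1) xs)" using that e by (simp add: min_def)
    then show ?thesis unfolding Out by (metis outputs_mono take_is_prefix)
  qed
qed

lemma op_inv_Out:
  assumes "op_inv p N s xs ex F d f Out V"
  shows "prefix Out (outputs p xs)"
proof (cases p)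
  case (Stateful s0 h)
  then interpret stateful p xs F d f Out V using assms by (simp add: op_inv_def)
  have "\<exists>n. Out = outputs p (take n xs)"
  proof (cases "\<forall>w. f w = Return \<or> f w = Fetch")
    case False
    then obtain w where w: "f w \<noteq> Return" "f w \<noteq> Fetch" by blast
    then show ?thesis
      using pcs[of w] sread[of w] swrite[of w] ssend[of w] by (cases "f w") auto
  qed (use idle in blast)
  then show ?thesis by (metis outputs_mono take_is_prefix)
next
  case (Stateless h)
  then have R: "reorder s (unit_of p xs) {1..F} d f Out V" and "F \<le> length xs"
    using assms by (auto simp: op_inv_def stateless_def)
  from R show ?thesis by (rule unit_prefix(1)) (use \<open>F \<le> length xs\<close> in auto)
next
  case (Partitioned n key part s0 h)
  then obtain mark where "reorder s (unit_of p xs) (taken (\<lambda>x. part (key x)) mark xs) d f Out V"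
    using assms by (auto simp: op_inv_def)
  then show ?thesis by (rule unit_prefix(1)) (simp add: taken_def)
qed

lemma op_inv_allot:
  assumes I: "op_inv p N s xs ex F d f Out V" and w: "w < N" "f w = Return"
    and single: "\<And>s0 h w'. p = Stateful s0 h \<Longrightarrow> f w' = Return"
  shows "op_inv p N s xs ex F d (f(w := Fetch)) Out V"
proof (cases p)
  case (Stateful s0 h)
  then interpret stateful p xs F d f Out V using I by (simp add: op_inv_def)
  have "stateful p xs F d (f(w := Fetch)) Out V"
    using single[OF Stateful]
    by unfold_locales (use C_le squeue idle V_start in \<open>auto split: if_splits\<close>)
  then show ?thesis using Stateful by (simp add: op_inv_def)
next
  case (Stateless h)
  then have S: "stateless s p xs F d f Out V" using I by (simp add: op_inv_def)
  then interpret reorder s "unit_of p xs" "{1..F}" d f Out V by (simp add: stateless_def)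
  have "reorder s (unit_of p xs) {1..F} d (f(w := Fetch)) Out V"
    by (rule unlocked_step) (use w in auto)
  then have "stateless s p xs F d (f(w := Fetch)) Out V"
    using S by (auto simp: stateless_def)
  then show ?thesis using Stateless by (simp add: op_inv_def)
next
  case (Partitioned n key part s0 h)
  then obtain mark where Q: "partition_inv N n key part s0 h xs ex mark F d f"
    and R: "reorder s (unit_of p xs) (taken (\<lambda>x. part (key x)) mark xs) d f Out V"
    and pc: "\<forall>w. partitioned_pc (f w)"
    using I by (auto simp: op_inv_def)
  have "reorder s (unit_of p xs) (taken (\<lambda>x. part (key x)) mark xs) d (f(w := Fetch)) Out V"
    by (rule reorder.unlocked_step[OF R]) (use w in auto)
  moreover have "partition_inv N n key part s0 h xs ex mark F d (f(w := Fetch))"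
    by (rule partition_inv.quiet_step[OF Q]) (use w in \<open>auto simp: weight_def\<close>)
  ultimately show ?thesis using Partitioned pc by (auto simp: op_inv_def)
qed

lemma op_inv_init:
  assumes "0 < s"
  shows "op_inv p N s [] [] 0 (init_opdata p) (\<lambda>_. Return) [] ([], Start)"
proof (cases p)
  case (Stateful s0 h)
  then show ?thesis
    by (simp add: op_inv_def) (unfold_locales, auto simp: init_opdata_def)
next
  case (Stateless h)
  have "reorder s (unit_of p []) {1..0} (init_opdata p) (\<lambda>_. Return) [] ([], Start)"
    by unfold_locales (use assms in \<open>auto simp: init_opdata_def\<close>)
  then show ?thesis using Stateless
    by (auto simp: op_inv_def stateless_def init_opdata_def enum_def)
next
  case (Partitioned n key part s0 h)
  have "partition_inv N n key part s0 h [] [] (\<lambda>_. 0) 0 (init_opdata p) (\<lambda>_. Return)"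
    by unfold_locales (use Partitioned in \<open>auto simp: init_opdata_def enum_def weight_def\<close>)
  moreover have "reorder s (unit_of p []) (taken (\<lambda>x. part (key x)) (\<lambda>_. 0) []) (init_opdata p) (\<lambda>_. Return) [] ([], Start)"
    by unfold_locales (use assms in \<open>auto simp: init_opdata_def taken_def\<close>)
  ultimately show ?thesis using Partitioned by (auto simp: op_inv_def)
qed

text \<open>
  Ghost state: \<open>D k\<close> lists the tuples delivered to operator \<open>k\<close>, \<open>V k\<close> is the delivery to it that is in
  progress, and \<open>F k\<close> counts the inputs that its workers have removed from its worklist. Tuples beyond
  the last operator have left the pipeline.
\<close>

locale invariant =
  fixes P :: "('a, 'k, 's) pipeline" and inp :: "nat \<Rightarrow> 'a option"
    and D :: "nat \<Rightarrow> 'a list" and F :: "nat \<Rightarrow> nat" and V :: "nat \<Rightarrow> 'a delivery"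
    and G :: "('a, 'k, 's) state"
  assumes ops: "k < length (ops P) \<Longrightarrow> op_inv_at P k (D k) (extra (V k)) (F k)
       (opd (shared G) k) (pcs G k) (D (Suc k) @ fst (V (Suc k))) (V (Suc k))"
    and input: "k < length (ops P) \<Longrightarrow> input_inv (ops P ! k) (D k) (V k) (opd (shared G) k)"
    and idle: "cores P \<le> w \<Longrightarrow> workers G w = Idle"
    and busy: "workers G w = Busy k q c \<Longrightarrow> k < length (ops P)"
    and incoming: "V 0 = incoming G"
    and arrived: "D 0 @ fst (V 0) = first (arrived G) inp"
    and outs: "D (length (ops P)) = outs (shared G)"
    and exit: "snd (V (length (ops P))) = Start"

context invariant begin

abbreviation "received k xs' V' S' \<equiv>
  (k < length (ops P) \<longrightarrow> op_inv_at P k xs' (extra V') (F k) (opd S' k) (pcs G k)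
      (D (Suc k) @ fst (V (Suc k))) (V (Suc k)) \<and>
    input_inv (ops P ! k) xs' V' (opd S' k) \<and> shared.outs S' = shared.outs (shared G)) \<and>
  (k = length (ops P) \<longrightarrow> xs' = shared.outs S' \<and> snd V' = Start) \<and>
  prefix (D k) xs' \<and> nxt (opd S' k) = nxt (opd (shared G) k)"

lemma deliver_received:
  assumes k: "k \<le> length (ops P)" and ne: "fst (V k) \<noteq> []"
    and dl: "deliver P k (V k) (shared G) = (V', S')"
  shows "\<exists>xs'. received k xs' V' S' \<and> xs' @ fst V' = D k @ fst (V k) \<and>
    delivery_size V' < delivery_size (V k)"
proof (cases "k < length (ops P)")
  case True
  from deliver_step[OF ops[OF True] input[OF True] True ne dl] True show ?thesis by auto
next
  case False
  then have k: "k = length (ops P)" using k by simp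
  obtain x ys st where V: "V k = (x # ys, st)" using ne by (cases "V k") (auto simp: neq_Nil_conv)
  then have "V' = (ys, Start)" "S' = shared G\<lparr>outs := shared.outs (shared G) @ [x]\<rparr>" "st = Start"
    using dl k exit by auto
  then show ?thesis using V k outs by (intro exI[of _ "D k @ [x]"]) auto
qed

end

text \<open>Besides monotonicity it ties every increase of \<open>F k\<close> to a worker that uses
  up one of its remaining inputs, so finite quotas bound the fetches that can occur without a return
  to the scheduler.\<close>

definition grows ::
  "('a, 'k, 's) pipeline \<Rightarrow> (nat \<Rightarrow> 'a list) \<Rightarrow> (nat \<Rightarrow> nat) \<Rightarrow> ('a, 'k, 's) state \<Rightarrow>
   (nat \<Rightarrow> 'a list) \<Rightarrow> (nat \<Rightarrow> nat) \<Rightarrow> ('a, 'k, 's) state \<Rightarrow> bool" where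
  "grows P D F G D' F' G' \<longleftrightarrow> (\<forall>k. prefix (D k) (D' k) \<and> F k \<le> F' k \<and>
     (F' k = F k \<or> (\<exists>w q c. workers G w = Busy k (Suc q) Fetch \<and> workers G' w = Busy k q c)) \<and>
     nxt (opd (shared G) k) \<le> nxt (opd (shared G') k))"

lemma invariant_step:
  assumes I: "invariant P inp D F V G" and step: "step P inp a G G'"
  shows "\<exists>D' F' V'. invariant P inp D' F' V' G' \<and> grows P D F G D' F' G'"
proof -
  interpret invariant P inp D F V G by (fact I)
  from step show ?thesis
  proof cases
    case (allot w k q)
    have k: "k < length (ops P)" using allot by (simp add: schedulable_def)
    have p: "pcs G' j = (if j = k then (pcs G k)(w := Fetch) else pcs G j)" for j
      using allot by (auto simp: pcs_def fun_eq_iff)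
    have sg: "shared G' = shared G" using allot by simp
    have "op_inv_at P k (D k) (extra (V k)) (F k)
       (opd (shared G) k) ((pcs G k)(w := Fetch)) (D (Suc k) @ fst (V (Suc k))) (V (Suc k))"
    proof (rule op_inv_allot[OF ops[OF k]])
      show "pcs G k w = Return" using allot by (simp add: pcs_def)
      show "pcs G k w' = Return" if "ops P ! k = Stateful s0 h" for s0 h w'
      proof -
        \<comment> \<open>The bound 1 for a stateful operator means that no worker at all is
          allotted to it at this moment.\<close>
        have "card {w. w < cores P \<and> (\<exists>q c. workers G w = Busy k q c)} = 0"
          using allot that by (simp add: schedulable_def allotted_def)
        then have "{w. w < cores P \<and> (\<exists>q c. workers G w = Busy k q c)} = {}"
          by (subst (asm) card_0_eq) auto
        then show ?thesis using idle[of w'] by (cases "w' < cores P") (auto simp: pcs_def split: worker.splits)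
      qed
    qed (use allot in simp)
    then have "invariant P inp D F V G'"
      by unfold_locales (use p sg ops input idle busy incoming arrived outs exit allot k in \<open>auto split: if_splits\<close>)
    then show ?thesis using sg by (auto simp: grows_def)
  next
    case no_work
    then show ?thesis using I by (auto simp: grows_def)
  next
    case (return w k q)
    have p: "pcs G' j = pcs G j" for j
      using return by (auto simp: pcs_def fun_eq_iff)
    have sg: "shared G' = shared G" using return by simp
    have "invariant P inp D F V G'"
      by unfold_locales (use p sg ops input idle busy incoming arrived outs exit return in \<open>auto split: if_splits\<close>)
    then show ?thesis using sg by (auto simp: grows_def)
  next
    case (arrive x)
    \<comment> \<open>An input arrives only after the previous delivery has ended, so the delivery
      replaced below is empty.\<close>
    have V0: "V 0 = ([], Start)" if "0 < length (ops P)"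
      using input[OF that] arrive incoming by (auto simp: input_inv_def prod_eq_iff)
    have sg: "shared G' = shared G" "workers G' = workers G" using arrive by simp_all
    have p: "pcs G' j = pcs G j" for j
      using sg by (auto simp: pcs_def fun_eq_iff)
    define V' where "V' = V(0 := ([x], Start))"
    have V': "V' (Suc j) = V (Suc j)" "V' 0 = ([x], Start)" for j by (simp_all add: V'_def)
    have ex: "extra (V' j) = extra (V j)" if "j < length (ops P)" for j
      using V0 that V' by (cases j) (auto simp: extra_def)
    have "invariant P inp D F V' G'"
    proof (unfold_locales, unfold sg p)
      show "op_inv_at P k (D k) (extra (V' k)) (F k)
         (opd (shared G) k) (pcs G k) (D (Suc k) @ fst (V' (Suc k))) (V' (Suc k))" if "k < length (ops P)" for k
        using ops[OF that] ex[OF that] V' by simp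
      show "input_inv (ops P ! k) (D k) (V' k) (opd (shared G) k)" if "k < length (ops P)" for k
        using input[OF that] V0 V' that
        by (cases k) (auto simp: input_inv_def split: operator.splits)
      show "V' 0 = state.incoming G'" using arrive V' by simp
      show "D 0 @ fst (V' 0) = first (state.arrived G') inp"
        using arrived arrive V' incoming by (simp add: first_Suc)
      show "snd (V' (length (ops P))) = Start" using exit V' by (cases "length (ops P)") auto
    qed (fact idle busy outs)+
    then show ?thesis using sg by (auto simp: grows_def)
  next
    case (feed V1 S')
    have d0: "deliver P 0 (V 0) (shared G) = (V1, S')" "fst (V 0) \<noteq> []"
      using feed incoming by simp_all
    obtain xs' where x1: "received 0 xs' V1 S'" and x3: "xs' @ fst V1 = D 0 @ fst (V 0)"
      using deliver_received[OF _ d0(2,1)] by blast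
    have o: "opd S' (Suc i) = opd (shared G) (Suc i)" for i
      using deliver_other[of P 0] feed by simp
    have sg: "shared G' = S'" "workers G' = workers G" using feed by simp_all
    have p: "pcs G' j = pcs G j" for j
      using sg by (auto simp: pcs_def fun_eq_iff)
    define V' where "V' = V(0 := V1)"
    define D' where "D' = D(0 := xs')"
    have V': "V' (Suc j) = V (Suc j)" "V' 0 = V1" "D' (Suc j) = D (Suc j)" "D' 0 = xs'" for j
      by (simp_all add: V'_def D'_def)
    have "invariant P inp D' F V' G'"
    proof (unfold_locales, unfold sg p)
      show "op_inv_at P k (D' k) (extra (V' k)) (F k)
         (opd S' k) (pcs G k) (D' (Suc k) @ fst (V' (Suc k))) (V' (Suc k))" if "k < length (ops P)" for k
        using ops[OF that] x1 that V' o by (cases k) auto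
      show "input_inv (ops P ! k) (D' k) (V' k) (opd S' k)" if "k < length (ops P)" for k
        using input[OF that] x1 that V' o by (cases k) auto
      show "V' 0 = state.incoming G'" using feed V' by simp
      show "D' 0 @ fst (V' 0) = first (state.arrived G') inp"
        using arrived feed V' x3 by simp
      show "snd (V' (length (ops P))) = Start" using exit V' x1 by (cases "length (ops P)") auto
      show "D' (length (ops P)) = shared.outs S'" using outs V' x1 by (cases "length (ops P)") auto
    qed (fact idle busy)+
    moreover have "grows P D F G D' F G'"
      unfolding grows_def sg using x1 o V' by (metis eq_refl nat.exhaust prefix_order.refl)
    ultimately show ?thesis by blast
  next
    case no_input
    then show ?thesis using I by (auto simp: grows_def)
  next
    case (act w k q c q' c' S')
    have k: "k < length (ops P)" using act busy by blast
    have fw: "pcs G k w = c" using act by (simp add: pcs_def)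
    have p: "pcs G' j = (if j = k then (pcs G k)(w := c') else pcs G j)" for j
      using act by (auto simp: pcs_def fun_eq_iff)
    have sg: "shared G' = S'" "state.incoming G' = state.incoming G" "state.arrived G' = state.arrived G"
      using act by simp_all
    let ?S = "shared G" and ?K = "length (ops P)"
    have "work P k (q, pcs G k w, ?S) (q', c', S')" using act fw by simp
    from op_work[OF ops[OF k] act(3) this] obtain F1 Out1 V1 where
      w1: "op_inv_at P k (D k) (extra (V k)) F1 (opd S' k) ((pcs G k)(w := c')) Out1 V1"
        "F1 = F k \<or> F1 = Suc (F k) \<and> pcs G k w = Fetch \<and> q = Suc q'" "output_step P k ?S S' (pcs G k w) c' (D (Suc k) @ fst (V (Suc k)), V (Suc k)) (Out1, V1)"
      and w2: "serial (opd S' k) = serial (opd ?S k)" "nxt (opd ?S k) \<le> nxt (opd S' k)"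
      by blast
    \<comment> \<open>An action of operator \<open>k\<close> affects at most \<open>k\<close> and
      its successor. Either it is an action of the delivery downstream, or the received list stays
      and at most a fresh delivery is opened; for the last operator the receiver is the pipeline
      output.\<close>
    have "\<exists>xs'. (\<forall>i. i \<noteq> k \<and> i \<noteq> Suc k \<longrightarrow> opd S' i = opd ?S i) \<and> received (Suc k) xs' V1 S' \<and> xs' @ fst V1 = Out1"
    proof (cases "fst (V (Suc k)) \<noteq> [] \<and> deliver P (Suc k) (V (Suc k)) ?S = (V1, S') \<and> Out1 = D (Suc k) @ fst (V (Suc k))")
      case True
      then obtain xs' where "received (Suc k) xs' V1 S'" "xs' @ fst V1 = D (Suc k) @ fst (V (Suc k))"
        using deliver_received[of "Suc k" V1 S'] k by auto
      moreover have "opd S' i = opd ?S i" if "i \<noteq> Suc k" for i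
        using deliver_other[of P "Suc k"] that True by blast
      ultimately show ?thesis using True by (intro exI[of _ xs']) auto
    next
      case False
      then have o: "\<And>i. i \<noteq> k \<Longrightarrow> opd S' i = opd ?S i" "shared.outs S' = shared.outs ?S"
        and V1: "Out1 = D (Suc k) @ fst (V (Suc k)) \<and> V1 = V (Suc k) \<or>
          V (Suc k) = ([], Start) \<and> (\<exists>u. V1 = (u, Start) \<and> Out1 = (D (Suc k) @ fst (V (Suc k))) @ u)"
        using w1(3) unfolding output_step_def by auto
      have ex: "extra V1 = extra (V (Suc k))" using V1 by (auto simp: extra_def)
      have "input_inv (ops P ! Suc k) (D (Suc k)) V1 (opd S' (Suc k))" if "Suc k < ?K"
        using V1 input[OF that] o by (auto simp: input_inv_def split: operator.splits)
      moreover have "snd V1 = Start" if "Suc k = ?K"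
        using V1 exit that by auto
      moreover have "D (Suc k) @ fst V1 = Out1" using V1 by auto
      ultimately show ?thesis
        using ops[of "Suc k"] o ex outs by (intro exI[of _ "D (Suc k)"]) auto
    qed
    then obtain xs' where o: "\<And>i. i \<noteq> k \<Longrightarrow> i \<noteq> Suc k \<Longrightarrow> opd S' i = opd ?S i"
      and x1: "received (Suc k) xs' V1 S'" and x3: "xs' @ fst V1 = Out1"
      by blast
    define V' where "V' = V(Suc k := V1)"
    define D' where "D' = D(Suc k := xs')"
    define F' where "F' = F(k := F1)"
    have new: "V' i = (if i = Suc k then V1 else V i)" "D' i = (if i = Suc k then xs' else D i)"
      "F' i = (if i = k then F1 else F i)" for i
      by (simp_all add: V'_def D'_def F'_def)
    have Inv: "invariant P inp D' F' V' G'"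
    proof (unfold_locales, unfold sg p)
      show "op_inv_at P i (D' i) (extra (V' i)) (F' i) (opd S' i)
        (if i = k then (pcs G k)(w := c') else pcs G i) (D' (Suc i) @ fst (V' (Suc i))) (V' (Suc i))"
        if i: "i < ?K" for i
      proof (cases "i = k")
        case True
        then show ?thesis using w1(1) x3 by (simp add: new)
      next
        case False
        then show ?thesis
          using x1 i o[of i] ops[OF i] by (cases "i = Suc k") (simp_all add: new)
      qed
      show "input_inv (ops P ! i) (D' i) (V' i) (opd S' i)" if i: "i < ?K" for i
      proof (cases "i = k")
        case True
        then show ?thesis using input[OF i] w2 input_inv_cong[OF w2(1)] by (simp add: new)
      next
        case False
        then show ?thesis
          using x1 i o[of i] input[OF i] by (cases "i = Suc k") (simp_all add: new)
      qed
      show "V' 0 = state.incoming G" "D' 0 @ fst (V' 0) = first (state.arrived G) inp"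
        using incoming arrived by (simp_all add: new)
      have "shared.outs S' = shared.outs ?S" if "Suc k \<noteq> ?K" using that x1 k by simp
      then show "D' ?K = shared.outs S'" using x1 outs by (auto simp: new)
      show "snd (V' ?K) = Start" using x1 exit by (auto simp: new)
      show "workers G' w' = Idle" if "cores P \<le> w'" for w'
        using idle[OF that] act that by auto
      show "i < ?K" if "workers G' w' = Busy i q'' c''" for w' i q'' c''
        using that busy act k by (auto split: if_splits)
    qed
    have "nxt (opd ?S i) \<le> nxt (opd S' i)" for i
      using w2 x1 o[of i] by (cases "i = k"; cases "i = Suc k") auto
    moreover have "F' i = F i \<or> (\<exists>w q c. workers G w = Busy i (Suc q) Fetch \<and> workers G' w = Busy i q c)" for i
    proof (cases "F1 = F k")
      case True
      then show ?thesis by (simp add: new)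
    next
      case False
      then have "workers G w = Busy k (Suc q') Fetch" using w1(2) fw act by simp
      moreover have "workers G' w = Busy k q' c'" using act by simp
      ultimately show ?thesis by (auto simp: new)
    qed
    ultimately have "grows P D F G D' F' G'"
      unfolding grows_def sg using x1 w1(2) by (auto simp: new)
    then show ?thesis using Inv by blast
  qed
qed

lemma invariant_init:
  assumes "valid_pipeline P"
  shows "invariant P inp (\<lambda>_. []) (\<lambda>_. 0) (\<lambda>_. ([], Start)) (init_state P)"
proof -
  have p: "pcs (init_state P) k = (\<lambda>_. Return)" for k
    by (auto simp: pcs_def init_state_def)
  show ?thesis
  proof (unfold_locales, unfold p)
    show "op_inv_at P k [] (extra ([], Start)) 0 (opd (shared (init_state P)) k)
        (\<lambda>_. Return) ([] @ fst ([], Start)) ([], Start)" if "k < length (ops P)" for k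
      using op_inv_init[of "bufsize P k" "ops P ! k" "cores P"] assms that
      by (simp add: valid_pipeline_def init_state_def init_shared_def extra_def)
    show "input_inv (ops P ! k) [] ([], Start) (opd (shared (init_state P)) k)" for k
      by (simp add: input_inv_def init_state_def init_shared_def init_opdata_def split: operator.splits)
  qed (auto simp: init_state_def init_shared_def first_def List.map_filter_def)
qed

text \<open>Each operator emits a prefix of its sequential output on what it has received, and
  monotonicity of sequential operators carries this along the chain.\<close>

lemma (in invariant) D_prefix: "k \<le> length (ops P) \<Longrightarrow> prefix (D k) (stage_outputs P k (first (state.arrived G) inp))"
proof (induction k)
  case 0
  then show ?case using arrived by (metis prefixI stage_outputs.simps(1))
next
  case (Suc k)
  then have k: "k < length (ops P)" by simp
  have "prefix (D (Suc k)) (D (Suc k) @ fst (V (Suc k)))" by simp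
  also have "prefix \<dots> (outputs (ops P ! k) (D k))" using op_inv_Out[OF ops[OF k]] .
  also have "prefix \<dots> (stage_outputs P (Suc k) (first (state.arrived G) inp))"
    using Suc k by (auto intro: outputs_mono)
  finally show ?case .
qed

lemma (in invariant) outs_prefix:
  "prefix (shared.outs (shared G)) (sequential_outputs P (first (state.arrived G) inp))"
  using D_prefix[of "length (ops P)"] outs by (simp add: sequential_outputs_eq)

text \<open>Ghost components are provided existentially and one step at a time; dependent choice
  assembles them into histories along the execution.\<close>

lemma invariant_execution:
  assumes "valid_pipeline P" "execution P inp \<sigma> a"
  shows "\<exists>D F V. (\<forall>i. invariant P inp (D i) (F i) (V i) (\<sigma> i)) \<and>
    (\<forall>i. grows P (D i) (F i) (\<sigma> i) (D (Suc i)) (F (Suc i)) (\<sigma> (Suc i)))"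
proof -
  have "\<exists>g. \<forall>i. (case g i of (D, F, V) \<Rightarrow> invariant P inp D F V (\<sigma> i)) \<and>
     (case (g i, g (Suc i)) of ((D, F, V), (D', F', V')) \<Rightarrow> grows P D F (\<sigma> i) D' F' (\<sigma> (Suc i)))"
  proof (rule dependent_nat_choice)
    show "\<exists>g. case g of (D, F, V) \<Rightarrow> invariant P inp D F V (\<sigma> 0)"
      using invariant_init[OF assms(1)] assms(2) by (auto simp: execution_def)
    show "\<exists>g'. (case g' of (D, F, V) \<Rightarrow> invariant P inp D F V (\<sigma> (Suc i))) \<and>
       (case (g, g') of ((D, F, V), (D', F', V')) \<Rightarrow> grows P D F (\<sigma> i) D' F' (\<sigma> (Suc i)))"
      if "case g of (D, F, V) \<Rightarrow> invariant P inp D F V (\<sigma> i)" for g i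
    proof -
      obtain D F V where g: "g = (D, F, V)" by (cases g) auto
      have "step P inp (a i) (\<sigma> i) (\<sigma> (Suc i))" using assms(2) by (simp add: execution_def)
      then show ?thesis using invariant_step that g by fastforce
    qed
  qed
  then obtain g where g: "\<forall>i. (case g i of (D, F, V) \<Rightarrow> invariant P inp D F V (\<sigma> i)) \<and>
     (case (g i, g (Suc i)) of ((D, F, V), (D', F', V')) \<Rightarrow> grows P D F (\<sigma> i) D' F' (\<sigma> (Suc i)))"
    by (elim exE)
  show ?thesis
    by (intro exI[of _ "\<lambda>i. fst (g i)"] exI[of _ "\<lambda>i. fst (snd (g i))"] exI[of _ "\<lambda>i. snd (snd (g i))"])
      (use g in \<open>auto simp: split_beta\<close>)
qed

section \<open>Progress\<close>

lemma pcs_Busy: "workers G w = Busy k q c \<Longrightarrow> pcs G k w = c"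
  by (simp add: pcs_def)

lemma pcs_not_Return: "pcs G k w \<noteq> Return \<Longrightarrow> \<exists>q. workers G w = Busy k q (pcs G k w)"
  by (auto simp: pcs_def split: worker.splits if_splits)

locale run =
  fixes P :: "('a, 'k, 's) pipeline" and inp :: "nat \<Rightarrow> 'a option"
    and \<sigma> :: "nat \<Rightarrow> ('a, 'k, 's) state" and a :: "nat \<Rightarrow> agent"
    and D :: "nat \<Rightarrow> nat \<Rightarrow> 'a list" and F :: "nat \<Rightarrow> nat \<Rightarrow> nat" and V :: "nat \<Rightarrow> nat \<Rightarrow> 'a delivery"
  assumes valid: "valid_pipeline P"
    and inv: "invariant P inp (D i) (F i) (V i) (\<sigma> i)"
    and grow: "grows P (D i) (F i) (\<sigma> i) (D (Suc i)) (F (Suc i)) (\<sigma> (Suc i))"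
    and step: "step P inp (a i) (\<sigma> i) (\<sigma> (Suc i))"
    and inputs: "valid_seq inp"
    and source: "\<exists>\<^sub>\<infinity>i. a i = Source"
    and worker: "w < cores P \<Longrightarrow> \<exists>\<^sub>\<infinity>i. a i = Worker w"
    and starve: "(\<forall>n. inp n \<noteq> None) \<Longrightarrow> no_starvation P \<sigma> a"
begin

abbreviation "dat i k \<equiv> opd (shared (\<sigma> i)) k"
abbreviation "pc_at i \<equiv> pcs (\<sigma> i)"
abbreviation "worker_at i \<equiv> workers (\<sigma> i)"
abbreviation "acts k i q c q' c' \<equiv> work P k (q, c, shared (\<sigma> i)) (q', c', shared (\<sigma> (Suc i)))"
abbreviation "ordering_at i k Tk \<equiv> reorder (bufsize P k) (unit_of (ops P ! k) (D i k)) Tk (dat i k) (pc_at i k)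
  (D i (Suc k) @ fst (V i (Suc k))) (V i (Suc k))"
abbreviation "partitioning i k n key part s0 h mark \<equiv>
  partition_inv (cores P) n key part s0 h (D i k) (extra (V i k)) mark (F i k) (dat i k) (pc_at i k)"
abbreviation "K \<equiv> length (ops P)"

lemma D_mono: "i \<le> j \<Longrightarrow> prefix (D i k) (D j k)"
  by (induction j rule: dec_induct) (use grow in \<open>auto simp: grows_def intro: prefix_order.trans\<close>)

lemma F_mono: "i \<le> j \<Longrightarrow> F i k \<le> F j k"
  by (rule lift_Suc_mono_le[of "\<lambda>i. F i k"]) (use grow in \<open>auto simp: grows_def\<close>)

lemma nxt_mono: "i \<le> j \<Longrightarrow> nxt (dat i k) \<le> nxt (dat j k)"
  by (rule lift_Suc_mono_le[of "\<lambda>i. nxt (dat i k)"]) (use grow in \<open>auto simp: grows_def\<close>)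

lemma F_le: "k < K \<Longrightarrow> F i k \<le> length (D i k)"
  and backlog: "k < K \<Longrightarrow> backlog (ops P ! k) (dat i k) = length (D i k) - F i k"
  using op_inv_backlog[OF invariant.ops[OF inv]] by blast+

lemma other_agent: "a i \<noteq> Worker w \<Longrightarrow> worker_at (Suc i) w = worker_at i w"
  using step[of i] by cases auto

lemma other_agents:
  assumes "i \<le> j" "\<And>m. \<lbrakk>i \<le> m; m < j\<rbrakk> \<Longrightarrow> a m \<noteq> Worker w"
  shows "worker_at j w = worker_at i w"
  using assms by (induction j rule: dec_induct) (auto simp: other_agent)

text \<open>Only a worker's own actions change its entry in \<open>workers\<close>, so its next turn
  finds it exactly as it is now.\<close>

lemma next_action:
  assumes "w < cores P"
  shows "\<exists>j\<ge>i. a j = Worker w \<and> worker_at j w = worker_at i w"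
proof -
  let ?j = "LEAST j. i \<le> j \<and> a j = Worker w"
  have "\<exists>j. i \<le> j \<and> a j = Worker w"
    using worker[OF assms] by (auto simp: INFM_nat_le)
  then have j: "i \<le> ?j \<and> a ?j = Worker w" by (rule LeastI_ex)
  have "workers (\<sigma> ?j) w = worker_at i w"
    by (rule other_agents) (use j not_less_Least in blast)+
  then show ?thesis using j by blast
qed

lemma Busy_less: "worker_at i w = Busy k q c \<Longrightarrow> w < cores P \<and> k < K"
  using invariant.idle[OF inv] invariant.busy[OF inv] by (metis not_le worker.distinct(1))

lemma work_action:
  assumes "a j = Worker w" "worker_at j w = Busy k q c" "c \<noteq> Return"
  shows "\<exists>q' c'. acts k j q c q' c' \<and>
    worker_at (Suc j) w = Busy k q' c'"
  using step[of j] by cases (use assms in auto)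

lemma next_work:
  assumes "worker_at i w = Busy k q c" "c \<noteq> Return"
  shows "\<exists>j\<ge>i. a j = Worker w \<and> worker_at j w = Busy k q c \<and>
    (\<exists>q' c'. acts k j q c q' c' \<and> worker_at (Suc j) w = Busy k q' c')"
  using next_action[of w i] work_action assms Busy_less by metis

lemma next_pc:
  assumes "pc_at i k w = c" "c \<noteq> Return"
  shows "\<exists>j\<ge>i. pc_at j k w = c \<and>
    (\<exists>q q' c'. acts k j q c q' c' \<and> pc_at (Suc j) k w = c')"
proof -
  obtain q where "worker_at i w = Busy k q c"
    using pcs_not_Return[of "\<sigma> i" k w] assms by blast
  from next_work[OF this assms(2)] show ?thesis
    using pcs_Busy by blast
qed

text \<open>A worker away from \<open>Return\<close> eventually acts, with its program counter
  unchanged until then. If every action from \<open>A\<close> is contradictory from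
  \<open>i0\<close> on, then \<open>A\<close> is not even entered.\<close>

lemma never:
  assumes "\<And>j q c q' c'. \<lbrakk>i0 \<le> j; A c; c \<noteq> Return; pc_at j k w = c;
      acts k j q c q' c'; pc_at (Suc j) k w = c'\<rbrakk> \<Longrightarrow> False"
    and "\<not> A Return" "i0 \<le> i"
  shows "\<not> A (pc_at i k w)"
proof
  assume A: "A (pc_at i k w)"
  then have "pc_at i k w \<noteq> Return" using assms(2) by metis
  from next_pc[OF refl this] obtain j q q' c' where "j \<ge> i" "pc_at j k w = pc_at i k w"
    "acts k j q (pc_at i k w) q' c'" "pc_at (Suc j) k w = c'"
    by blast
  then show False using assms(1)[of j "pc_at i k w" q q' c'] A assms(3) \<open>pc_at i k w \<noteq> Return\<close> by simp
qed

text \<open>Backward propagation: what leads in one action to an excluded program counter is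
  excluded as well.\<close>

lemma never_before:
  assumes "\<And>m. i0 \<le> m \<Longrightarrow> \<not> B (pc_at m k w)"
    and "\<And>m q c q' c'. \<lbrakk>i0 \<le> m; A c; pc_at m k w = c; acts k m q c q' c'\<rbrakk> \<Longrightarrow> B c'"
    and "\<not> A Return" "i0 \<le> i"
  shows "\<not> A (pc_at i k w)"
proof (rule never[where A = A, OF _ assms(3,4)])
  fix m q c q' c'
  assume "i0 \<le> m" "A c" "pc_at m k w = c" "acts k m q c q' c'" "pc_at (Suc m) k w = c'"
  then show False using assms(1)[of "Suc m"] assms(2) by auto
qed

lemma next_pc_leads:
  assumes "pc_at i k w = c" "c \<noteq> Return"
    and "\<And>m q q' c'. \<lbrakk>i \<le> m; pc_at m k w = c; acts k m q c q' c'; pc_at (Suc m) k w = c'\<rbrakk> \<Longrightarrow>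
      \<exists>j\<ge>Suc m. Q j"
  shows "\<exists>j\<ge>i. Q j"
proof -
  obtain m q q' c' where "i \<le> m" "pc_at m k w = c" "acts k m q c q' c'" "pc_at (Suc m) k w = c'"
    using next_pc[OF assms(1,2)] by blast
  with assms(3)[OF this] show ?thesis by (meson Suc_leD le_trans)
qed

lemma delivery_decreases:
  assumes "k \<le> K" "fst (V i k) \<noteq> []" "deliver P k (V i k) (shared (\<sigma> i)) = (V', S')"
  shows "delivery_size V' < delivery_size (V i k)"
  using invariant.deliver_received[OF inv assms] by blast

definition stateful_op :: "nat \<Rightarrow> bool" where
  "stateful_op k \<longleftrightarrow> (\<exists>s0 h. ops P ! k = Stateful s0 h)"

lemma stateful_at:
  assumes "k < K" "stateful_op k"
  shows "stateful (ops P ! k) (D i k) (F i k) (dat i k) (pc_at i k) (D i (Suc k) @ fst (V i (Suc k))) (V i (Suc k))"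
  using invariant.ops[OF inv assms(1), of i] assms(2) by (auto simp: op_inv_def stateful_op_def)

lemma reorder_at:
  assumes "k < K" "\<not> stateful_op k"
  shows "\<exists>Tk. ordering_at i k Tk \<and> Tk \<subseteq> {1..F i k} \<and>
    ((\<exists>h. ops P ! k = Stateless h) \<and> Tk = {1..F i k} \<or>
     (\<exists>n key part s0 h mark. ops P ! k = Partitioned n key part s0 h \<and>
        partitioning i k n key part s0 h mark \<and>
        Tk = taken (\<lambda>x. part (key x)) mark (D i k)))"
proof (cases "ops P ! k")
  case (Stateful s0 h)
  then show ?thesis using assms by (simp add: stateful_op_def)
next
  case (Stateless h)
  then show ?thesis
    using invariant.ops[OF inv assms(1), of i] by (auto simp: op_inv_def stateless_def)
next
  case (Partitioned n key part s0 h)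
  then obtain mark where mark: "partitioning i k n key part s0 h mark"
    "ordering_at i k (taken (\<lambda>x. part (key x)) mark (D i k))"
    using invariant.ops[OF inv assms(1), of i] by (auto simp: op_inv_def)
  have "taken (\<lambda>x. part (key x)) mark (D i k) \<subseteq> {1..F i k}"
  proof
    fix t assume "t \<in> taken (\<lambda>x. part (key x)) mark (D i k)"
    then have "0 < t" "t \<le> mark (part (key (D i k ! (t - 1))))" by (auto simp: taken_def)
    then show "t \<in> {1..F i k}"
      using partition_inv.mark_le[OF mark(1), of "part (key (D i k ! (t - 1)))"] by simp
  qed
  then show ?thesis using mark Partitioned by blast
qed

text \<open>Every delivery action decreases \<open>delivery_size\<close>, and by \<open>V_eq\<close>
  the delivery of the invariant is the one the worker carries.\<close>

lemma forward_ends: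
  assumes "k < K" "\<not> stateful_op k" "pc_at i k w = Forward j b n d"
  shows "\<exists>i'\<ge>i. pc_at i' k w = EmptyCell j b n"
  using assms(3)
proof (induction "delivery_size d" arbitrary: d i rule: less_induct)
  case less
  from next_pc[OF less.prems] obtain i1 q q' c' where i1: "i1 \<ge> i" "pc_at i1 k w = Forward j b n d"
    "acts k i1 q (Forward j b n d) q' c'" "pc_at (Suc i1) k w = c'"
    by auto
  from i1(3) show ?case
  proof (cases rule: work.cases)
    case (forward d')
    obtain Tk where "ordering_at i1 k Tk"
      using reorder_at assms by blast
    then have "V i1 (Suc k) = d" using reorder.V_eq[of _ _ _ _ _ _ _ w] i1(2) by fastforce
    then have "delivery_size d' < delivery_size d"
      using delivery_decreases[of "Suc k" i1 d'] forward assms(1) by auto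
    from less.hyps[OF this, of "Suc i1"] show ?thesis using forward i1 by (meson Suc_leD le_trans)
  next
    case forward_done
    then show ?thesis using i1 by (meson le_Suc_eq le_trans)
  qed
qed

lemma send_ends:
  assumes "k < K" "stateful_op k" "pc_at i k w = SSend d"
  shows "\<exists>i'\<ge>i. pc_at i' k w = Fetch"
  using assms(3)
proof (induction "delivery_size d" arbitrary: d i rule: less_induct)
  case less
  from next_pc[OF less.prems] obtain i1 q q' c' where i1: "i1 \<ge> i" "pc_at i1 k w = SSend d"
    "acts k i1 q (SSend d) q' c'" "pc_at (Suc i1) k w = c'"
    by auto
  from i1(3) show ?case
  proof (cases rule: work.cases)
    case (s_send d')
    have "V i1 (Suc k) = d" using stateful.ssend[OF stateful_at[OF assms(1,2)] i1(2)] by simp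
    then have "delivery_size d' < delivery_size d"
      using delivery_decreases[of "Suc k" i1 d'] s_send assms(1) by auto
    from less.hyps[OF this, of "Suc i1"] show ?thesis using s_send i1 by (meson Suc_leD le_trans)
  next
    case s_done
    then show ?thesis using i1 by (meson le_Suc_eq le_trans)
  qed
qed

lemma source_waits:
  assumes "i \<le> j" "\<And>m. \<lbrakk>i \<le> m; m < j\<rbrakk> \<Longrightarrow> a m \<noteq> Source"
  shows "incoming (\<sigma> j) = incoming (\<sigma> i) \<and> arrived (\<sigma> j) = arrived (\<sigma> i)"
  using assms
proof (induction j rule: dec_induct)
  case (step m)
  then have "a m \<noteq> Source" "incoming (\<sigma> m) = incoming (\<sigma> i) \<and> arrived (\<sigma> m) = arrived (\<sigma> i)" by auto
  from run.step[OF run_axioms, of m] this show ?case by cases auto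
qed simp

lemma next_source: "\<exists>j\<ge>i. a j = Source \<and> incoming (\<sigma> j) = incoming (\<sigma> i) \<and> arrived (\<sigma> j) = arrived (\<sigma> i)"
proof -
  let ?j = "LEAST j. i \<le> j \<and> a j = Source"
  have "\<exists>j. i \<le> j \<and> a j = Source"
    using source by (auto simp: INFM_nat_le)
  then have j: "i \<le> ?j \<and> a ?j = Source" by (rule LeastI_ex)
  have "incoming (\<sigma> ?j) = incoming (\<sigma> i) \<and> arrived (\<sigma> ?j) = arrived (\<sigma> i)"
    by (rule source_waits) (use j not_less_Least in blast)+
  then show ?thesis using j by blast
qed

lemma incoming_ends: "\<exists>j\<ge>i. fst (incoming (\<sigma> j)) = []"
proof (induction "delivery_size (incoming (\<sigma> i))" arbitrary: i rule: less_induct)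
  case less
  show ?case
  proof (cases "fst (incoming (\<sigma> i)) = []")
    case False
    obtain j where j: "i \<le> j" "a j = Source" "incoming (\<sigma> j) = incoming (\<sigma> i)"
      using next_source by blast
    from step[of j] show ?thesis
    proof cases
      case (feed d' S')
      have "delivery_size d' < delivery_size (incoming (\<sigma> i))"
        using delivery_decreases[of 0 j d' S'] feed invariant.incoming[OF inv] j by simp
      moreover have "incoming (\<sigma> (Suc j)) = d'" using feed by simp
      ultimately show ?thesis using less[of "Suc j"] j by (meson Suc_leD le_trans)
    qed (use j False in auto)
  qed auto
qed

text \<open>The emitted list includes tuples still on their way. Every delivery ends, and at a
  moment when none is in progress the emitted list has arrived downstream completely.\<close>

lemma settles:
  assumes k: "k < K"
  shows "\<exists>j\<ge>i. (stateful_op k \<longrightarrow> prefix (outputs (ops P ! k) (take (F j k) (D j k))) (D j (Suc k))) \<and>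
     (\<not> stateful_op k \<longrightarrow> (\<forall>m < nxt (dat j k). prefix (outputs (ops P ! k) (take m (D j k))) (D j (Suc k))))"
proof (cases "stateful_op k")
  case True
  note st = stateful_at[OF k True]
  have fin: "\<exists>j\<ge>i. prefix (outputs (ops P ! k) (take (F j k) (D j k))) (D j (Suc k))"
    if "pc_at j k w = Fetch" "i \<le> j" for w j
  proof -
    interpret stateful "ops P ! k" "D j k" "F j k" "dat j k" "pc_at j k" "D j (Suc k) @ fst (V j (Suc k))" "V j (Suc k)"
      by (fact st)
    have "pc_at j k w' = Return \<or> pc_at j k w' = Fetch" for w'
      using alone[of w w'] that(1) by fastforce
    from idle[OF this] show ?thesis using that(2) by auto
  qed
  have wr: "\<exists>j\<ge>i1. pc_at j k w = Fetch" if "pc_at i1 k w = SWrite x m" for w i1 x m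
    by (rule next_pc_leads[OF that]) (auto elim!: work.cases intro: send_ends[OF k True])
  have rd: "\<exists>j\<ge>i1. pc_at j k w = Fetch" if "pc_at i1 k w = SRead x" for w i1 x
    by (rule next_pc_leads[OF that]) (auto elim!: work.cases intro: wr)
  have "\<exists>j\<ge>i. prefix (outputs (ops P ! k) (take (F j k) (D j k))) (D j (Suc k))"
  proof (cases "\<forall>w. pc_at i k w = Return \<or> pc_at i k w = Fetch")
    case True
    then show ?thesis using stateful.idle[OF st[of i]] by auto
  next
    case False
    then obtain w where w: "pc_at i k w \<noteq> Return" "pc_at i k w \<noteq> Fetch" by blast
    then have "\<exists>j\<ge>i. pc_at j k w = Fetch"
      using stateful.pcs[OF st, of i w] rd[of i w] wr[of i w] send_ends[OF k True, of i w] by (cases "pc_at i k w") auto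
    then show ?thesis using fin by blast
  qed
  then show ?thesis using True by simp
next
  case False
  have "\<exists>j\<ge>i. \<forall>w. \<not> sending (pc_at j k w)"
  proof -
    have load: "\<exists>j\<ge>i1. \<forall>w. \<not> sending (pc_at j k w)" if "pc_at i1 k w = LoadNext jb b" for w i1 jb b
    proof -
      obtain Tk where R: "ordering_at i1 k Tk"
        using reorder_at k False by blast
      show ?thesis using reorder.not_sending[OF R, of w] that by auto
    qed
    have inc: "\<exists>j\<ge>i1. \<forall>w. \<not> sending (pc_at j k w)" if "pc_at i1 k w = IncNext jb b" for w i1 jb b
      by (rule next_pc_leads[OF that]) (auto elim!: work.cases intro: load)
    have emp: "\<exists>j\<ge>i1. \<forall>w. \<not> sending (pc_at j k w)" if "pc_at i1 k w = EmptyCell jb b n" for w i1 jb b n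
      by (rule next_pc_leads[OF that]) (auto elim!: work.cases intro: inc)
    have fwd: "\<exists>j\<ge>i. \<forall>w. \<not> sending (pc_at j k w)" if "pc_at i k w = Forward jb b n d" for w jb b n d
      using forward_ends[OF k False that] emp le_trans by blast
    show ?thesis
    proof (cases "\<exists>w. sending (pc_at i k w)")
      case True
      then obtain w where "sending (pc_at i k w)" ..
      then show ?thesis using fwd[of w] emp[of i w] inc[of i w] by (cases "pc_at i k w") auto
    qed auto
  qed
  then obtain j where j: "i \<le> j" "\<And>w. \<not> sending (pc_at j k w)" by blast
  obtain Tk where R: "ordering_at j k Tk" "Tk \<subseteq> {1..F j k}"
    using reorder_at k False by blast
  have "V j (Suc k) = ([], Start)" using reorder.V_idle[OF R(1)] j by blast
  moreover have "t \<in> Tk \<Longrightarrow> t \<le> length (D j k)" for t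
    using R(2) F_le[OF k, of j] by (meson atLeastAtMost_iff le_trans subsetD)
  ultimately show ?thesis
    using unit_prefix(2)[OF R(1)] j False by (intro exI[of _ j]) auto
qed

end

lemma deliver_frame:
  assumes "deliver P k V S = (V', S')"
  shows "nxt (opd S' i) = nxt (opd S i) \<and> buffer (opd S' i) = buffer (opd S i) \<and>
    flag (opd S' i) = flag (opd S i) \<and> cnt (opd S' i) = cnt (opd S i)"
  using assms
  by (cases "(P, k, V, S)" rule: deliver.cases; cases "i = k")
    (auto split: if_splits operator.splits stage.splits simp: Let_def)

lemma work_frame:
  assumes "work P k (q, c, S) (q', c', S')" "i \<noteq> k"
  shows "nxt (opd S' i) = nxt (opd S i) \<and> buffer (opd S' i) = buffer (opd S i) \<and>
    flag (opd S' i) = flag (opd S i) \<and> cnt (opd S' i) = cnt (opd S i)"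
  using assms(1) by cases (use assms(2) in \<open>auto dest: deliver_frame[where i = i]\<close>)

declare split_paired_Ex [simp del] split_paired_All [simp del]

context run begin

lemma frame:
  "nxt (dat (Suc i) k) = nxt (dat i k) \<and> buffer (dat (Suc i) k) = buffer (dat i k) \<and>
     flag (dat (Suc i) k) = flag (dat i k) \<and> cnt (dat (Suc i) k) = cnt (dat i k) \<or>
   (\<exists>w q q' c'. acts k i q (pc_at i k w) q' c' \<and>
     pc_at (Suc i) k w = c')"
  using step[of i]
proof cases
  case (act w k' q c q' c' S')
  show ?thesis
  proof (cases "k' = k")
    case True
    have "acts k i q (pc_at i k w) q' c' \<and> pc_at (Suc i) k w = c'"
      using act True by (simp add: pcs_def)
    then show ?thesis by blast
  next
    case False
    then show ?thesis using work_frame[of P k' q c "shared (\<sigma> i)" q' c' S' k] act by simp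
  qed
next
  case (feed d' S')
  then show ?thesis using deliver_frame[of P 0 _ "shared (\<sigma> i)" d' S' k] by simp
qed simp_all

end

section \<open>A reordering buffer whose \<open>nxt\<close> no longer moves\<close>

lemma sending_iff:
  "sending c \<longleftrightarrow> (\<exists>j b m d. c = Forward j b m d) \<or> (\<exists>j b m. c = EmptyCell j b m) \<or> (\<exists>j b. c = IncNext j b)"
  by (cases c) simp_all

text \<open>From \<open>i0\<close> on the buffer waits for number \<open>n\<close>. This serves two
  purposes: to refute that \<open>n\<close> has been fetched, and to describe an operator that has
  run out of input.\<close>

locale stuck = run +
  fixes k i0 n :: nat
  assumes k: "k < K" and reordering: "\<not> stateful_op k"
    and nxt: "i0 \<le> i \<Longrightarrow> nxt (dat i k) = n"
begin

abbreviation "bsize \<equiv> bufsize P k"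

lemma reorder_ex:
  obtains Tk where "ordering_at i k Tk" "Tk \<subseteq> {1..F i k}"
  using reorder_at[OF k reordering] by blast

text \<open>Executing it would move \<open>nxt\<close>. The earlier states of a transmission are
  then excluded backwards, so nobody is ever sending.\<close>

lemma no_IncNext: "i0 \<le> i \<Longrightarrow> pc_at i k w \<noteq> IncNext j b"
proof -
  have "\<not> (\<exists>j b. pc_at i k w = IncNext j b)" if "i0 \<le> i"
  proof (rule never[OF _ _ that])
    fix m q c q' c'
    assume "i0 \<le> m" "\<exists>j b. c = IncNext j b" "acts k m q c q' c'"
    then have "nxt (dat (Suc m) k) = Suc (nxt (dat m k))"
      by (auto elim: work.cases)
    then show False using nxt[of m] nxt[of "Suc m"] \<open>i0 \<le> m\<close> by simp
  qed simp
  then show "i0 \<le> i \<Longrightarrow> pc_at i k w \<noteq> IncNext j b" by blast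
qed

lemma no_EmptyCell: "i0 \<le> i \<Longrightarrow> pc_at i k w \<noteq> EmptyCell j b m"
proof -
  have "\<not> (\<exists>j b m. pc_at i k w = EmptyCell j b m)" if "i0 \<le> i"
  proof (rule never[OF _ _ that])
    fix m q c q' c'
    assume m: "i0 \<le> m" "\<exists>j b m. c = EmptyCell j b m"
      "acts k m q c q' c'" "pc_at (Suc m) k w = c'"
    then obtain j b where "c' = IncNext j b"
      by (auto elim: work.cases)
    then show False using no_IncNext[of "Suc m" w j b] m by simp
  qed simp
  then show "i0 \<le> i \<Longrightarrow> pc_at i k w \<noteq> EmptyCell j b m" by blast
qed

lemma no_Forward: "i0 \<le> i \<Longrightarrow> pc_at i k w \<noteq> Forward j b m d"
  using forward_ends[OF k reordering, of i w j b m d] no_EmptyCell le_trans by blast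

lemma not_sending: "i0 \<le> i \<Longrightarrow> \<not> sending (pc_at i k w)"
  using no_Forward[of i w] no_EmptyCell[of i w] no_IncNext[of i w] unfolding sending_iff by blast

lemma cell_index_at:
  assumes "i0 \<le> i" "cell_of (pc_at i k w) = Some m"
  shows "m = n mod bsize"
  using assms nxt reorder_ex[of i] reorder.cell_index by metis

text \<open>Only the action of \<open>EmptyCell\<close> empties a cell, and that state no longer
  occurs.\<close>

lemma full_stays:
  assumes "i0 \<le> i" "buffer (dat i k) (n mod bsize) \<noteq> None" "i \<le> j"
  shows "buffer (dat j k) (n mod bsize) \<noteq> None"
  using assms(3,2)
proof (induction j rule: dec_induct)
  case (step m)
  from frame[of m k] show ?case
  proof (elim disjE exE conjE)
    fix w q q' c'
    assume "acts k m q (pc_at m k w) q' c'"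
    moreover have "\<forall>j b l. pc_at m k w \<noteq> EmptyCell j b l"
      using no_EmptyCell[of m w] step assms(1) by simp
    ultimately show ?thesis
      using step by cases (auto dest: deliver_frame[where i = k])
  qed (use step in simp)
qed simp

text \<open>Once full, the cell stays full, and reading it would start a transmission; so
  \<open>LoadCell\<close> and \<open>LoadNext\<close> are excluded and nobody acquires the flag any
  more. A clear flag would stay clear, and the witness for \<open>wake\<close> would acquire it. So
  the flag is always set, which excludes \<open>ClearFlag\<close>, and its holder has no state
  left.\<close>

lemma cell_empty: 
  assumes "i0 \<le> i"
  shows "buffer (dat i k) (n mod bsize) = None"
proof (rule ccontr)
  assume "buffer (dat i k) (n mod bsize) \<noteq> None"
  then have full: "buffer (dat j k) (n mod bsize) \<noteq> None" if "i \<le> j" for j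
    using full_stays[OF assms _ that] by blast
  have no_LoadCell: "\<not> (\<exists>j b m. pc_at i' k w = LoadCell j b m)" if "i \<le> i'" for i' w
  proof (rule never[OF _ _ that])
    fix m q c q' c'
    assume m: "i \<le> m" "\<exists>j b m. c = LoadCell j b m" "pc_at m k w = c"
      "acts k m q c q' c'" "pc_at (Suc m) k w = c'"
    then obtain j b l where c: "c = LoadCell j b l" by blast
    have "l = n mod bsize" using cell_index_at[of m w l] m assms c by simp
    then obtain u where "c' = Forward j b l (u, Start)"
      using m(4) full[OF m(1)] unfolding c by (auto elim: work.cases)
    then show False using no_Forward[of "Suc m" w j b l "(u, Start)"] m assms by simp
  qed simp
  have no_LoadNext: "\<not> (\<exists>j b. pc_at i' k w = LoadNext j b)" if "i \<le> i'" for i' w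
    by (rule never_before[where B = "\<lambda>c. \<exists>j b l. c = LoadCell j b l", OF no_LoadCell _ _ that]) (auto elim!: work.cases)
  have flag: "flag (dat j k)" if ij: "i \<le> j" for j
  proof (rule ccontr)
    assume "\<not> flag (dat j k)"
    have clear: "\<not> flag (dat j' k)" if "j \<le> j'" for j'
      using that
    proof (induction j' rule: dec_induct)
      case (step m)
      from frame[of m k] show ?case
      proof (elim disjE exE conjE)
        fix w q q' c'
        assume "acts k m q (pc_at m k w) q' c'"
          "pc_at (Suc m) k w = c'"
        then show ?thesis
          using step no_LoadNext[of "Suc m" w] \<open>i \<le> j\<close>
          by cases (auto dest: deliver_frame[where i = k])
      qed (use step in simp)
    qed (fact \<open>\<not> flag (dat j k)\<close>)
    have no_Tas: "\<not> (\<exists>j b. pc_at i' k w = Tas j b)" if "j \<le> i'" for i' w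
    proof (rule never[OF _ _ that])
      fix m q c q' c'
      assume m: "j \<le> m" "\<exists>j b. c = Tas j b"
        "acts k m q c q' c'" "pc_at (Suc m) k w = c'"
      then have "\<exists>j b. c' = LoadNext j b" using clear[of m] by (auto elim: work.cases)
      then show False using no_LoadNext[of "Suc m" w] m \<open>i \<le> j\<close> by auto
    qed simp
    have no_Recheck: "\<not> (\<exists>j b. pc_at i' k w = Recheck j b (n mod bsize))" if "j \<le> i'" for i' w
    proof (rule never[OF _ _ that])
      fix m q c q' c'
      assume m: "j \<le> m" "\<exists>j b. c = Recheck j b (n mod bsize)"
        "acts k m q c q' c'" "pc_at (Suc m) k w = c'"
      then have "\<exists>j b. c' = Tas j b" using full[of m] \<open>i \<le> j\<close> by (auto elim: work.cases)
      then show False using no_Tas[of "Suc m" w] m by auto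
    qed simp
    obtain Tk where R: "ordering_at j k Tk"
      by (rule reorder_ex)
    have nj: "nxt (dat j k) = n" using nxt that assms by simp
    obtain w where "wakes (n mod bsize) (pc_at j k w)"
      using reorder.wake[OF R \<open>\<not> flag (dat j k)\<close>] full[OF ij] unfolding nj by blast
    then show False using no_Tas[of j w] no_Recheck[of j w] by (cases "pc_at j k w") auto
  qed
  have no_ClearFlag: "\<not> (\<exists>j b m. pc_at i' k w = ClearFlag j b m)" if "i \<le> i'" for i' w
  proof (rule never[OF _ _ that])
    fix m q c q' c'
    assume m: "i \<le> m" "\<exists>j b l. c = ClearFlag j b l"
      "acts k m q c q' c'"
    then have "\<not> flag (dat (Suc m) k)" by (auto elim: work.cases)
    then show False using flag[of "Suc m"] m by simp
  qed simp
  obtain Tk where R: "ordering_at i k Tk"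
    by (rule reorder_ex)
  then obtain w where "locked (pc_at i k w)"
    using reorder.flag_iff[OF R] flag[of i] by blast
  then show False
    using no_ClearFlag[of i w] no_LoadNext[of i w] no_LoadCell[of i w] not_sending[OF assms, of w]
    by (cases "pc_at i k w") auto
qed

text \<open>With the next cell empty, whoever gets the flag finds nothing to send, clears it and
  leaves. \<open>AddLoad\<close> and \<open>AddStore\<close> are left out because there the outcome
  of the attempt is still open.\<close>

lemma send_resolves:
  assumes "i0 \<le> i" "job_of (pc_at i k w) = Some (j, b)"
    "\<And>j. pc_at i k w \<noteq> AddLoad j" "\<And>j. pc_at i k w \<noteq> AddStore j"
  shows "\<exists>i'\<ge>i. pc_at i' k w = resume j b"
proof -
  define done_by where "done_by i' \<longleftrightarrow> pc_at i' k w = resume j b" for i'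
  have now: "pc_at i1 k w = resume j b \<Longrightarrow> \<exists>i'\<ge>i1. done_by i'" for i1
    by (auto simp: done_by_def)
  have rn: "\<exists>i'\<ge>i1. done_by i'" if "i0 \<le> i1" "pc_at i1 k w = Recheck j b (n mod bsize)" for i1
    by (rule next_pc_leads[OF that(2)])
      (use cell_empty that(1) in \<open>auto elim!: work.cases intro: now\<close>)
  have cf: "\<exists>i'\<ge>i1. done_by i'" if "i0 \<le> i1" "pc_at i1 k w = ClearFlag j b m" for i1 m
    by (rule next_pc_leads[OF that(2)])
      (use that cell_index_at[of i1 w m] in \<open>auto elim!: work.cases intro: rn\<close>)
  have lc: "\<exists>i'\<ge>i1. done_by i'" if "i0 \<le> i1" "pc_at i1 k w = LoadCell j b m" for i1 m
    by (rule next_pc_leads[OF that(2)])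
      (use that cell_index_at[of i1 w m] cell_empty in \<open>auto elim!: work.cases intro: cf\<close>)
  have ln: "\<exists>i'\<ge>i1. done_by i'" if "i0 \<le> i1" "pc_at i1 k w = LoadNext j b" for i1
    by (rule next_pc_leads[OF that(2)]) (use that(1) in \<open>auto elim!: work.cases intro: lc\<close>)
  have ts: "\<exists>i'\<ge>i1. done_by i'" if "i0 \<le> i1" "pc_at i1 k w = Tas j b" for i1
    by (rule next_pc_leads[OF that(2)])
      (use that(1) in \<open>auto elim!: work.cases intro: now ln\<close>)
  \<comment> \<open>The index may have been read before \<open>i0\<close> and its cell may be full;
    this costs one more round through \<open>Tas\<close>.\<close>
  have rc: "\<exists>i'\<ge>i1. done_by i'" if "i0 \<le> i1" "pc_at i1 k w = Recheck j b m" for i1 m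
    by (rule next_pc_leads[OF that(2)])
      (use that(1) in \<open>auto elim!: work.cases intro: now ts\<close>)
  have "\<forall>j. pc_at i k w \<noteq> AddLoad j \<and> pc_at i k w \<noteq> AddStore j"
    using assms(3,4) by blast
  then have "\<exists>i'\<ge>i. done_by i'"
    using assms(2) not_sending[OF assms(1), of w] rc[OF assms(1)] ts[OF assms(1)] ln[OF assms(1)]
      lc[OF assms(1)] cf[OF assms(1)]
    by (cases "pc_at i k w") auto
  then show ?thesis unfolding done_by_def .
qed

text \<open>The window starts at \<open>n\<close>, so \<open>n\<close> passes the window test and
  its holder would fill the next cell. A failed earlier attempt ends and is retried, and the states
  before the first attempt lead to it.\<close>

lemma not_held:
  assumes "i0 \<le> i"
  shows "holds (pc_at i k w) \<noteq> Some n"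
proof -
  have bsize: "0 < bsize" using valid k by (simp add: valid_pipeline_def)
  have st: "\<not> (\<exists>po u. pc_at i' k w = AddStore (po, n, u))" if "i0 \<le> i'" for i' w
  proof (rule never[OF _ _ that])
    fix m q c q' c'
    assume m: "i0 \<le> m" "\<exists>po u. c = AddStore (po, n, u)"
      "acts k m q c q' c'"
    then have "buffer (dat (Suc m) k) (n mod bsize) \<noteq> None" by (auto elim!: work.cases)
    then show False using cell_empty[of "Suc m"] m by simp
  qed simp
  have ld: "\<not> (\<exists>po u. pc_at i' k w = AddLoad (po, n, u))" if "i0 \<le> i'" for i' w
    by (rule never_before[where B = "\<lambda>c. \<exists>po u. c = AddStore (po, n, u)", OF st _ _ that]) (use nxt bsize in \<open>auto elim!: work.cases\<close>)
  have jb: "job_of (pc_at i' k w) \<noteq> Some ((po, n, u), False)" if "i0 \<le> i'" for i' w po u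
  proof
    assume j: "job_of (pc_at i' k w) = Some ((po, n, u), False)"
    have "pc_at i' k w \<noteq> AddLoad j'" "pc_at i' k w \<noteq> AddStore j'" for j'
      using j ld[OF that, of w] st[OF that, of w] by auto
    from send_resolves[OF that j this] show False
      using ld[of _ w] that le_trans by fastforce
  qed
  have wr: "\<not> (\<exists>p x m. pc_at i' k w = PWrite p n x m)" if "i0 \<le> i'" for i' w
    by (rule never_before[where B = "\<lambda>c. \<exists>po u. c = AddLoad (po, n, u)", OF ld _ _ that]) (auto elim!: work.cases)
  have rd: "\<not> (\<exists>p x. pc_at i' k w = PRead p n x)" if "i0 \<le> i'" for i' w
    by (rule never_before[where B = "\<lambda>c. \<exists>p x m. c = PWrite p n x m", OF wr _ _ that]) (auto elim!: work.cases)
  have cp: "\<not> (\<exists>x. pc_at i' k w = Compute n x)" if "i0 \<le> i'" for i' w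
    by (rule never_before[where B = "\<lambda>c. \<exists>po u. c = AddLoad (po, n, u)", OF ld _ _ that]) (auto elim!: work.cases)
  show ?thesis
  proof
    assume h: "holds (pc_at i k w) = Some n"
    show False
    proof (cases "job_of (pc_at i k w)")
      case None
      then show False using h wr[OF assms, of w] rd[OF assms, of w] cp[OF assms, of w]
        by (cases "pc_at i k w") auto
    next
      case (Some x)
      obtain po t u b where x: "x = ((po, t, u), b)" by (cases x) auto
      then show False using h jb[OF assms, of w po u] holds_job Some by (cases b) fastforce+
    qed
  qed
qed

lemma not_taken:
  assumes "i0 \<le> i"
    and R: "reorder bsize (unit_of (ops P ! k) (D i k)) Tk (dat i k) (pc_at i k) Out V'"
  shows "n \<notin> Tk"
proof
  assume "n \<in> Tk"
  moreover have "\<not> held (pc_at i k) n" using not_held[OF assms(1)] by (simp add: held_def)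
  moreover have "\<not> is_IncNext (pc_at i k w)" for w
    using not_sending[OF assms(1)] is_IncNext_sending by blast
  ultimately show False
    using reorder.next_cell[OF R] cell_empty[OF assms(1)] nxt[OF assms(1)] by simp
qed

text \<open>In a stateless operator, fetched means taken. In a partitioned one only the masterQueue
  entry is known to be gone, while \<open>n\<close> may wait in its partition \<open>p\<close>.
  There \<open>PTake p\<close> would take \<open>n\<close>, so it never occurs; hence the counter of
  \<open>p\<close> is never 0 and \<open>PLeave p\<close> never occurs, although the server of
  \<open>p\<close> would have to reach it.\<close>

lemma not_fetched: "F i0 k < n"
proof (rule ccontr)
  assume nF: "\<not> F i0 k < n"
  then have nFi: "n \<le> F i k" if "i0 \<le> i" for i
    using F_mono[OF that, of k] by linarith
  obtain Tk where R: "ordering_at i0 k Tk"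
    and kind: "(\<exists>h. ops P ! k = Stateless h) \<and> Tk = {1..F i0 k} \<or>
     (\<exists>n key part s0 h mark. ops P ! k = Partitioned n key part s0 h \<and>
        partitioning i0 k n key part s0 h mark \<and>
        Tk = taken (\<lambda>x. part (key x)) mark (D i0 k))"
    using reorder_at[OF k reordering, of i0] by blast
  have n0: "0 < n" using reorder.nxt_pos[OF R] nxt[of i0] by simp
  from kind show False
  proof (elim disjE conjE exE)
    assume "Tk = {1..F i0 k}"
    then show False using not_taken[OF _ R] n0 nF by simp
  next
    fix n' key part s0 h mark0
    assume p: "ops P ! k = Partitioned n' key part s0 h"
    let ?pk = "\<lambda>x. part (key x)"
    define p where "p = part (key (D i0 k ! (n - 1)))"
    have Dn: "?pk (D i k ! (n - 1)) = p" if i: "i0 \<le> i" for i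
    proof -
      obtain zs where "D i k = D i0 k @ zs" using D_mono[OF i, of k] by (auto simp: prefix_def)
      moreover have "n - 1 < length (D i0 k)" using nF n0 F_le[OF k, of i0] by linarith
      ultimately show ?thesis by (simp add: p_def nth_append)
    qed
    have at: "\<exists>mark. partitioning i k n' key part s0 h mark \<and>
      ordering_at i k (taken ?pk mark (D i k)) \<and> mark p < n" if i: "i0 \<le> i" for i
    proof -
      obtain mark where Q: "partitioning i k n' key part s0 h mark"
        and R: "ordering_at i k (taken ?pk mark (D i k))"
        using reorder_at[OF k reordering, of i] \<open>ops P ! k = Partitioned n' key part s0 h\<close> by auto
      have "n \<notin> taken ?pk mark (D i k)" using not_taken[OF i R] .
      moreover have "n \<le> length (D i k)" using nFi[OF that] F_le[OF k, of i] by simp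
      ultimately have "mark p < n" using Dn[OF that] n0 by (auto simp: taken_def)
      then show ?thesis using Q R by blast
    qed
    have no_PTake: "pc_at i k w \<noteq> PTake p" if "i0 \<le> i" for i w
    proof -
      have "\<not> (pc_at i k w = PTake p)"
      proof (rule never[OF _ _ that])
        fix m q c q' c'
        assume m: "i0 \<le> m" "c = PTake p" "pc_at m k w = c"
          "acts k m q c q' c'" "pc_at (Suc m) k w = c'"
        obtain mark where Q: "partitioning m k n' key part s0 h mark"
          and R: "ordering_at m k (taken ?pk mark (D m k))" and "mark p < n"
          using at[OF m(1)] by blast
        interpret partition_inv "cores P" n' key part s0 h "D m k" "extra (V m k)" mark "F m k" "dat m k" "pc_at m k"
          by (fact Q)
        have ne: "{t. mark p < t \<and> t \<le> F m k \<and> ?pk (D m k ! (t - 1)) = p} \<noteq> {}"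
          using \<open>mark p < n\<close> nFi[OF m(1)] Dn[OF m(1)] by blast
        obtain t rest where t: "parts (dat m k) p = (t, D m k ! (t - 1)) # rest" "mark p < t" "t \<le> F m k"
          "?pk (D m k ! (t - 1)) = p" "\<forall>t'. mark p < t' \<and> t' < t \<longrightarrow> ?pk (D m k ! (t' - 1)) \<noteq> p"
          using next_in_partition[OF ne] by blast
        \<comment> \<open>The head \<open>t\<close> is the least waiting number of \<open>p\<close>,
          hence at most \<open>n\<close>; a smaller one would be below \<open>nxt\<close> and thus
          taken already.\<close>
        have "\<not> n < t" using t(5) Dn[OF m(1)] \<open>mark p < n\<close> by blast
        moreover have "\<not> t < n"
        proof
          assume "t < n"
          then have "t \<in> taken ?pk mark (D m k)"
            using reorder.below[OF R, of t] nxt[OF m(1)] t(2) by simp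
          then show False using t by (auto simp: taken_def)
        qed
        ultimately have "t = n" by simp
        then have "holds c' = Some n" using m(4) t(1) unfolding m(2) by (auto elim: work.cases)
        then show False using not_held[of "Suc m" w] m by simp
      qed simp
      then show ?thesis .
    qed
    have cnt: "cnt (dat i k) p \<noteq> 0" if i: "i0 \<le> i" for i
    proof
      assume c0: "cnt (dat i k) p = 0"
      \<comment> \<open>An increment from 0 would put its worker at \<open>PTake p\<close>, and a
        decrement needs a server, which a zero counter excludes.\<close>
      have stay: "cnt (dat j k) p = 0" if "i \<le> j" for j
        using that
      proof (induction j rule: dec_induct)
        case (step m)
        have m: "i0 \<le> m" using step \<open>i0 \<le> i\<close> by simp
        obtain mark where Q: "partitioning m k n' key part s0 h mark"
          using at[OF m] by blast
        have sv: "serving (pc_at m k w) \<noteq> Some p" for w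
          using partition_inv.serving_cnt[OF Q, of w p] step by auto
        from frame[of m k] show ?case
        proof (elim disjE exE conjE)
          fix w q q' c'
          assume "acts k m q (pc_at m k w) q' c'"
            "pc_at (Suc m) k w = c'"
          then show ?thesis
            using step no_PTake[of "Suc m" w] m sv[of w]
            by cases (auto dest: deliver_frame[where i = k])
        qed (use step in simp)
      qed (fact c0)
      obtain mark where Q: "partitioning i k n' key part s0 h mark"
        and "mark p < n"
        using at[OF i] by blast
      have "n \<in> {t. mark p < t \<and> t \<le> F i k \<and> ?pk (D i k ! (t - 1)) = p}"
        using \<open>mark p < n\<close> nFi[OF that] Dn[OF that] by blast
      moreover have "finite {t. mark p < t \<and> t \<le> F i k \<and> ?pk (D i k ! (t - 1)) = p}"
        by (rule finite_subset[of _ "{..F i k}"]) auto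
      ultimately have "0 < card {t. mark p < t \<and> t \<le> F i k \<and> ?pk (D i k ! (t - 1)) = p}"
        by (metis card_gt_0_iff empty_iff)
      \<comment> \<open>With counter 0 the waiting number must show up as positive weight: some
        worker has removed an entry of \<open>p\<close> and is about to execute fetch_add.\<close>
      then have "0 < (\<Sum>w<cores P. weight p (pc_at i k w))"
        using partition_inv.count[OF Q, of p] c0 by simp
      then obtain w where "0 < weight p (pc_at i k w)"
        by (metis not_le sum_nonpos)
      then have "pc_at i k w = PEnter p" by (simp add: weight_def split: if_splits)
      then obtain m q q' c' where m: "m \<ge> i" "acts k m q (PEnter p) q' c'"
        "pc_at (Suc m) k w = c'"
        using next_pc[of i k w "PEnter p"] by auto
      then have "c' = PTake p" using stay[of m] by (auto elim: work.cases)
      then show False using no_PTake[of "Suc m" w] m that by simp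
    qed
    have no_PLeave: "pc_at i k w \<noteq> PLeave p" if "i0 \<le> i" for i w
    proof -
      have "\<not> (pc_at i k w = PLeave p)"
      proof (rule never[OF _ _ that])
        fix m q c q' c'
        assume m: "i0 \<le> m" "c = PLeave p" "pc_at m k w = c"
          "acts k m q c q' c'" "pc_at (Suc m) k w = c'"
        obtain mark where Q: "partitioning m k n' key part s0 h mark"
          using at[OF m(1)] by blast
        have "0 < cnt (dat m k) p" using partition_inv.serving_cnt[OF Q, of w p] m by simp
        moreover have "cnt (dat (Suc m) k) p = cnt (dat m k) p - 1" "c' = (if cnt (dat m k) p > 1 then PTake p else Fetch)"
          using m(4) unfolding m(2) by (auto elim: work.cases)
        ultimately show False
          using cnt[of "Suc m"] no_PTake[of "Suc m" w] m by (auto split: if_splits)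
      qed simp
      then show ?thesis .
    qed
    obtain mark where Q: "partitioning i0 k n' key part s0 h mark"
      and R: "ordering_at i0 k (taken ?pk mark (D i0 k))" and "mark p < n"
      using at[of i0] by blast
    obtain w where w: "serving (pc_at i0 k w) = Some p"
      using partition_inv.cnt_serving[OF Q, of p] partition_inv.cnt_nonneg[OF Q, of p] cnt[of i0] by auto
    \<comment> \<open>A held number of \<open>p\<close> is taken, hence at most
      \<open>mark p\<close>, but also at least \<open>nxt\<close>, which is
      \<open>n\<close>.\<close>
    have "holds (pc_at i0 k w) = None"
    proof (rule ccontr)
      assume "holds (pc_at i0 k w) \<noteq> None"
      then obtain t where t: "holds (pc_at i0 k w) = Some t" by blast
      have "t \<le> mark p"
        using reorder.held_Tk[OF R t] partition_inv.holds_part[OF Q t w] by (simp add: taken_def)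
      then show False using reorder.held_Tk[OF R t] nxt[of i0] \<open>mark p < n\<close> by simp
    qed
    then obtain t u where j: "job_of (pc_at i0 k w) = Some ((Some p, t, u), True)"
      using w no_PTake[of i0 w] no_PLeave[of i0 w]
      by (cases "pc_at i0 k w") (auto split: bool.splits)
    then have "pc_at i0 k w \<noteq> AddLoad j'" "pc_at i0 k w \<noteq> AddStore j'" for j'
      by auto
    from send_resolves[OF _ j this] show False
      using no_PLeave[of _ w] by fastforce
  qed
qed

end

section \<open>From fetched inputs to delivered outputs\<close>

context run begin

lemma nxt_advances:
  assumes "k < K" "\<not> stateful_op k" "nxt (dat i k) \<le> F i k"
  shows "\<exists>j\<ge>i. nxt (dat i k) < nxt (dat j k)"
proof (rule ccontr)
  assume stuck: "\<not> ?thesis"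
  have "nxt (dat j k) = nxt (dat i k)" if "i \<le> j" for j
  proof -
    have "\<not> nxt (dat i k) < nxt (dat j k)" using stuck that by blast
    then show ?thesis using nxt_mono[OF that, of k] by simp
  qed
  then have "stuck P inp \<sigma> a D F V k i (nxt (dat i k))"
    using assms(1,2) run_axioms by (intro stuck.intro stuck_axioms.intro)
  from stuck.not_fetched[OF this] show False using assms(3) by simp
qed

lemma nxt_catches_up:
  assumes "k < K" "\<not> stateful_op k" "m \<le> F i k"
  shows "\<exists>j\<ge>i. m < nxt (dat j k)"
  using assms(3)
proof (induction "Suc m - nxt (dat i k)" arbitrary: i rule: less_induct)
  case less
  show ?case
  proof (cases "m < nxt (dat i k)")
    case False
    then obtain j where j: "i \<le> j" "nxt (dat i k) < nxt (dat j k)"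
      using nxt_advances[OF assms(1,2), of i] less.prems by auto
    have "m \<le> F j k" using less.prems F_mono[OF j(1), of k] by simp
    moreover have "Suc m - nxt (dat j k) < Suc m - nxt (dat i k)" using False j by linarith
    ultimately show ?thesis using less.hyps[of j] j by (meson le_trans)
  qed auto
qed

lemma processed:
  assumes "k < K" "m \<le> F i k"
  shows "\<exists>j\<ge>i. prefix (outputs (ops P ! k) (take m (D j k))) (D j (Suc k))"
proof (cases "stateful_op k")
  case True
  then obtain j where j: "i \<le> j" "prefix (outputs (ops P ! k) (take (F j k) (D j k))) (D j (Suc k))"
    using settles[OF assms(1), of i] by blast
  have "m \<le> F j k" using assms(2) F_mono[OF j(1), of k] by simp
  then have "take m (D j k) = take m (take (F j k) (D j k))" by (simp add: min_def)
  then have "prefix (outputs (ops P ! k) (take m (D j k))) (outputs (ops P ! k) (take (F j k) (D j k)))"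
    by (metis outputs_mono take_is_prefix)
  then show ?thesis using j prefix_order.trans by blast
next
  case False
  obtain i1 where i1: "i \<le> i1" "m < nxt (dat i1 k)"
    using nxt_catches_up[OF assms(1) False assms(2)] by blast
  obtain j where j: "i1 \<le> j" "\<forall>m < nxt (dat j k). prefix (outputs (ops P ! k) (take m (D j k))) (D j (Suc k))"
    using settles[OF assms(1), of i1] False by blast
  have "m < nxt (dat j k)" using i1(2) nxt_mono[OF j(1), of k] by simp
  then show ?thesis using j i1 le_trans by blast
qed

text \<open>\<open>F\<close> is a ghost counter and is recovered from the backlog, the number of
  received tuples minus \<open>F\<close>: the backlog drops by one while the received list does not
  shrink.\<close>

lemma take_increases:
  assumes "k < K" and work: "acts k m q Fetch q' c'" and "c' \<noteq> Return"
  shows "F m k < F (Suc m) k"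
proof -
  have "Suc (backlog (ops P ! k) (dat (Suc m) k)) = backlog (ops P ! k) (dat m k)"
    using work by cases (use \<open>c' \<noteq> Return\<close> in \<open>auto simp: backlog_def\<close>)
  moreover have "length (D m k) \<le> length (D (Suc m) k)"
    using D_mono[of m "Suc m" k] by (simp add: prefix_length_le)
  ultimately show ?thesis
    using F_le[OF assms(1), of m] F_le[OF assms(1), of "Suc m"]
      backlog[OF assms(1), of m] backlog[OF assms(1), of "Suc m"] by linarith
qed

definition serves :: "nat \<Rightarrow> nat \<Rightarrow> nat \<Rightarrow> bool" where
  "serves i k w \<longleftrightarrow> (\<exists>q c. worker_at i w = Busy k q c)"

text \<open>A worker at \<open>Fetch\<close> must return, since taking an input would increase
  \<open>F\<close>. With a reordering buffer, all fetched inputs are eventually sent; then nobody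
  holds a number and no tuple waits in a partition, so each loop of a worker has only its exit
  left.\<close>

lemma drains:
  assumes k: "k < K" and F: "\<And>i. i0 \<le> i \<Longrightarrow> F i k = n" and "i0 \<le> i"
  shows "\<exists>j\<ge>i. \<not> serves j k w"
proof -
  define out where "out m \<longleftrightarrow> (\<exists>j\<ge>m. \<not> serves j k w)" for m
  have later: "out m" if "out m'" "m \<le> m'" for m m'
    using that unfolding out_def by (meson le_trans)
  have go: "out i1" if g: "pc_at i1 k w = c" "c \<noteq> Return"
    "\<And>m q q' c'. \<lbrakk>i1 \<le> m; pc_at m k w = c; acts k m q c q' c';
        pc_at (Suc m) k w = c'\<rbrakk> \<Longrightarrow> out (Suc m)" for i1 c
  proof -
    obtain m q q' c' where m: "m \<ge> i1" "pc_at m k w = c"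
      "acts k m q c q' c'" "pc_at (Suc m) k w = c'"
      using next_pc[OF g(1,2)] by blast
    show ?thesis using later[OF g(3)[OF m]] m by simp
  qed
  have ret: "out i1" if r: "pc_at i1 k w = Return" for i1
  proof (cases "serves i1 k w")
    case False
    then show ?thesis by (auto simp: out_def)
  next
    case True
    then obtain q where b: "worker_at i1 w = Busy k q Return"
      using r by (auto simp: serves_def pcs_def)
    then obtain m where m: "i1 \<le> m" "a m = Worker w" "worker_at m w = Busy k q Return"
      using next_action[of w i1] Busy_less[OF b] by auto
    from step[of m] have "worker_at (Suc m) w = Idle"
      by cases (use m in \<open>auto elim: work.cases\<close>)
    then have "\<not> serves (Suc m) k w" by (simp add: serves_def)
    then show ?thesis unfolding out_def using m by (meson le_SucI)
  qed
  have fet: "out i1" if "i0 \<le> i1" "pc_at i1 k w = Fetch" for i1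
  proof (rule go[OF that(2)])
    fix m q q' c'
    assume m: "i1 \<le> m" "acts k m q Fetch q' c'" "pc_at (Suc m) k w = c'"
    have "c' = Return" using take_increases[OF k m(2)] F[of m] F[of "Suc m"] m that by auto
    then show "out (Suc m)" using ret m by simp
  qed simp
  show ?thesis
  proof (cases "stateful_op k")
    case True
    have sd: "out i1" if "i0 \<le> i1" "pc_at i1 k w = SSend d" for i1 d
      using send_ends[OF k True that(2)] fet later that(1) le_trans by blast
    have wr: "out i1" if "i0 \<le> i1" "pc_at i1 k w = SWrite x m" for i1 x m
      by (rule go[OF that(2)]) (use sd that(1) in \<open>auto elim!: work.cases\<close>)
    have rd: "out i1" if "i0 \<le> i1" "pc_at i1 k w = SRead x" for i1 x
      by (rule go[OF that(2)]) (use wr that(1) in \<open>auto elim!: work.cases\<close>)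
    have "out i"
      using stateful.pcs[OF stateful_at[OF k True], of i w] \<open>i0 \<le> i\<close> ret fet sd wr rd
      by (cases "pc_at i k w") auto
    then show ?thesis unfolding out_def .
  next
    case False
    obtain i1 where i1: "i \<le> i1" "n < nxt (dat i1 k)"
      using nxt_catches_up[OF k False, of n i] F \<open>i0 \<le> i\<close> by auto
    \<comment> \<open>Taken numbers are at most \<open>n\<close>, and all numbers below
      \<open>nxt\<close> are taken; so a buffer that has passed \<open>n\<close> stands exactly at
      \<open>Suc n\<close>.\<close>
    have nxt: "nxt (dat j k) = Suc n" if "i1 \<le> j" for j
    proof -
      obtain Tk where R: "ordering_at j k Tk" "Tk \<subseteq> {1..F j k}"
        using reorder_at[OF k False, of j] by blast
      have "n < nxt (dat j k)" using i1 nxt_mono[OF that, of k] by simp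
      moreover have "nxt (dat j k) - 1 \<in> Tk \<or> nxt (dat j k) = 1"
        using reorder.below[OF R(1), of "nxt (dat j k) - 1"] reorder.nxt_pos[OF R(1)] by auto
      moreover from this have "nxt (dat j k) - 1 \<le> F j k" using R(2) by auto
      moreover have "F j k = n" using F i1(1) that \<open>i0 \<le> i\<close> by simp
      ultimately show ?thesis by linarith
    qed
    \<comment> \<open>Here \<open>nxt\<close> stands still for lack of input, and the termination of
      send carries over to this situation.\<close>
    interpret stuck P inp \<sigma> a D F V k i1 "Suc n"
      by unfold_locales (use k False nxt in auto)
    have i01: "i0 \<le> j" if "i1 \<le> j" for j using that i1 \<open>i0 \<le> i\<close> by simp
    have nh: "holds (pc_at j k w) = None" if j: "i1 \<le> j" for j
    proof (rule ccontr)
      assume "holds (pc_at j k w) \<noteq> None"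
      then obtain t where t: "holds (pc_at j k w) = Some t" by blast
      obtain Tk where R: "ordering_at j k Tk" "Tk \<subseteq> {1..F j k}"
        using reorder_at[OF k False, of j] by blast
      show False using reorder.held_Tk[OF R(1) t] R(2) F[OF i01[OF j]] nxt[OF j] by auto
    qed
    have srv: "pc_at j k w \<noteq> PTake p \<and> (serving (pc_at j k w) = Some p \<longrightarrow> cnt (dat j k) p \<le> 1)"
      if j: "i1 \<le> j" for j p
    proof -
      consider (less) h where "ops P ! k = Stateless h" "stateless_pc (pc_at j k w)"
        | (part) n' key part s0 h mark where
        "partitioning j k n' key part s0 h mark"
        "ordering_at j k (taken (\<lambda>x. part (key x)) mark (D j k))"
      proof (cases "ops P ! k")
        case (Stateless h)
        then show ?thesis using less invariant.ops[OF inv k, of j] by (auto simp: op_inv_def stateless_def)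
      next
        case (Partitioned n' key part s0 h)
        then show ?thesis using part invariant.ops[OF inv k, of j] by (auto simp: op_inv_def)
      next
        case (Stateful s0 h)
        then show ?thesis using False by (simp add: stateful_op_def)
      qed
      then show ?thesis
      proof cases
        case less
        have "serving (pc_at j k w) = None"
          using less(2) by (cases "pc_at j k w") auto
        then show ?thesis by auto
      next
        case part
        have "{t. mark p < t \<and> t \<le> F j k \<and> part (key (D j k ! (t - 1))) = p} = {}"
        proof (rule ccontr)
          assume "\<not> ?thesis"
          then obtain t where t: "mark p < t" "t \<le> F j k" "part (key (D j k ! (t - 1))) = p" by blast
          then have "t \<in> taken (\<lambda>x. part (key x)) mark (D j k)"
            using reorder.below[OF part(2), of t] F[OF i01[OF j]] nxt[OF j] by simp
          then show False using t by (simp add: taken_def)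
        qed
        from partition_inv.cnt_le_1[OF part(1) _ this, of w] show ?thesis by auto
      qed
    qed
    have lv: "out i2" if "i1 \<le> i2" "pc_at i2 k w = PLeave p" for i2 p
    proof (rule go[OF that(2)])
      fix m q q' c'
      assume m: "i2 \<le> m" "pc_at m k w = PLeave p"
        "acts k m q (PLeave p) q' c'" "pc_at (Suc m) k w = c'"
      then have "c' = Fetch" using srv[of m p] that(1) by (auto elim: work.cases)
      then show "out (Suc m)" using fet m i01 that(1) by auto
    qed simp
    have en: "out i2" if "i1 \<le> i2" "pc_at i2 k w = PEnter p" for i2 p
    proof (rule go[OF that(2)])
      fix m q q' c'
      assume m: "i2 \<le> m" "acts k m q (PEnter p) q' c'" "pc_at (Suc m) k w = c'"
      have "c' \<noteq> PTake p" using srv[of "Suc m" p] m that(1) by auto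
      with m(2) have "c' = Fetch" by cases (auto split: if_splits)
      then show "out (Suc m)" using fet m i01 that(1) by auto
    qed simp
    have "out i1"
    proof (cases "job_of (pc_at i1 k w)")
      case (Some x)
      then obtain j b where j: "job_of (pc_at i1 k w) = Some (j, b)" by (cases x) auto
      have b: "b" using holds_job[OF j] nh[of i1] by (auto split: if_splits)
      have "pc_at i1 k w \<noteq> AddLoad j'" "pc_at i1 k w \<noteq> AddStore j'" for j'
        using j b by auto
      from send_resolves[OF _ j this] obtain i2 where i2: "i1 \<le> i2" "pc_at i2 k w = resume j True"
        using b by auto
      have "resume j True = (Fetch :: ('a, 's) pc) \<or> (\<exists>p. resume j True = (PLeave p :: ('a, 's) pc))"
        by (cases "(j, True)" rule: resume.cases) auto
      then show ?thesis using i2 fet[of i2] lv[of i2] i01 later by auto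
    next
      case None
      have "stateless_pc (pc_at i1 k w) \<or> partitioned_pc (pc_at i1 k w)"
        using invariant.ops[OF inv k, of i1] False
        by (cases "ops P ! k") (auto simp: op_inv_def stateless_def stateful_op_def)
      then show ?thesis
        using None nh[of i1] srv[of i1] ret[of i1] fet[of i1] lv[of i1] en[of i1] i01[of i1]
        by (cases "pc_at i1 k w") auto
    qed
    then have "out i" using later i1 by blast
    then show ?thesis unfolding out_def .
  qed
qed

section \<open>Every pending input is fetched\<close>

lemma eventually_constant:
  fixes g :: "nat \<Rightarrow> nat"
  assumes "\<And>i j. i \<le> j \<Longrightarrow> g i \<le> g j" "\<And>i. g i \<le> B"
  shows "\<exists>T. \<forall>i\<ge>T. g i = g T"
proof (rule ccontr)
  assume *: "\<not> ?thesis"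
  have "\<exists>i. m \<le> g i" for m
  proof (induction m)
    case (Suc m)
    then obtain i where "m \<le> g i" by blast
    moreover obtain j where "i \<le> j" "g j \<noteq> g i" using * by blast
    ultimately have "Suc m \<le> g j" using assms(1)[of i j] by simp
    then show ?case by blast
  qed auto
  from this[of "Suc B"] show False using assms(2) not_less_eq_eq by blast
qed

text \<open>Otherwise every worker eventually stays at one operator forever. Quotas never increase
  there and each fetch lowers one, so fetching stops; but then operators drain and workers do
  leave.\<close>

lemma queries_infinite: "\<exists>\<^sub>\<infinity>i. query_at \<sigma> a i"
proof (rule ccontr)
  assume "\<not> ?thesis"
  then obtain T where T: "\<And>i. T \<le> i \<Longrightarrow> \<not> query_at \<sigma> a i"
    by (auto simp: INFM_nat_le)
  have busy: "worker_at i w \<noteq> Idle" if iw: "T \<le> i" "w < cores P" for i w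
  proof
    assume "worker_at i w = Idle"
    then obtain j where "i \<le> j" "a j = Worker w" "worker_at j w = Idle"
      using next_action[OF iw(2), of i] by auto
    then show False using T[of j] iw by (auto simp: query_at_def)
  qed
  define quota where "quota i w = (case worker_at i w of Busy k q c \<Rightarrow> q | Idle \<Rightarrow> 0)" for i w
  have work_quota: "q' \<le> q" if "work P k (q, c, S) (q', c', S')" for k q c S q' c' S'
    using that by cases auto
  have stay: "(\<exists>k q q' c c'. worker_at i w = Busy k q c \<and> worker_at (Suc i) w = Busy k q' c' \<and> q' \<le> q)"
    if iw: "T \<le> i" "w < cores P" for i w
  proof -
    obtain k q c where b: "worker_at i w = Busy k q c"
      using busy[OF iw] by (cases "worker_at i w") auto
    from step[of i] show ?thesis
    proof cases
      case (act w' k' q0 c0 q' c' S')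
      then show ?thesis using b work_quota[of k' q0 c0 "shared (\<sigma> i)" q' c' S'] by (cases "w' = w") auto
    next
      case (return w' k' q')
      then show ?thesis using b busy[of "Suc i" w] that by (cases "w' = w") auto
    qed (use b in \<open>auto split: if_splits\<close>)
  qed
  have quota_Suc: "quota (Suc i) w \<le> quota i w" if "T \<le> i" "w < cores P" for i w
    using stay[OF that] by (auto simp: quota_def)
  have quota_mono: "quota j w \<le> quota i w" if "T \<le> i" "w < cores P" "i \<le> j" for i j w
    using that(3)
  proof (induction j rule: dec_induct)
    case (step m)
    then show ?case using quota_Suc[of m w] that by simp
  qed simp
  \<comment> \<open>The total quota used up since \<open>T\<close> is increasing and bounded, as
    \<open>eventually_constant\<close> requires; \<open>sum_le\<close> ensures that the subtraction
    is not truncated.\<close>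
  define g where "g i = (\<Sum>w<cores P. quota T w) - (\<Sum>w<cores P. quota (T + i) w)" for i
  have "\<exists>T'. \<forall>i\<ge>T'. g i = g T'"
  proof (rule eventually_constant)
    show "g i \<le> g j" if "i \<le> j" for i j
      unfolding g_def by (rule diff_le_mono2, rule sum_mono) (use quota_mono that in auto)
    show "g i \<le> (\<Sum>w<cores P. quota T w)" for i
      by (simp add: g_def)
  qed
  then obtain T' where T': "\<And>i. T' \<le> i \<Longrightarrow> g i = g T'" by blast
  have sum_le: "(\<Sum>w<cores P. quota (T + i) w) \<le> (\<Sum>w<cores P. quota T w)" for i
    by (rule sum_mono) (use quota_mono in auto)
  have const: "quota (Suc i) w = quota i w" if i: "T + T' \<le> i" and w: "w < cores P" for i w
  proof -
    have "g (i - T) = g (Suc i - T)" using T'[of "i - T"] T'[of "Suc i - T"] i by simp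
    then have "(\<Sum>w<cores P. quota (Suc i) w) = (\<Sum>w<cores P. quota i w)"
      using sum_le[of "i - T"] sum_le[of "Suc i - T"] i by (simp add: g_def)
    then show ?thesis
      using sum_mono_inv[of "quota (Suc i)" "{..<cores P}" "quota i" w] quota_Suc i w by simp
  qed
  have F_Suc: "F (Suc i) k = F i k" if i: "T + T' \<le> i" for i k
  proof (rule ccontr)
    assume "F (Suc i) k \<noteq> F i k"
    then obtain w q c where w: "worker_at i w = Busy k (Suc q) Fetch" "worker_at (Suc i) w = Busy k q c"
      using grow[of i] unfolding grows_def by blast
    then show False using const[OF i, of w] Busy_less[OF w(1)] by (simp add: quota_def)
  qed
  have F: "F i k = F (T + T') k" if "T + T' \<le> i" for i k
    using that by (induction i rule: dec_induct) (use F_Suc in auto)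
  have 0: "0 < cores P" using valid by (simp add: valid_pipeline_def)
  obtain k q c where b: "workers (\<sigma> (T + T')) 0 = Busy k q c"
    using busy[of "T + T'" 0] 0 by (cases "workers (\<sigma> (T + T')) 0") auto
  have always: "serves i k 0" if "T + T' \<le> i" for i
    using that
  proof (induction i rule: dec_induct)
    case base
    then show ?case using b by (auto simp: serves_def)
  next
    case (step m)
    then show ?case using stay[of m 0] 0 by (auto simp: serves_def)
  qed
  obtain j where "T + T' \<le> j" "\<not> serves j k 0"
    using drains[of k "T + T'" "F (T + T') k" "T + T'" 0] F Busy_less[OF b] by blast
  then show False using always by blast
qed

text \<open>An allotment presupposes a nonempty worklist and a positive quota. If nothing were
  fetched afterwards, the worklist would stay nonempty and the first action of the new worker would
  fetch.\<close>

lemma allot_fetches: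
  assumes "allot_at \<sigma> a i k"
  shows "k < K \<and> (\<exists>j\<ge>i. F i k < F j k)"
proof -
  obtain w q where w: "a i = Worker w" "worker_at i w = Idle" "worker_at (Suc i) w = Busy k q Fetch"
    using assms by (auto simp: allot_at_def)
  from step[of i] have sch: "schedulable P (\<sigma> i) k" and q: "0 < q"
    by (cases; use w in auto)+
  have k: "k < K" using sch by (simp add: schedulable_def)
  have "\<exists>j\<ge>i. F i k < F j k"
  proof (rule ccontr)
    assume stuck: "\<not> ?thesis"
    have F: "F j k = F i k" if "i \<le> j" for j
    proof -
      have "\<not> F i k < F j k" using stuck that by blast
      then show ?thesis using F_mono[OF that, of k] by simp
    qed
    have "0 < backlog (ops P ! k) (dat i k)"
      using sch by (auto simp: schedulable_def backlog_def split: operator.splits)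
    then have "F i k < length (D i k)" using backlog[OF k, of i] by simp
    then have bl: "0 < backlog (ops P ! k) (dat j k)" if "i \<le> j" for j
      using F[OF that] backlog[OF k, of j] prefix_length_le[OF D_mono[OF that, of k]] by simp
    obtain j q' c' where j: "Suc i \<le> j" "acts k j q Fetch q' c'"
      using next_work[OF w(3)] by auto
    have "c' \<noteq> Return"
      using j(2) by cases (use bl[of j] j(1) q in \<open>auto simp: backlog_def\<close>)
    then show False using take_increases[OF k j(2)] F[of j] F[of "Suc j"] j(1) by simp
  qed
  then show ?thesis using k by blast
qed

lemma fetches:
  assumes k: "k < K" and pending: "F i k < length (D i k)"
  shows "\<exists>j\<ge>i. F i k < F j k"
proof (rule ccontr)
  assume stuck: "\<not> ?thesis"
  have F: "F j k = F i k" if "i \<le> j" for j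
  proof -
    have "\<not> F i k < F j k" using stuck that by blast
    then show ?thesis using F_mono[OF that, of k] by simp
  qed
  have no_allot: "\<not> allot_at \<sigma> a j k" if "i \<le> j" for j
    using allot_fetches[of j k] F[OF that] F that by (metis le_trans less_irrefl)
  have leaves: "\<not> serves j k w" if "\<not> serves i1 k w" "i \<le> i1" "i1 \<le> j" for i1 j w
    using that(3)
  proof (induction j rule: dec_induct)
    case (step m)
    show ?case
    proof
      assume "serves (Suc m) k w"
      then obtain q c where b: "worker_at (Suc m) w = Busy k q c" by (auto simp: serves_def)
      from run.step[OF run_axioms, of m] show False
      proof cases
        case (allot w' k' q')
        then show False
          using b step no_allot[of m] that(2)
          by (cases "w' = w") (auto simp: serves_def allot_at_def)
      qed (use b step in \<open>auto simp: serves_def split: if_splits\<close>)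
    qed
  qed (fact that(1))
  have drain: "\<exists>j\<ge>i1. \<not> serves j k w" if "i \<le> i1" for i1 w
    by (rule drains[OF k _ that]) (rule F)
  \<comment> \<open>Workers leave at different times, but without allotments none comes back, so a
    common time is found by induction on their number.\<close>
  have "\<exists>T\<ge>i. \<forall>w<N. \<not> serves T k w" for N
  proof (induction N)
    case (Suc N)
    then obtain T where T: "i \<le> T" "\<And>w. w < N \<Longrightarrow> \<not> serves T k w" by blast
    obtain T' where "T \<le> T'" "\<not> serves T' k N"
      using drain[OF T(1)] by blast
    then show ?case using T leaves by (intro exI[of _ T']) (auto simp: less_Suc_eq)
  qed auto
  then obtain T where T: "i \<le> T" "\<And>w. w < cores P \<Longrightarrow> \<not> serves T k w" by blast
  have none: "allotted P (\<sigma> j) k = 0" if "T \<le> j" for j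
  proof -
    have "{w. w < cores P \<and> (\<exists>q c. worker_at j w = Busy k q c)} = {}"
      using leaves[OF T(2) T(1) that] by (auto simp: serves_def)
    then show ?thesis unfolding allotted_def by (simp only: card.empty)
  qed
  have bl: "0 < backlog (ops P ! k) (dat j k)" if "i \<le> j" for j
    using F[OF that] backlog[OF k, of j] prefix_length_le[OF D_mono[OF that, of k]] pending by simp
  have sch: "schedulable P (\<sigma> j) k" if "T \<le> j" for j
  proof (cases "ops P ! k")
    case (Partitioned n key part s0 h)
    then have "Partitioned n key part s0 h \<in> set (ops P)" using k nth_mem by metis
    \<comment> \<open>Any key shows that there is at least one partition, so having no allotted
      worker is below the permitted number.\<close>
    then have "part undefined < n" using valid unfolding valid_pipeline_def by blast
    then show ?thesis
      using Partitioned none[OF that] bl[of j] T that k by (auto simp: schedulable_def backlog_def)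
  qed (use none[OF that] bl[of j] T that k in \<open>auto simp: schedulable_def backlog_def\<close>)
  show False
  proof (cases "\<forall>n. inp n \<noteq> None")
    case True
    then obtain j where "T \<le> j" "allot_at \<sigma> a j k"
      using starve sch queries_infinite unfolding no_starvation_def by blast
    then show False using no_allot T by simp
  next
    case False
    then obtain n where n: "inp n = None" by blast
    have beyond: "inp (n + m) = None" for m
      using inputs n by (induction m) (auto simp: valid_seq_def)
    have "first (n + m) inp = first n inp" for m
      by (induction m) (simp_all add: first_Suc beyond)
    then have fin: "prefix (first m inp) (first n inp)" for m
      using first_mono[of m n inp] by (metis le_add_diff_inverse nat_le_linear prefix_order.refl)
    \<comment> \<open>A finite input bounds what each operator can ever receive, and with it the
      total number of fetches.\<close>
    define B where "B = (\<Sum>k'<K. length (stage_outputs P k' (first n inp)))"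
    have "(\<Sum>k'<K. F j k') \<le> B" for j
      unfolding B_def
    proof (rule sum_mono)
      fix k' assume "k' \<in> {..<K}"
      then have k': "k' < K" by simp
      have "prefix (D j k') (stage_outputs P k' (first (arrived (\<sigma> j)) inp))"
        using invariant.D_prefix[OF inv] k' by simp
      also have "prefix \<dots> (stage_outputs P k' (first n inp))"
        using fin by (rule stage_outputs_mono)
      finally show "F j k' \<le> length (stage_outputs P k' (first n inp))"
        using F_le[OF k', of j] prefix_length_le by fastforce
    qed
    moreover have "(\<Sum>k'<K. F i k') \<le> (\<Sum>k'<K. F j k')" if "i \<le> j" for i j
      using F_mono[OF that] by (rule sum_mono)
    ultimately obtain T' where T': "\<And>j. T' \<le> j \<Longrightarrow> (\<Sum>k'<K. F j k') = (\<Sum>k'<K. F T' k')"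
      using eventually_constant[of "\<lambda>j. \<Sum>k'<K. F j k'" B] by blast
    obtain j where j: "T + T' \<le> j" "query_at \<sigma> a j"
      using queries_infinite by (auto simp: INFM_nat_le)
    then obtain w where w: "a j = Worker w" "worker_at j w = Idle" by (auto simp: query_at_def)
    \<comment> \<open>Operator \<open>k\<close> is schedulable, so the query ends in an allotment,
      possibly to another operator, whose fetch then contradicts the constant total.\<close>
    from step[of j] have "\<exists>k'. allot_at \<sigma> a j k'"
    proof cases
      case (allot w' k' q)
      then show ?thesis using w by (auto simp: allot_at_def)
    next
      case no_work
      then show ?thesis using sch[of j] j by simp
    qed (use w in auto)
    then obtain k' m where k': "k' < K" "j \<le> m" "F j k' < F m k'"
      using allot_fetches by blast
    have "(\<Sum>k'<K. F j k') < (\<Sum>k'<K. F m k')"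
      by (rule sum_strict_mono_ex1) (use k' F_mono[OF k'(2)] in auto)
    then show False using T'[of j] T'[of m] j k' by simp
  qed
qed

lemma fetched:
  assumes "k < K" "m \<le> length (D i k)"
  shows "\<exists>j\<ge>i. m \<le> F j k"
  using assms(2)
proof (induction "m - F i k" arbitrary: i rule: less_induct)
  case less
  show ?case
  proof (cases "m \<le> F i k")
    case False
    then obtain j where j: "i \<le> j" "F i k < F j k"
      using fetches[OF assms(1), of i] less.prems by auto
    have "m \<le> length (D j k)" using less.prems prefix_length_le[OF D_mono[OF j(1), of k]] by simp
    moreover have "m - F j k < m - F i k" using False j by linarith
    ultimately show ?thesis using less.hyps[of j] j by (meson le_trans)
  qed auto
qed

section \<open>Arrival of inputs and equality of the limits\<close>

lemma arrived_mono: "i \<le> j \<Longrightarrow> arrived (\<sigma> i) \<le> arrived (\<sigma> j)"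
proof (rule lift_Suc_mono_le[of "\<lambda>i. arrived (\<sigma> i)"])
  show "arrived (\<sigma> m) \<le> arrived (\<sigma> (Suc m))" for m
    using step[of m] by cases auto
qed

lemma arrives_next:
  assumes "inp n \<noteq> None" "n \<le> arrived (\<sigma> i)"
  shows "\<exists>i. n < arrived (\<sigma> i)"
proof -
  obtain j where j: "i \<le> j" "fst (incoming (\<sigma> j)) = []" using incoming_ends by blast
  obtain m where m: "j \<le> m" "a m = Source" "incoming (\<sigma> m) = incoming (\<sigma> j)"
    using next_source by blast
  have "n \<le> arrived (\<sigma> m)" using assms(2) arrived_mono[of i m] j m by simp
  moreover have "n < arrived (\<sigma> (Suc m))" if "arrived (\<sigma> m) = n"
    using step[of m] by cases (use m j that assms in auto)
  ultimately show ?thesis by (metis le_neq_implies_less)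
qed

lemma arrives: "inp n \<noteq> None \<Longrightarrow> \<exists>i. n < arrived (\<sigma> i)"
proof (induction n)
  case 0
  then show ?case using arrives_next[of 0 0] by simp
next
  case (Suc n)
  then have "inp n \<noteq> None" using inputs by (auto simp: valid_seq_def)
  then obtain i where "Suc n \<le> arrived (\<sigma> i)" using Suc.IH by (auto simp: Suc_le_eq)
  then show ?case using arrives_next Suc.prems by blast
qed

text \<open>Along the chain, what reaches an operator is eventually fetched and then processed. By
  then more may have been received, so the sequential output is cut back to the inputs in question,
  on which the received list agrees.\<close>

lemma delivered: "k \<le> K \<Longrightarrow> \<exists>i. prefix (stage_outputs P k (first n inp)) (D i k)"
proof (induction k)
  case 0
  show ?case
  proof (induction n)
    case 0
    then show ?case by (simp add: first_def List.map_filter_def)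
  next
    case (Suc n)
    show ?case
    proof (cases "inp n")
      case None
      then show ?thesis using Suc by (simp add: first_Suc)
    next
      case (Some x)
      then obtain i where "Suc n \<le> arrived (\<sigma> i)" using arrives[of n] by (auto simp: Suc_le_eq)
      moreover obtain j where j: "i \<le> j" "fst (incoming (\<sigma> j)) = []" using incoming_ends by blast
      ultimately have "prefix (first (Suc n) inp) (first (arrived (\<sigma> j)) inp)"
        using arrived_mono[of i j] by (intro first_mono) simp
      also have "first (arrived (\<sigma> j)) inp = D j 0"
        using invariant.arrived[OF inv, of j] invariant.incoming[OF inv, of j] j by simp
      finally show ?thesis by auto
    qed
  qed
next
  case (Suc k)
  then have k: "k < K" by simp
  let ?X = "stage_outputs P k (first n inp)"
  obtain i where i: "prefix ?X (D i k)" using Suc by auto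
  obtain j where j: "i \<le> j" "length ?X \<le> F j k"
    using fetched[OF k, of "length ?X" i] prefix_length_le[OF i] by blast
  obtain m where m: "j \<le> m" "prefix (outputs (ops P ! k) (take (length ?X) (D m k))) (D m (Suc k))"
    using processed[OF k j(2)] by blast
  have "prefix ?X (D m k)" using i D_mono[of i m k] j m by (meson le_trans prefix_order.trans)
  then have "take (length ?X) (D m k) = ?X" by (auto simp: prefix_def)
  then show ?case using m by auto
qed

lemma is_ordered: "ordered P inp \<sigma>"
  unfolding ordered_def output_seq_def sequential_output_seq_def
proof (rule limit_cong_cofinal)
  have outs: "shared.outs (shared (\<sigma> i)) = D i K" for i
    using invariant.outs[OF inv] by simp
  show "prefix (shared.outs (shared (\<sigma> i))) (shared.outs (shared (\<sigma> j)))" if "i \<le> j" for i j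
    using D_mono[OF that] by (simp add: outs)
  show "prefix (sequential_outputs P (first i inp)) (sequential_outputs P (first j inp))" if "i \<le> j" for i j
    unfolding sequential_outputs_eq by (intro stage_outputs_mono first_mono that)
  show "\<exists>j. prefix (shared.outs (shared (\<sigma> i))) (sequential_outputs P (first j inp))" for i
    using invariant.outs_prefix[OF inv] by blast
  show "\<exists>j. prefix (sequential_outputs P (first i inp)) (shared.outs (shared (\<sigma> j)))" for i
    using delivered[of K i] by (simp add: outs sequential_outputs_eq)
qed

end

theorem theorem5p2:
  fixes P :: "('a, 'k, 's) pipeline" and inp :: "nat \<Rightarrow> 'a option"
    and \<sigma> :: "nat \<Rightarrow> ('a, 'k, 's) state" and a :: "nat \<Rightarrow> agent"
  assumes "valid_pipeline P" and "valid_seq inp"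
  shows "(execution P inp \<sigma> a \<longrightarrow>
            (\<forall>i. prefix (outs (shared (\<sigma> i)))
                        (sequential_outputs P (first (arrived (\<sigma> i)) inp)))) \<and>
         (complete_execution P inp \<sigma> a \<longrightarrow> ordered P inp \<sigma>)"
proof (intro conjI impI allI)
  fix i
  assume "execution P inp \<sigma> a"
  then obtain D F V where "\<And>i. invariant P inp (D i) (F i) (V i) (\<sigma> i)"
    using invariant_execution[OF assms(1)] by blast
  then show "prefix (outs (shared (\<sigma> i))) (sequential_outputs P (first (arrived (\<sigma> i)) inp))"
    by (rule invariant.outs_prefix)
next
  assume c: "complete_execution P inp \<sigma> a"
  then have e: "execution P inp \<sigma> a" by (simp add: complete_execution_def)
  obtain D F V where "\<And>i. invariant P inp (D i) (F i) (V i) (\<sigma> i)"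
    and "\<And>i. grows P (D i) (F i) (\<sigma> i) (D (Suc i)) (F (Suc i)) (\<sigma> (Suc i))"
    using invariant_execution[OF assms(1) e] by blast
  then have "run P inp \<sigma> a D F V"
    using c e assms by (intro run.intro) (auto simp: complete_execution_def execution_def)
  then show "ordered P inp \<sigma>" by (rule run.is_ordered)
qed

end
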